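(* Let $T$ and $T'$ be closed symmetric relations in Krein spaces $\mathfrak H$ and $\mathfrak H'$ with fundamental symmetries $J$ and $J'$. Assume $T$ and $T'$ have the same equal defect numbers and let $\Pi_\Gamma=(\mathfrak L,\Gamma_0,\Gamma_1)$ and $\Pi_{\Gamma'}=(\mathfrak L,\Gamma'_0,\Gamma'_1)$ be boundary triples for $T^+$ and $T'^{+}$. Let $T_0=\ker\Gamma_0$, $T'_0=\ker\Gamma'_0$, $N=T_0\cap T^\bot$, $N'=T'_0\cap T'^{\bot}$. Let $\mathcal V(\Gamma,\Gamma')$ denote the set of all relations $V\colon\mathfrak K\to\mathfrak K'$ such that $\Gamma'=\Gamma V^{-1}$. 1) There is an operator (resp. injective operator) in $\mathcal V(\Gamma,\Gamma')$ iff there is a surjection (resp. bijection) $\tau\colon T\to T'$. In particular, every operator $V\in\mathcal V(\Gamma,\Gamma')$ satisfies $V|_T=\tau$ (for such a $\tau$), $\operatorname{dom}V\supseteq T^+$, and is of the matrix form $$V=\begin{pmatrix}\tau&*&*&*\\0&w_1&w_{01}&*\\0&0&\widehat J'w_0\widehat J&*\\0&0&0&*\end{pmatrix}\colon T\,\widehat{\oplus}\,N\,\widehat{\oplus}\,\widehat J(N)\,\widehat{\oplus}\,\widehat J(T)\to T'\,\widehat{\oplus}\,N'\,\widehat{\oplus}\,\widehat J'(N')\,\widehat{\oplus}\,\widehat J'(T'),$$ where $w_{01}=\Gamma_1'^{(-1)}(\beta-\beta')\Gamma_0|_{\widehat J(N)}$. 2) There is a standard unitary operator in $\mathcal V(\Gamma,\Gamma')$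 iff $T$ and $T'$ are isomorphic. In particular, every standard unitary operator $V\in\mathcal V(\Gamma,\Gamma')$ is parametrized by a homeomorphism $B\in\mathcal B(\widehat J'(T'_0),\widehat J(T_0))$ and a bounded everywhere defined self-adjoint operator $\Theta$ in the Hilbert space $(\widehat J'(T'),[\cdot,\widehat J'\cdot]')$, namely $$V=\begin{pmatrix}B^{-1}&0\\ i\widehat J'EB^{-1}&\widehat J'B^*\widehat J\end{pmatrix}\colon\widehat J(T_0)\,\widehat{\oplus}\,T_0\to\widehat J'(T'_0)\,\widehat{\oplus}\,T'_0,$$ where $B$ is of the form $$B=\begin{pmatrix}\widehat J\tau^*\widehat J'&0\\ *&\widehat Jw_0^{-1}\widehat J'\end{pmatrix}\colon\widehat J'(T')\,\widehat{\oplus}\,\widehat J'(N')\to\widehat J(T)\,\widehat{\oplus}\,\widehat J(N)$$ and $\tau$ is a homeomorphism $T\to T'$. The operator $E=E_0\,\widehat{\oplus}\,\Theta$ is a bounded everywhere defined canonical self-adjoint extension of the closed symmetric operator $E_0=-i\widehat J'\Gamma_1'^{(-1)}(\beta-\beta')\Gamma'_0|_{\widehat J'(N')}$ in the Hilbert space $(\widehat J'(T'_0),[\cdot,\widehat J'\cdot]')$.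
   Context: All spaces are complex; all relations, operators, surjections, bijections are linear. A relation from $X$ to $Y$ is a linear subset of $X\times Y$; operators are identified with their graphs; inverses and products are in the sense of relations. A Krein space $(\mathfrak H,[\cdot,\cdot])$ with fundamental symmetry $J$ has inner product conjugate-linear in the first factor, $(\mathfrak H,[\cdot,J\cdot])$ being a Hilbert space. $T^+=\{(g,g')\in\mathfrak H^2:[f,g']=[f',g]\ \forall(f,f')\in T\}$; $T$ is symmetric if $T\subseteq T^+$. $T$ has equal defect numbers $(d,d)$, $d\le\infty$, if $\dim\ker(JT^+-iI)=\dim\ker(JT^++iI)=d$, $JT^+=\{(f,Jf'):(f,f')\in T^+\}$. $\mathfrak K=\mathfrak H^2$ is a Krein space with $[\hat f,\hat g]=-i[f,g']+i[f',g]$, $\hat f=(f,f')$, $\hat g=(g,g')$, and fundamental symmetry $\widehat J(f,f')=(-iJf',iJf)$; likewise $\mathfrak K'=\mathfrak H'^2$ with $[\cdot,\cdot]'$, $\widehat J'$. The symbol $\bot$ in $\mathfrak K$ refers to the Hilbert inner product $[\cdot,\widehat J\cdot]$ (and in $\mathfrak K'$ to $[\cdot,\widehat J'\cdot]'$), with respect to which $\widehat\oplus$ denotes an orthogonal (componentwise) sum; one has $\mathfrak K=T\,\widehat\oplus\,N\,\widehat\oplus\,\widehat J(N)\,\widehat\oplus\,\widehat J(T)$. Closed linear subsets of $\mathfrak K,\mathfrak K'$ are regarded as Hilbert spaces with these inner products, and $B^*,\tau^*$ are Hilbert space adjoints. $T$ and $T'$ are isomorphic if there is a homeomorphism (bounded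 bijective operator with bounded inverse) $T\to T'$ between these Hilbert spaces. $\mathcal B(X,Y)$ is the set of bounded everywhere defined operators. A standard unitary operator $V\colon\mathfrak K\to\mathfrak K'$ is a bounded everywhere defined bijective operator preserving the indefinite inner products. For $E=E_0\,\widehat\oplus\,\Theta$ graphs are summed, i.e. $E$ is the orthogonal sum of $E_0$ (acting in $\widehat J'(N')$) and $\Theta$ (acting in $\widehat J'(T')$). A canonical extension of a closed symmetric operator $E_0$ is one lying between $E_0$ and its adjoint. Boundary triple: $(\mathfrak L,\Gamma_0,\Gamma_1)$, $(\mathfrak L,\langle\cdot,\cdot\rangle)$ a Hilbert space, is a boundary triple for $T^+$ if $\Gamma=(\Gamma_0,\Gamma_1)\colon T^+\to\mathfrak L^2$ is surjective and $[f,g']-[f',g]=\langle\Gamma_0\hat f,\Gamma_1\hat g\rangle-\langle\Gamma_1\hat f,\Gamma_0\hat g\rangle$ for all $\hat f,\hat g\in T^+$. The operators $\Gamma_0|_{\widehat J(N)}$ and $\Gamma_1|_N$ are bijective onto $\mathfrak L$; put $\Gamma_0^{(-1)}=(\Gamma_0|_{\widehat J(N)})^{-1}$, $\Gamma_1^{(-1)}=(\Gamma_1|_N)^{-1}$, $\beta=\Gamma_1\Gamma_0^{(-1)}$, and analogously $\Gamma_0'^{(-1)}=(\Gamma'_0|_{\widehat J'(N')})^{-1}$, $\Gamma_1'^{(-1)}=(\Gamma'_1|_{N'})^{-1}$, $\beta'=\Gamma'_1\Gamma_0'^{(-1)}$. Further $w_0=\widehat J'\Gamma_0'^{(-1)}\Gamma_0\widehat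 J|_N\colon N\to N'$ and $w_1=\Gamma_1'^{(-1)}\Gamma_1|_N\colon N\to N'$. An asterisk entry in a matrix denotes an unspecified operator between the corresponding components.
   Formalization: In 1), T ⊆ dom V is added for the injective/bijection equivalence and for the claims on every operator V. In 2), E = E_0 ⊕ Θ is claimed exactly for those V with V(Ĵ(N)) ⊥ T'; for other standard unitary V, E is only self-adjoint with diagonal blocks Θ, E_0. Both fail as stated. *)

theory Defs
  imports "HOL-Analysis.Analysis" "HOL-Library.Extended_Nat"
begin

section \<open>Complex Hilbert spaces\<close>

class complex_vector = real_vector +
  fixes scaleC :: "complex \<Rightarrow> 'a \<Rightarrow> 'a" (infixr \<open>*\<^sub>C\<close> 75)
  assumes scaleC_add_right: "a *\<^sub>C (x + y) = a *\<^sub>C x + a *\<^sub>C y"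
    and scaleC_add_left: "(a + b) *\<^sub>C x = a *\<^sub>C x + b *\<^sub>C x"
    and scaleC_scaleC: "a *\<^sub>C (b *\<^sub>C x) = (a * b) *\<^sub>C x"
    and scaleR_scaleC: "scaleR r x = complex_of_real r *\<^sub>C x"
begin

lemma scaleC_one: "1 *\<^sub>C x = x"
  using scaleR_scaleC[of 1 x] scaleR_one[of x] by simp

end

global_interpretation complex_vector:
  vector_space "scaleC :: complex \<Rightarrow> 'a \<Rightarrow> 'a::complex_vector"
  defines csubspace = complex_vector.subspace
    and cspan = complex_vector.span
    and cdependent = complex_vector.dependent
    and cdim_nat = complex_vector.dim
  by unfold_locales
     (simp_all add: scaleC_add_right scaleC_add_left scaleC_scaleC scaleC_one)

text \<open>The complex inner product is conjugate-linear in the first factor; positivity and the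
  norm are inherited from its real part, the library's \<open>inner\<close>.\<close>

class chilbert_space = complex_vector + real_inner + complete_space +
  fixes cinner :: "'a \<Rightarrow> 'a \<Rightarrow> complex"
  assumes cinner_commute: "cinner x y = cnj (cinner y x)"
    and cinner_add_right: "cinner x (y + z) = cinner x y + cinner x z"
    and cinner_scaleC_right: "cinner x (c *\<^sub>C y) = c * cinner x y"
    and Re_cinner: "Re (cinner x y) = inner x y"

instantiation prod :: (complex_vector, complex_vector) complex_vector
begin

definition scaleC_prod :: "complex \<Rightarrow> 'a \<times> 'b \<Rightarrow> 'a \<times> 'b"
  where "scaleC_prod c x = (c *\<^sub>C fst x, c *\<^sub>C snd x)"

instance
  by standard
     (simp_all add: scaleC_prod_def scaleC_add_right scaleC_add_left scaleC_scaleC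
        scaleR_prod_def scaleR_scaleC)

end

instantiation prod :: (chilbert_space, chilbert_space) chilbert_space
begin

definition cinner_prod :: "'a \<times> 'b \<Rightarrow> 'a \<times> 'b \<Rightarrow> complex"
  where "cinner_prod x y = cinner (fst x) (fst y) + cinner (snd x) (snd y)"

instance
proof
  fix x y z :: "'a \<times> 'b" and c :: complex
  show "cinner x y = cnj (cinner y x)"
    unfolding cinner_prod_def complex_cnj_add
    using cinner_commute[of "fst x" "fst y"] cinner_commute[of "snd x" "snd y"] by simp
  show "cinner x (y + z) = cinner x y + cinner x z"
    by (simp add: cinner_prod_def cinner_add_right)
  show "cinner x (c *\<^sub>C y) = c * cinner x y"
    by (simp add: cinner_prod_def scaleC_prod_def cinner_scaleC_right distrib_left)
  show "Re (cinner x y) = inner x y"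
    by (simp add: cinner_prod_def Re_cinner inner_prod_def)
qed

end

text \<open>Dimension in $\{0, 1, \dots, \infty\}$; \<open>cdim_nat\<close> does not single out the
  infinite-dimensional case.\<close>

definition cdim :: "'a::complex_vector set \<Rightarrow> enat"
  where "cdim S = (if \<exists>B. finite B \<and> S \<subseteq> cspan B then enat (cdim_nat S) else \<infinity>)"

definition orth :: "'a::chilbert_space set \<Rightarrow> 'a set"
  where "orth S = {g. \<forall>f\<in>S. cinner f g = 0}"


section \<open>Operators on linear subsets\<close>

text \<open>An operator with domain \<open>X\<close> is a function of which only the values on \<open>X\<close> matter.
  Relations, and graphs of operators, are sets of pairs; an operator among the linear relations
  is one that is \<open>single_valued\<close>.\<close>

definition clinear_on :: "'a::complex_vector set \<Rightarrow> ('a \<Rightarrow> 'b::complex_vector) \<Rightarrow> bool"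
  where "clinear_on X f \<longleftrightarrow>
    (\<forall>x\<in>X. \<forall>y\<in>X. f (x + y) = f x + f y) \<and> (\<forall>c. \<forall>x\<in>X. f (c *\<^sub>C x) = c *\<^sub>C f x)"

definition lin_op :: "'a::complex_vector set \<Rightarrow> 'b::complex_vector set \<Rightarrow> ('a \<Rightarrow> 'b) \<Rightarrow> bool"
  where "lin_op X Y f \<longleftrightarrow> clinear_on X f \<and> f ` X \<subseteq> Y"

definition graph_on :: "'a set \<Rightarrow> ('a \<Rightarrow> 'b) \<Rightarrow> ('a \<times> 'b) set"
  where "graph_on X f = {(x, f x) | x. x \<in> X}"

definition bounded_op :: "'a::chilbert_space set \<Rightarrow> 'b::chilbert_space set \<Rightarrow> ('a \<Rightarrow> 'b) \<Rightarrow> bool"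
  where "bounded_op X Y f \<longleftrightarrow> lin_op X Y f \<and> (\<exists>K. \<forall>x\<in>X. norm (f x) \<le> K * norm x)"

definition homeo_op :: "'a::chilbert_space set \<Rightarrow> 'b::chilbert_space set \<Rightarrow> ('a \<Rightarrow> 'b) \<Rightarrow> bool"
  where "homeo_op X Y f \<longleftrightarrow>
    bounded_op X Y f \<and> bij_betw f X Y \<and> bounded_op Y X (inv_into X f)"

definition isomorphic_subspaces :: "'a::chilbert_space set \<Rightarrow> 'b::chilbert_space set \<Rightarrow> bool"
  where "isomorphic_subspaces X Y \<longleftrightarrow> (\<exists>f. homeo_op X Y f)"

text \<open>Hilbert space adjoint of a relation from \<open>X\<close> to \<open>Y\<close>, where the closed linear subsets
  \<open>X\<close>, \<open>Y\<close> are Hilbert spaces in their own right.\<close>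

definition adj_rel ::
    "'a::chilbert_space set \<Rightarrow> 'b::chilbert_space set \<Rightarrow> ('a \<times> 'b) set \<Rightarrow> ('b \<times> 'a) set"
  where "adj_rel X Y R =
    {(y, x). y \<in> Y \<and> x \<in> X \<and> (\<forall>(u, v)\<in>R. cinner v y = cinner u x)}"

text \<open>The same adjoint as a function on \<open>Y\<close>, for \<open>f\<close> bounded from \<open>X\<close> to \<open>Y\<close>.\<close>

definition adj_op ::
    "'a::chilbert_space set \<Rightarrow> 'b::chilbert_space set \<Rightarrow> ('a \<Rightarrow> 'b) \<Rightarrow> 'b \<Rightarrow> 'a"
  where "adj_op X Y f y = (THE x. (y, x) \<in> adj_rel X Y (graph_on X f))"

definition bounded_selfadjoint :: "'a::chilbert_space set \<Rightarrow> ('a \<Rightarrow> 'a) \<Rightarrow> bool"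
  where "bounded_selfadjoint X A \<longleftrightarrow>
    bounded_op X X A \<and> adj_rel X X (graph_on X A) = graph_on X A"

definition closed_symmetric_op ::
    "'a::chilbert_space set \<Rightarrow> 'a set \<Rightarrow> ('a \<Rightarrow> 'a) \<Rightarrow> bool"
  where "closed_symmetric_op X D A \<longleftrightarrow>
    D \<subseteq> X \<and> csubspace D \<and> lin_op D X A \<and> closed (graph_on D A) \<and>
    graph_on D A \<subseteq> adj_rel X X (graph_on D A)"

definition graph_sum ::
    "('a::plus \<times> 'b::plus) set \<Rightarrow> ('a \<times> 'b) set \<Rightarrow> ('a \<times> 'b) set"
  where "graph_sum R S = {(x + u, y + v) | x y u v. (x, y) \<in> R \<and> (u, v) \<in> S}"

text \<open>\<open>has_matrix V [X\<^sub>1,\<dots>,X\<^sub>n] [Y\<^sub>1,\<dots>,Y\<^sub>m] M\<close>: \<open>V\<close> is the operator with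
  domain \<open>X\<^sub>1 + \<dots> + X\<^sub>n\<close> given by the matrix \<open>M\<close> (a list of rows) whose
  \<open>(i,j)\<close> entry is a linear operator from \<open>X\<^sub>j\<close> to \<open>Y\<^sub>i\<close>.\<close>

definition has_matrix ::
    "('a::complex_vector \<times> 'b::complex_vector) set \<Rightarrow> 'a set list \<Rightarrow> 'b set list
      \<Rightarrow> ('a \<Rightarrow> 'b) list list \<Rightarrow> bool"
  where "has_matrix V Xs Ys M \<longleftrightarrow>
    list_all2 (\<lambda>Y row. list_all2 (\<lambda>X f. lin_op X Y f) Xs row) Ys M \<and>
    V = {(sum_list xs, \<Sum>row\<leftarrow>M. \<Sum>(f, x)\<leftarrow>zip row xs. f x) | xs.
           list_all2 (\<lambda>x X. x \<in> X) xs Xs}"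


section \<open>Krein spaces\<close>

text \<open>The Hilbert space structure of the type is the one of \<open>[\<cdot>,J\<cdot>]\<close>.\<close>

locale krein_space =
  fixes ip :: "'h::chilbert_space \<Rightarrow> 'h \<Rightarrow> complex"
    and J :: "'h \<Rightarrow> 'h"
  assumes ip_commute: "ip f g = cnj (ip g f)"
    and ip_add_right: "ip f (g + h) = ip f g + ip f h"
    and ip_scaleC_right: "ip f (c *\<^sub>C g) = c * ip f g"
    and J_linear: "clinear_on UNIV J"
    and J_involution: "J (J f) = f"
    and ip_J: "ip f (J g) = cinner f g"

definition hat_ip ::
    "('h \<Rightarrow> 'h \<Rightarrow> complex) \<Rightarrow> 'h \<times> 'h \<Rightarrow> 'h \<times> 'h \<Rightarrow> complex"
  where "hat_ip ip x y = - \<i> * ip (fst x) (snd y) + \<i> * ip (snd x) (fst y)"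

definition hat_J :: "('h::complex_vector \<Rightarrow> 'h) \<Rightarrow> 'h \<times> 'h \<Rightarrow> 'h \<times> 'h"
  where "hat_J J x = ((- \<i>) *\<^sub>C J (snd x), \<i> *\<^sub>C J (fst x))"

text \<open>In particular the Hilbert inner product of the doubled Krein space is the
  \<open>cinner\<close> of the product type.\<close>

lemma krein_space_hat:
  assumes "krein_space ip J"
  shows "krein_space (hat_ip ip) (hat_J J)"
proof -
  interpret krein_space ip J by fact
  have Jadd: "J (x + y) = J x + J y" and Jsc: "J (c *\<^sub>C x) = c *\<^sub>C J x" for x y c
    using J_linear by (auto simp: clinear_on_def)
  have Jneg: "J (- x) = - J x" for x
    using Jsc[of "-1" x] by (simp add: scaleC_one)
  have ipneg: "ip f (- g) = - ip f g" for f g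
    using ip_scaleC_right[of f "-1" g] by (simp add: scaleC_one)
  show ?thesis
  proof
    fix f g h :: "'a \<times> 'a" and c :: complex
    show "hat_ip ip f g = cnj (hat_ip ip g f)"
      using ip_commute[of "fst f" "snd g"] ip_commute[of "snd f" "fst g"]
      by (simp add: hat_ip_def)
    show "hat_ip ip f (g + h) = hat_ip ip f g + hat_ip ip f h"
      by (simp add: hat_ip_def ip_add_right algebra_simps)
    show "hat_ip ip f (c *\<^sub>C g) = c * hat_ip ip f g"
      by (simp add: hat_ip_def scaleC_prod_def ip_scaleC_right algebra_simps)
    show "clinear_on UNIV (hat_J J)"
      by (simp add: clinear_on_def hat_J_def scaleC_prod_def Jadd Jsc scaleC_add_right
          scaleC_scaleC mult.commute)
    show "hat_J J (hat_J J f) = f"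
      by (simp add: hat_J_def Jsc Jneg J_involution scaleC_scaleC scaleC_one)
    show "hat_ip ip f (hat_J J g) = cinner f g"
      by (simp add: hat_ip_def hat_J_def ipneg ip_scaleC_right ip_J cinner_prod_def
          flip: mult.assoc)
  qed
qed

definition krein_adj :: "('h \<Rightarrow> 'h \<Rightarrow> complex) \<Rightarrow> ('h \<times> 'h) set \<Rightarrow> ('h \<times> 'h) set"
  where "krein_adj ip T = {(g, g'). \<forall>(f, f')\<in>T. ip f g' = ip f' g}"

definition krein_symmetric :: "('h \<Rightarrow> 'h \<Rightarrow> complex) \<Rightarrow> ('h \<times> 'h) set \<Rightarrow> bool"
  where "krein_symmetric ip T \<longleftrightarrow> T \<subseteq> krein_adj ip T"

definition rel_ker :: "('a \<times> 'b::zero) set \<Rightarrow> 'a set"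
  where "rel_ker R = {x. (x, 0) \<in> R}"

definition rel_minus :: "('a::complex_vector \<times> 'a) set \<Rightarrow> complex \<Rightarrow> ('a \<times> 'a) set"
  where "rel_minus R z = {(x, y - z *\<^sub>C x) | x y. (x, y) \<in> R}"

definition equal_defect ::
    "('h::complex_vector \<Rightarrow> 'h \<Rightarrow> complex) \<Rightarrow> ('h \<Rightarrow> 'h) \<Rightarrow> ('h \<times> 'h) set \<Rightarrow> enat \<Rightarrow> bool"
  where "equal_defect ip J T d \<longleftrightarrow>
    (let JT = {(f, J f') | f f'. (f, f') \<in> krein_adj ip T}
     in cdim (rel_ker (rel_minus JT \<i>)) = d \<and> cdim (rel_ker (rel_minus JT (- \<i>))) = d)"

definition standard_unitary ::
    "('h::chilbert_space \<Rightarrow> 'h \<Rightarrow> complex) \<Rightarrow> ('k::chilbert_space \<Rightarrow> 'k \<Rightarrow> complex)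
      \<Rightarrow> ('h \<times> 'k) set \<Rightarrow> bool"
  where "standard_unitary ip ip' V \<longleftrightarrow>
    csubspace V \<and> single_valued V \<and> Domain V = UNIV \<and>
    single_valued (V\<inverse>) \<and> Range V = UNIV \<and>
    (\<exists>K. \<forall>(x, y)\<in>V. norm y \<le> K * norm x) \<and>
    (\<forall>(x, y)\<in>V. \<forall>(u, v)\<in>V. ip' y v = ip x u)"


section \<open>Boundary triples\<close>

text \<open>Only the values of \<open>\<Gamma>0\<close>, \<open>\<Gamma>1\<close> on \<open>T\<^sup>+\<close> matter; the Hilbert space
  of the triple is the type \<open>'l\<close>.\<close>

definition boundary_triple ::
    "('h::chilbert_space \<Rightarrow> 'h \<Rightarrow> complex) \<Rightarrow> ('h \<times> 'h) set
      \<Rightarrow> ('h \<times> 'h \<Rightarrow> 'l::chilbert_space) \<Rightarrow> ('h \<times> 'h \<Rightarrow> 'l) \<Rightarrow> bool"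
  where "boundary_triple ip T \<Gamma>0 \<Gamma>1 \<longleftrightarrow>
    clinear_on (krein_adj ip T) \<Gamma>0 \<and> clinear_on (krein_adj ip T) \<Gamma>1 \<and>
    (\<lambda>x. (\<Gamma>0 x, \<Gamma>1 x)) ` krein_adj ip T = UNIV \<and>
    (\<forall>x \<in> krein_adj ip T. \<forall>y \<in> krein_adj ip T.
       ip (fst x) (snd y) - ip (snd x) (fst y)
         = cinner (\<Gamma>0 x) (\<Gamma>1 y) - cinner (\<Gamma>1 x) (\<Gamma>0 y))"

definition triple_graph ::
    "('h::chilbert_space \<Rightarrow> 'h \<Rightarrow> complex) \<Rightarrow> ('h \<times> 'h) set
      \<Rightarrow> ('h \<times> 'h \<Rightarrow> 'l) \<Rightarrow> ('h \<times> 'h \<Rightarrow> 'l) \<Rightarrow> (('h \<times> 'h) \<times> ('l \<times> 'l)) set"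
  where "triple_graph ip T \<Gamma>0 \<Gamma>1 = graph_on (krein_adj ip T) (\<lambda>x. (\<Gamma>0 x, \<Gamma>1 x))"

text \<open>\<open>\<Gamma>' = \<Gamma> V\<^sup>-\<^sup>1\<close>; the library's \<open>R O S\<close> applies \<open>R\<close> first.
  Two pitfalls. An operator \<open>V\<close> in this set need not be defined on all of \<open>T = ker \<Gamma>\<close>:
  if \<open>T' = {0}\<close>, its domain may even meet \<open>T\<close> only in \<open>0\<close>.
  And \<open>\<Gamma>'\<close> does not see the \<open>T'\<close>-component of \<open>V x\<close>, so that component is arbitrary for \<open>x \<in> T\<^sup>+\<close> orthogonal to \<open>T\<close>, even for
  standard unitary \<open>V\<close>.\<close>

definition transforms ::
    "('a::complex_vector \<times> 'l) set \<Rightarrow> ('b::complex_vector \<times> 'l) set \<Rightarrow> ('a \<times> 'b) set set"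
  where "transforms \<Gamma> \<Gamma>' = {V. csubspace V \<and> \<Gamma>' = V\<inverse> O \<Gamma>}"

end

theory Submission
  imports Defs
begin

text \<open>The doubled Krein space is treated as one Krein space with fundamental symmetry \<open>J\<close> (without the hat), so that
$[x,y] = \langle x, Jy\rangle$; a relation such as \<open>T\<close> is then just a neutral closed subspace.  Everything rests on the geometry of one boundary triple and on a
single pairing identity between two of them.

\<^bold>\<open>One triple.\<close>  Green's identity and surjectivity of \<open>\<Gamma> = (\<Gamma>0, \<Gamma>1)\<close> show that \<open>T = ker \<Gamma>\<close> and that
\<open>T0 = ker \<Gamma>0\<close> is its own companion: \<open>orth T0 = J ` T0\<close> (\<open>ip_orth_T0\<close>).  Hence the space splits orthogonally
as \<open>T0 + J T0\<close>, with \<open>T0 = T + N\<close>, and \<open>T\<^sup>+ = T + N + J N\<close>.  On \<open>J N\<close> the map \<open>\<Gamma>0\<close> is bijective, on \<open>N\<close> the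
map \<open>\<Gamma>1\<close> is, and Green's identity couples the two by
$\langle \Gamma_0 u, \Gamma_1 n\rangle = i \langle u, Jn\rangle$ (\<open>green_J_N_N\<close>).

\<^bold>\<open>Two triples.\<close>  The coupling gives $\langle w_0 m, w_1 n\rangle = \langle m, n\rangle$, so \<open>w0\<close> and \<open>w1\<close> are
inverse adjoints of one another.  An everywhere defined operator that has an everywhere defined formal adjoint is
bounded (\<open>bounded_of_formal_adjoint\<close>); this makes \<open>w0\<close> a homeomorphism and \<open>E0\<close> bounded.

\<^bold>\<open>Operators.\<close>  An operator \<open>V\<close> belongs to \<open>\<V>\<close> iff it intertwines the boundary maps on \<open>dom V \<inter> T\<^sup>+\<close> and reaches all
of \<open>T'\<^sup>+\<close> from there (\<open>graph_in_\<V>_iff\<close>).  It therefore maps \<open>T \<inter> dom V\<close> onto \<open>T'\<close>, and the boundary values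
determine the image of \<open>N\<close> and \<open>J N\<close> up to the component in \<open>T' = ker \<Gamma>'\<close>: these are the columns of the \<open>4 \<times> 4\<close> matrix.
Conversely a surjection \<open>T \<rightarrow> T'\<close> extends to \<open>T\<^sup>+\<close> by lifting the boundary values of \<open>x\<close> to the primed space
(\<open>operator_of_surjection\<close>).

\<^bold>\<open>Unitary operators.\<close>  A standard unitary \<open>V \<in> \<V>\<close> maps \<open>T0\<close> onto \<open>T0'\<close>, so it is lower triangular with respect to
\<open>J T0 + T0\<close>.  Write its first diagonal entry as \<open>inverse B\<close> and the lower left one as \<open>i J' E (inverse B)\<close>.  Preservation of
the indefinite product says exactly that the second diagonal entry is $J' B^* J$ and that \<open>E\<close> is symmetric.
The action on \<open>T\<close> and on \<open>J N\<close> identifies the three prescribed entries of \<open>B\<close>, and boundary values on \<open>J N\<close> show that the corner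
of \<open>E\<close> on \<open>J' N'\<close> is \<open>E0\<close>.  The off-diagonal corners of \<open>E\<close> vanish precisely when \<open>V\<close> sends \<open>J N\<close> into the complement of \<open>T'\<close>.
The same computations read backwards turn any parameters \<open>(B, \<Theta>, \<tau>)\<close> into such a unitary operator
(\<open>unitary_of_parameters\<close>), and \<open>\<Theta> = 0\<close> with a diagonal \<open>B\<close> yields one for every homeomorphism \<open>\<tau>\<close>.\<close>

section \<open>Orthogonal projections in complex Hilbert spaces\<close>

lemma cinner_add_left: "cinner (x + y) z = cinner x z + cinner y (z::'a::chilbert_space)"
  using arg_cong[OF cinner_add_right[of z x y], of cnj] by (simp flip: cinner_commute)

lemma cinner_scaleC_left: "cinner (c *\<^sub>C x) y = cnj c * cinner x (y::'a::chilbert_space)"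
  using arg_cong[OF cinner_scaleC_right[of y c x], of cnj] by (simp flip: cinner_commute)

lemma scaleC_minus1: "(-1) *\<^sub>C x = - (x::'a::complex_vector)"
  using complex_vector.scale_minus_left[of 1 x] by (simp add: scaleC_one)

lemma cinner_minus_right [simp]: "cinner x (- y) = - cinner x (y::'a::chilbert_space)"
  using cinner_scaleC_right[of x "-1" y] by (simp add: scaleC_minus1)

lemma cinner_minus_left [simp]: "cinner (- x) y = - cinner x (y::'a::chilbert_space)"
  using cinner_scaleC_left[of "-1" x y] by (simp add: scaleC_minus1)

lemma cinner_zero_right [simp]: "cinner x 0 = (0::complex)" for x :: "'a::chilbert_space"
  using cinner_scaleC_right[of x 0 0] by simp

lemma cinner_zero_left [simp]: "cinner 0 x = (0::complex)" for x :: "'a::chilbert_space"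
  using cinner_scaleC_left[of 0 0 x] by simp

lemma cinner_diff_right: "cinner x (y - z) = cinner x y - cinner x (z::'a::chilbert_space)"
  using cinner_add_right[of x y "- z"] by simp

lemma cinner_diff_left: "cinner (x - y) z = cinner x z - cinner y (z::'a::chilbert_space)"
  using cinner_add_left[of x "- y" z] by simp

lemma cinner_self: "cinner x x = complex_of_real ((norm x)\<^sup>2)" for x :: "'a::chilbert_space"
proof -
  have "Im (cinner x x) = 0" using arg_cong[OF cinner_commute[of x x], of Im] by simp
  then show ?thesis by (simp add: complex_eq_iff Re_cinner dot_square_norm)
qed

lemma cinner_self_eq_0 [simp]: "cinner x x = 0 \<longleftrightarrow> x = 0" for x :: "'a::chilbert_space"
  by (simp add: cinner_self)

lemma norm_scaleC: "norm (c *\<^sub>C x) = cmod c * norm x" for x :: "'a::chilbert_space"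
proof -
  have "complex_of_real ((norm (c *\<^sub>C x))\<^sup>2) = cnj c * c * complex_of_real ((norm x)\<^sup>2)"
    using cinner_self[of "c *\<^sub>C x"] cinner_self[of x] by (simp add: cinner_scaleC_left cinner_scaleC_right mult_ac)
  also have "\<dots> = complex_of_real ((cmod c * norm x)\<^sup>2)"
    using complex_norm_square[of c] by (simp add: power_mult_distrib mult.commute)
  finally show ?thesis
    unfolding of_real_eq_iff by (subst (asm) power2_eq_iff_nonneg) auto
qed

lemma cinner_cauchy_schwarz: "cmod (cinner x y) \<le> norm x * norm y" for x :: "'a::chilbert_space"
proof (cases "cinner x y = 0")
  case False
  define c where "c = cnj (cinner x y) / cmod (cinner x y)"
  have c: "cmod c = 1" using False by (simp add: c_def norm_divide)
  have "cinner x (c *\<^sub>C y) = cmod (cinner x y)"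
    using False by (simp add: c_def cinner_scaleC_right complex_norm_square[symmetric] 
       field_simps power2_eq_square)
  then have "cmod (cinner x y) = inner x (c *\<^sub>C y)"
    by (simp flip: Re_cinner)
  also have "\<dots> \<le> norm x * norm (c *\<^sub>C y)" by (rule norm_cauchy_schwarz)
  finally show ?thesis by (simp add: norm_scaleC c)
qed auto

lemma cinner_ext: "(\<And>z. z \<in> S \<Longrightarrow> cinner z x = cinner z y) \<Longrightarrow> x - y \<in> S \<Longrightarrow> x = y"
  for x y :: "'a::chilbert_space"
  using cinner_self_eq_0[of "x - y"] by (simp add: cinner_diff_right)

lemma tendsto_cinner [tendsto_intros]:
  assumes "(f \<longlongrightarrow> a) F"
  shows "((\<lambda>n. cinner x (f n)) \<longlongrightarrow> cinner x (a::'a::chilbert_space)) F"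
proof -
  have lim: "((\<lambda>n. norm x * norm (f n - a)) \<longlongrightarrow> norm x * 0) F"
    by (intro tendsto_mult tendsto_const tendsto_norm_zero LIM_zero assms)
  have "((\<lambda>n. cinner x (f n) - cinner x a) \<longlongrightarrow> 0) F"
    by (rule Lim_null_comparison[OF _ lim[unfolded mult_zero_right]])
       (simp add: cinner_cauchy_schwarz flip: cinner_diff_right)
  then show ?thesis by (simp add: LIM_zero_iff)
qed

lemma closed_orth: "closed (orth S)"
proof -
  have "orth S = (\<Inter>f\<in>S. {g. cinner f g = 0})" by (auto simp: orth_def)
  moreover have "closed {g. cinner f g = 0}" for f :: 'a
    by (intro closed_Collect_eq continuous_on_const)
       (auto simp: continuous_on_def intro!: tendsto_cinner tendsto_ident_at)
  ultimately show ?thesis by (simp add: closed_INT)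
qed

lemma csubspace_orth: "csubspace (orth S)"
  by (simp add: complex_vector.subspace_def orth_def cinner_add_right cinner_scaleC_right)

lemma orth_sym: "x \<in> S \<Longrightarrow> y \<in> orth S \<Longrightarrow> cinner y x = 0"
  using cinner_commute[of y x] by (simp add: orth_def)

lemma orthD: "y \<in> orth S \<Longrightarrow> x \<in> S \<Longrightarrow> cinner x y = 0"
  by (simp add: orth_def)

lemma orth_Int_zero: "x \<in> S \<Longrightarrow> x \<in> orth S \<Longrightarrow> x = 0"
  using orthD[of x S x] by simp

lemma csubspace_scaleR: "csubspace S \<Longrightarrow> x \<in> S \<Longrightarrow> r *\<^sub>R x \<in> S"
  by (simp add: complex_vector.subspace_scale scaleR_scaleC)

lemma parallelogram_law: "(norm (x + y))\<^sup>2 + (norm (x - y))\<^sup>2 = 2 * (norm x)\<^sup>2 + 2 * (norm y)\<^sup>2"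
  for x y :: "'a::real_inner"
  by (simp add: power2_norm_eq_inner algebra_simps inner_commute)

text \<open>In infinite dimensions bounded closed sets need not be compact, so the minimizer comes from completeness: by the
parallelogram law two almost optimal points are close to each other, because their midpoint lies in \<open>S\<close> and
cannot be closer to \<open>x\<close> than the infimum.\<close>

lemma closest_point_exists:
  fixes S :: "'a::chilbert_space set"
  assumes S: "csubspace S" and "closed S"
  shows "\<exists>s\<in>S. \<forall>t\<in>S. dist x s \<le> dist x t"
proof -
  define d where "d = Inf ((\<lambda>s. dist x s) ` S)"
  have S0: "0 \<in> S" using S by (rule complex_vector.subspace_0)
  have bdd: "bdd_below ((\<lambda>s. dist x s) ` S)"
    by (rule bdd_belowI2[where m=0]) simp
  have d_le: "d \<le> dist x t" if "t \<in> S" for t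
    unfolding d_def by (rule cINF_lower[OF bdd that])
  have d0: "0 \<le> d"
    unfolding d_def using S0 by (intro cINF_greatest) auto
  have "\<exists>s\<in>S. dist x s < d + 1 / Suc n" for n
    using cINF_less_iff[OF _ bdd, of "d + 1 / Suc n"] S0 unfolding d_def[symmetric] by auto
  then obtain s where s: "\<And>n. s n \<in> S" "\<And>n. dist x (s n) < d + 1 / Suc n" by metis
  have near: "(dist (s m) (s n))\<^sup>2 \<le> (8 * d + 4) * (1 / Suc k)" if "m \<ge> k" "n \<ge> k" for m n k
  proof -
    define e where "e = 1 / real (Suc k)"
    have e: "0 \<le> e" "e \<le> 1" by (auto simp: e_def)
    have le: "dist x (s j) \<le> d + e" if "j \<ge> k" for j
    proof -
      have "1 / real (Suc j) \<le> e" using that by (simp add: e_def frac_le)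
      then show ?thesis using s(2)[of j] by simp
    qed
    have "(1/2) *\<^sub>R (s m + s n) \<in> S"
      using S s(1) by (intro csubspace_scaleR complex_vector.subspace_add)
    from d_le[OF this] have "2 * d \<le> 2 * norm (x - (1/2) *\<^sub>R (s m + s n))"
      by (simp add: dist_norm)
    also have "\<dots> = norm (2 *\<^sub>R (x - (1/2) *\<^sub>R (s m + s n)))" by simp
    also have "2 *\<^sub>R (x - (1/2) *\<^sub>R (s m + s n)) = (x - s m) + (x - s n)"
      by (simp add: algebra_simps scaleR_2)
    finally have "(2 * d)\<^sup>2 \<le> (norm ((x - s m) + (x - s n)))\<^sup>2"
      using d0 by (intro power_mono) auto
    moreover have "(norm (x - s m))\<^sup>2 \<le> (d + e)\<^sup>2" "(norm (x - s n))\<^sup>2 \<le> (d + e)\<^sup>2"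
      using le[OF that(1)] le[OF that(2)] by (auto simp: dist_norm intro!: power_mono)
    moreover have "norm ((x - s m) - (x - s n)) = dist (s m) (s n)"
      by (simp add: dist_norm norm_minus_commute)
    ultimately have "(dist (s m) (s n))\<^sup>2 \<le> 4 * (d + e)\<^sup>2 - 4 * d\<^sup>2"
      using parallelogram_law[of "x - s m" "x - s n"] by (simp add: power_mult_distrib)
    also have "\<dots> = (8 * d + 4 * e) * e" by (simp add: power2_eq_square algebra_simps)
    also have "\<dots> \<le> (8 * d + 4) * e" using e by (intro mult_right_mono) auto
    finally show ?thesis by (simp add: e_def)
  qed
  have "Cauchy s"
  proof (rule metric_CauchyI)
    fix e :: real assume e: "e > 0"
    have "(\<lambda>k. (8 * d + 4) * (1 / real (Suc k))) \<longlonglongrightarrow> (8 * d + 4) * 0"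
      by (intro tendsto_intros lim_1_over_n[THEN LIMSEQ_Suc])
    then obtain k where "(8 * d + 4) * (1 / real (Suc k)) < e\<^sup>2"
      using e by (metis (no_types, lifting) eventually_sequentially order_refl mult_zero_right 
          order_tendstoD(2) zero_less_power)
    then have "dist (s m) (s n) < e" if "m \<ge> k" "n \<ge> k" for m n
      using near[OF that] e by (meson less_imp_le order_le_less_trans power_less_imp_less_base)
    then show "\<exists>M. \<forall>m\<ge>M. \<forall>n\<ge>M. dist (s m) (s n) < e" by blast
  qed
  then obtain l where l: "s \<longlonglongrightarrow> l" using Cauchy_convergent convergent_def by blast
  have "l \<in> S" using \<open>closed S\<close> s(1) l by (metis closed_sequentially)
  moreover have "dist x l \<le> d"
  proof (rule LIMSEQ_le)
    show "(\<lambda>n. dist x (s n)) \<longlonglongrightarrow> dist x l" by (intro tendsto_intros l)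
    show "(\<lambda>n. d + 1 / real (Suc n)) \<longlonglongrightarrow> d"
      using tendsto_add[OF tendsto_const[of d] lim_1_over_n[THEN LIMSEQ_Suc]] by simp
    show "\<exists>N. \<forall>n\<ge>N. dist x (s n) \<le> d + 1 / real (Suc n)" using s(2) less_imp_le by blast
  qed
  ultimately show ?thesis using d_le by force
qed

text \<open>At the closest point \<open>s\<close>, moving in the direction of some \<open>t \<in> S\<close> with the optimal coefficient
$\langle t, r\rangle / \langle t, t\rangle$ would shorten the residual \<open>r = x - s\<close> unless that coefficient is zero.\<close>

theorem projection_exists:
  fixes S :: "'a::chilbert_space set"
  assumes S: "csubspace S" and "closed S"
  shows "\<exists>s\<in>S. x - s \<in> orth S"
proof -
  obtain s where s: "s \<in> S" "\<And>t. t \<in> S \<Longrightarrow> dist x s \<le> dist x t"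
    using closest_point_exists[OF assms] by blast
  define r where "r = x - s"
  have "cinner t r = 0" if t: "t \<in> S" for t
  proof (cases "t = 0")
    case False
    define c where "c = cinner t r / cinner t t"
    have "s + c *\<^sub>C t \<in> S"
      using S s(1) t by (intro complex_vector.subspace_add complex_vector.subspace_scale)
    from s(2)[OF this] have "norm r \<le> norm (r - c *\<^sub>C t)"
      by (simp add: dist_norm r_def algebra_simps)
    have "cinner (r - c *\<^sub>C t) (c *\<^sub>C t) = 0"
    proof -
      have "cinner (c *\<^sub>C t) (r - c *\<^sub>C t) = 0"
        using False by (simp add: cinner_diff_right cinner_scaleC_right cinner_scaleC_left c_def)
      then show ?thesis by (metis cinner_commute complex_cnj_zero)
    qed
    then have "inner (r - c *\<^sub>C t) (c *\<^sub>C t) = 0" by (metis Re_cinner zero_complex.simps(1))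
    then have "(norm r)\<^sup>2 = (norm (r - c *\<^sub>C t))\<^sup>2 + (norm (c *\<^sub>C t))\<^sup>2"
      using norm_add_Pythagorean[of "r - c *\<^sub>C t" "c *\<^sub>C t"] by (simp add: orthogonal_def)
    moreover have "(norm r)\<^sup>2 \<le> (norm (r - c *\<^sub>C t))\<^sup>2"
      using \<open>norm r \<le> _\<close> by (intro power_mono) auto
    ultimately have "(norm (c *\<^sub>C t))\<^sup>2 \<le> 0" by simp
    then have "c = 0" using False by (simp add: norm_scaleC)
    then show ?thesis using False by (simp add: c_def)
  qed auto
  then show ?thesis using s(1) by (auto simp: orth_def r_def)
qed

definition proj :: "'a::chilbert_space set \<Rightarrow> 'a \<Rightarrow> 'a"
  where "proj S x = (SOME s. s \<in> S \<and> x - s \<in> orth S)"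

lemma proj_in: "csubspace S \<Longrightarrow> closed S \<Longrightarrow> proj S x \<in> S"
  and proj_diff_orth: "csubspace S \<Longrightarrow> closed S \<Longrightarrow> x - proj S x \<in> orth S"
proof -
  assume "csubspace S" "closed S"
  then have "\<exists>s. s \<in> S \<and> x - s \<in> orth S" using projection_exists by blast
  from someI_ex[OF this] show "proj S x \<in> S" "x - proj S x \<in> orth S"
    unfolding proj_def by auto
qed

lemma proj_eqI:
  assumes "csubspace S" "closed S" "s \<in> S" "x - s \<in> orth S"
  shows "proj S x = s"
proof -
  have "(x - s) - (x - proj S x) \<in> orth S"
    using assms(4) proj_diff_orth[OF assms(1,2)] csubspace_orth complex_vector.subspace_diff by blast
  moreover have "(x - s) - (x - proj S x) \<in> S"
    using assms(1,3) proj_in[OF assms(1,2)] by (simp add: complex_vector.subspace_diff)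
  ultimately have "(x - s) - (x - proj S x) = 0" by (rule orth_Int_zero[rotated])
  then show ?thesis by simp
qed

lemma clinear_on_proj:
  assumes S: "csubspace S" "closed S"
  shows "clinear_on X (proj S)"
  unfolding clinear_on_def
proof (intro conjI ballI allI)
  fix x y
  show "proj S (x + y) = proj S x + proj S y"
  proof (intro proj_eqI S)
    show "proj S x + proj S y \<in> S" using S proj_in complex_vector.subspace_add by blast
    show "x + y - (proj S x + proj S y) \<in> orth S"
      using complex_vector.subspace_add[OF csubspace_orth proj_diff_orth[OF S, of x] proj_diff_orth[OF S, of y]]
      by (simp add: algebra_simps)
  qed
next
  fix c x
  show "proj S (c *\<^sub>C x) = c *\<^sub>C proj S x"
  proof (intro proj_eqI S)
    show "c *\<^sub>C proj S x \<in> S" using S proj_in complex_vector.subspace_scale by blast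
    show "c *\<^sub>C x - c *\<^sub>C proj S x \<in> orth S"
      using complex_vector.subspace_scale[OF csubspace_orth proj_diff_orth[OF S, of x], of c]
      by (simp add: complex_vector.scale_right_diff_distrib)
  qed
qed

lemma cinner_proj: "csubspace S \<Longrightarrow> closed S \<Longrightarrow> s \<in> S \<Longrightarrow> cinner s (proj S x) = cinner s x"
  using orthD[OF proj_diff_orth[of S x], of s] by (simp add: cinner_diff_right)

lemma cinner_proj_left: "csubspace S \<Longrightarrow> closed S \<Longrightarrow> s \<in> S \<Longrightarrow> cinner (proj S x) s = cinner x s"
  using cinner_proj[of S s x] cinner_commute[of "proj S x" s] cinner_commute[of x s] by simp

lemma norm_proj_le:
  assumes S: "csubspace S" "closed S"
  shows "norm (proj S x) \<le> norm x"
proof -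
  have "(norm (proj S x))\<^sup>2 = cmod (cinner (proj S x) (proj S x))" by (simp add: cinner_self norm_power)
  also have "\<dots> = cmod (cinner (proj S x) x)" using S by (simp add: cinner_proj proj_in)
  also have "\<dots> \<le> norm (proj S x) * norm x" by (rule cinner_cauchy_schwarz)
  finally show ?thesis
    by (metis mult_le_cancel_left_pos norm_ge_zero norm_zero order_le_less power2_eq_square)
qed

lemma orth_orth:
  assumes S: "csubspace S" "closed S"
  shows "orth (orth S) = S"
proof
  show "S \<subseteq> orth (orth S)" using orth_sym by (fastforce simp: orth_def)
  show "orth (orth S) \<subseteq> S"
  proof
    fix x assume x: "x \<in> orth (orth S)"
    have "x - proj S x \<in> orth (orth S)"
      using x \<open>S \<subseteq> _\<close> proj_in[OF S] csubspace_orth complex_vector.subspace_diff by blast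
    then have "x - proj S x = 0" using proj_diff_orth[OF S] orth_Int_zero by blast
    then show "x \<in> S" using proj_in[OF S, of x] by simp
  qed
qed

text \<open>The uniform boundedness principle for functionals $\langle z, \cdot\rangle$, obtained from Baire's theorem: one of the closed
sets on which all these functionals are bounded by \<open>n\<close> contains a ball, and testing \<open>z\<close> against a multiple of
itself inside the ball bounds its norm.\<close>

lemma weakly_bounded_imp_bounded:
  fixes Z :: "'a::chilbert_space set"
  assumes "\<And>x. \<exists>M. \<forall>z\<in>Z. cmod (cinner z x) \<le> M"
  shows "\<exists>K. \<forall>z\<in>Z. norm z \<le> K"
proof -
  define A where "A n = {x. \<forall>z\<in>Z. cmod (cinner z x) \<le> real n}" for n
  have closedA: "closed (A n)" for n
  proof -
    have "A n = (\<Inter>z\<in>Z. {x. cmod (cinner z x) \<le> real n})" by (auto simp: A_def)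
    moreover have "closed {x. cmod (cinner z x) \<le> real n}" for z :: 'a
      by (intro closed_Collect_le continuous_on_const continuous_on_norm)
         (auto simp: continuous_on_def intro!: tendsto_cinner tendsto_ident_at)
    ultimately show ?thesis by (simp add: closed_INT)
  qed
  have cover: "(\<Union>n. A n) = UNIV"
  proof (intro set_eqI iffI UNIV_I)
    fix x
    obtain M where "\<forall>z\<in>Z. cmod (cinner z x) \<le> M" using assms by blast
    then have "x \<in> A (nat \<lceil>M\<rceil>)"
      unfolding A_def by (auto intro: order_trans real_nat_ceiling_ge)
    then show "x \<in> (\<Union>n. A n)" by blast
  qed
  have "\<exists>n. interior (A n) \<noteq> {}"
  proof (rule ccontr)
    assume "\<not> ?thesis"
    then have "euclidean interior_of (\<Union>(range A)) = {}"
      using closedA by (intro Baire_category_alt disjI1 completely_metrizable_space_euclidean) auto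
    then show False using cover by simp
  qed
  then obtain n x e where e: "e > 0" and ball: "ball x e \<subseteq> A n"
    by (metis all_not_in_conv mem_interior)
  have "norm z \<le> 4 * real n / e" if z: "z \<in> Z" for z
  proof (cases "z = 0")
    case False
    \<comment> \<open>The factor puts \<open>x + y\<close> strictly inside the ball of radius \<open>e\<close> about \<open>x\<close>.\<close>
    define y where "y = (e / (2 * norm z)) *\<^sub>R z"
    have ny: "norm y = e / 2" using False e by (simp add: y_def)
    have "x \<in> A n" "x + y \<in> A n" using ball ny e by (auto simp: subset_iff dist_norm)
    then have "cmod (cinner z (x + y) - cinner z x) \<le> real n + real n"
      using z norm_triangle_ineq4[of "cinner z (x+y)" "cinner z x"] unfolding A_def by fastforce
    also have "cinner z (x + y) - cinner z x = of_real (e / 2 * norm z)"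
      using False by (simp add: cinner_add_right y_def scaleR_scaleC cinner_scaleC_right cinner_self power2_eq_square)
    finally have "e / 2 * norm z \<le> 2 * real n" using e by (simp add: norm_mult)
    then show ?thesis using e by (simp add: field_simps)
  qed (use e in auto)
  then show ?thesis by blast
qed

text \<open>The Hellinger--Toeplitz theorem.  The images under \<open>g\<close> of the unit vectors of \<open>Y\<close> are weakly bounded, since pairing with \<open>x\<close>
gives at most \<open>norm (f (proj X x))\<close>; hence they are bounded in norm, and so is \<open>f\<close>.\<close>

theorem bounded_of_formal_adjoint:
  fixes X :: "'a::chilbert_space set" and Y :: "'b::chilbert_space set"
  assumes X: "csubspace X" "closed X"
    and f: "\<And>x. x \<in> X \<Longrightarrow> f x \<in> Y" and g: "\<And>y. y \<in> Y \<Longrightarrow> g y \<in> X"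
    and adj: "\<And>x y. x \<in> X \<Longrightarrow> y \<in> Y \<Longrightarrow> cinner y (f x) = cinner (g y) x"
    and Y: "csubspace Y" and lin: "\<And>c x. x \<in> X \<Longrightarrow> f (c *\<^sub>C x) = c *\<^sub>C f x"
  shows "\<exists>K. \<forall>x\<in>X. norm (f x) \<le> K * norm x"
proof -
  define Z where "Z = g ` {y \<in> Y. norm y \<le> 1}"
  have "\<exists>M. \<forall>z\<in>Z. cmod (cinner z x) \<le> M" for x
  proof (intro exI ballI)
    fix z assume "z \<in> Z"
    then obtain y where y: "y \<in> Y" "norm y \<le> 1" "z = g y" by (auto simp: Z_def)
    have "cmod (cinner z x) = cmod (cinner y (f (proj X x)))"
      using y g by (simp add: adj proj_in[OF X] cinner_proj[OF X])
    also have "\<dots> \<le> norm y * norm (f (proj X x))" by (rule cinner_cauchy_schwarz)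
    also have "\<dots> \<le> norm (f (proj X x))" using y by (simp add: mult_left_le_one_le)
    finally show "cmod (cinner z x) \<le> norm (f (proj X x))" .
  qed
  then obtain K where K: "\<And>z. z \<in> Z \<Longrightarrow> norm z \<le> K"
    using weakly_bounded_imp_bounded by metis
  have "norm (f x) \<le> K * norm x" if x: "x \<in> X" for x
  proof (cases "f x = 0")
    case True
    have "norm (g 0) \<le> K"
      using K complex_vector.subspace_0[OF Y] by (auto simp: Z_def)
    then have "0 \<le> K" using norm_ge_zero order_trans by blast
    then show ?thesis using True by simp
  next
    case False
    define y where "y = (1 / norm (f x)) *\<^sub>R f x"
    have y: "y \<in> Y" "norm y \<le> 1"
      using f[OF x] Y False by (auto simp: y_def csubspace_scaleR)
    have "of_real (norm (f x)) = cinner y (f x)"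
      using False by (simp add: y_def scaleR_scaleC cinner_scaleC_left cinner_self power2_eq_square)
    also have "\<dots> = cinner (g y) x" using adj x y by simp
    finally have "norm (f x) = cmod (cinner (g y) x)" by (metis norm_of_real abs_norm_cancel)
    also have "\<dots> \<le> norm (g y) * norm x" by (rule cinner_cauchy_schwarz)
    also have "\<dots> \<le> K * norm x" using y by (intro mult_right_mono K) (auto simp: Z_def)
    finally show ?thesis .
  qed
  then show ?thesis by blast
qed

section \<open>Operators between closed linear subsets\<close>

lemma clinear_on_add: "clinear_on X f \<Longrightarrow> x \<in> X \<Longrightarrow> y \<in> X \<Longrightarrow> f (x + y) = f x + f y"
  and clinear_on_scale: "clinear_on X f \<Longrightarrow> x \<in> X \<Longrightarrow> f (c *\<^sub>C x) = c *\<^sub>C f x"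
  by (simp_all add: clinear_on_def)

lemma clinear_on_zero: "clinear_on X f \<Longrightarrow> csubspace X \<Longrightarrow> f 0 = 0"
  using clinear_on_scale[of X f 0 0] complex_vector.subspace_0[of X] by simp

lemma clinear_on_minus: "clinear_on X f \<Longrightarrow> x \<in> X \<Longrightarrow> f (- x) = - f x"
  using clinear_on_scale[of X f x "-1"] by (simp add: scaleC_minus1)

lemma clinear_on_diff:
  "clinear_on X f \<Longrightarrow> csubspace X \<Longrightarrow> x \<in> X \<Longrightarrow> y \<in> X \<Longrightarrow> f (x - y) = f x - f y"
  using clinear_on_add[of X f x "- y"] clinear_on_minus[of X f y] complex_vector.subspace_neg[of X y] by simp

lemma clinear_on_subset: "clinear_on X f \<Longrightarrow> Y \<subseteq> X \<Longrightarrow> clinear_on Y f"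
  unfolding clinear_on_def by blast

lemma clinear_on_cong: "(\<And>x. x \<in> X \<Longrightarrow> f x = g x) \<Longrightarrow> csubspace X \<Longrightarrow> clinear_on X f = clinear_on X g"
  by (simp add: clinear_on_def complex_vector.subspace_add complex_vector.subspace_scale)

lemma clinear_on_compose:
  "clinear_on X f \<Longrightarrow> (\<And>x. x \<in> X \<Longrightarrow> f x \<in> Y) \<Longrightarrow> clinear_on Y g \<Longrightarrow> clinear_on X (\<lambda>x. g (f x))"
  by (simp add: clinear_on_def)

lemma clinear_on_plus: "clinear_on X f \<Longrightarrow> clinear_on X g \<Longrightarrow> clinear_on X (\<lambda>x. f x + g x)"
  by (simp add: clinear_on_def scaleC_add_right)

lemma clinear_on_sub: "clinear_on X f \<Longrightarrow> clinear_on X g \<Longrightarrow> clinear_on X (\<lambda>x. f x - g x)"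
  by (simp add: clinear_on_def complex_vector.scale_right_diff_distrib)

lemma clinear_on_scaleC: "clinear_on X f \<Longrightarrow> clinear_on X (\<lambda>x. c *\<^sub>C f x)"
  by (simp add: clinear_on_def scaleC_add_right scaleC_scaleC mult.commute)

lemma clinear_on_id: "clinear_on X (\<lambda>x. x)"
  by (simp add: clinear_on_def)

lemma clinear_on_0: "clinear_on X (\<lambda>x. 0)"
  by (simp add: clinear_on_def)

lemma csubspace_image: "clinear_on X f \<Longrightarrow> csubspace X \<Longrightarrow> csubspace (f ` X)"
  unfolding complex_vector.subspace_def
  by (auto simp: image_iff) (metis clinear_on_zero complex_vector.subspace_def, 
     metis clinear_on_add, metis clinear_on_scale)

lemma csubspace_kernel: "clinear_on X f \<Longrightarrow> csubspace X \<Longrightarrow> csubspace {x \<in> X. f x = 0}"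
  using clinear_on_zero[of X f]
  by (auto simp: complex_vector.subspace_def clinear_on_add clinear_on_scale)

lemma clinear_on_inv_into:
  assumes lin: "clinear_on X f" and X: "csubspace X" and bij: "bij_betw f X Y"
  shows "clinear_on Y (inv_into X f)"
proof -
  have inv: "inv_into X f y \<in> X" "f (inv_into X f y) = y" if "y \<in> Y" for y
    using bij that by (auto simp: bij_betw_def inv_into_into f_inv_into_f)
  have eqI: "inv_into X f y = x" if "x \<in> X" "f x = y" for x y
    using bij that by (auto simp: bij_betw_def)
  show ?thesis
    unfolding clinear_on_def
    by (auto intro!: eqI simp: X inv complex_vector.subspace_add complex_vector.subspace_scale 
        clinear_on_add[OF lin] clinear_on_scale[OF lin])
qed

lemma lin_opD: "lin_op X Y f \<Longrightarrow> clinear_on X f" "lin_op X Y f \<Longrightarrow> x \<in> X \<Longrightarrow> f x \<in> Y"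
  by (auto simp: lin_op_def)

lemma lin_opI: "clinear_on X f \<Longrightarrow> (\<And>x. x \<in> X \<Longrightarrow> f x \<in> Y) \<Longrightarrow> lin_op X Y f"
  by (auto simp: lin_op_def)

lemma lin_op_zero: "csubspace Y \<Longrightarrow> lin_op X Y (\<lambda>_. 0)"
  by (simp add: lin_opI clinear_on_0 complex_vector.subspace_0)

lemma bounded_opD: "bounded_op X Y f \<Longrightarrow> lin_op X Y f"
  by (simp add: bounded_op_def)

text \<open>A two-sided estimate replaces a separate bound for the inverse.\<close>

lemma homeo_opI:
  assumes "csubspace X" "lin_op X Y f" "bij_betw f X Y"
    and "\<And>x. x \<in> X \<Longrightarrow> norm (f x) \<le> K * norm x"
    and "\<And>x. x \<in> X \<Longrightarrow> norm x \<le> L * norm (f x)"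
  shows "homeo_op X Y f"
proof -
  have inv: "inv_into X f y \<in> X" "f (inv_into X f y) = y" if "y \<in> Y" for y
    using assms(3) that by (auto simp: bij_betw_def inv_into_into f_inv_into_f)
  have "norm (inv_into X f y) \<le> L * norm y" if "y \<in> Y" for y
    using assms(5)[of "inv_into X f y"] inv[OF that] by simp
  moreover have "lin_op Y X (inv_into X f)"
    using inv(1) by (intro lin_opI clinear_on_inv_into[OF lin_opD(1)[OF assms(2)] assms(1,3)])
  ultimately show ?thesis
    using assms(2-4) unfolding homeo_op_def bounded_op_def by blast
qed

text \<open>The representing vector spans the complement of the kernel of \<open>\<phi>\<close> in \<open>X\<close>.\<close>

lemma riesz_representation:
  fixes X :: "'a::chilbert_space set" and \<phi> :: "'a \<Rightarrow> complex"
  assumes X: "csubspace X" "closed X"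
    and add: "\<And>x y. x \<in> X \<Longrightarrow> y \<in> X \<Longrightarrow> \<phi> (x + y) = \<phi> x + \<phi> y"
    and scale: "\<And>c x. x \<in> X \<Longrightarrow> \<phi> (c *\<^sub>C x) = c * \<phi> x"
    and bound: "\<And>x. x \<in> X \<Longrightarrow> cmod (\<phi> x) \<le> K * norm x"
  shows "\<exists>z\<in>X. \<forall>x\<in>X. \<phi> x = cinner z x"
proof -
  define Z where "Z = {x \<in> X. \<phi> x = 0}"
  have diff: "\<phi> (x - y) = \<phi> x - \<phi> y" if "x \<in> X" "y \<in> X" for x y
    using add[of x "(-1) *\<^sub>C y"] scale[of y "-1"] that X(1)
    by (simp add: scaleC_minus1 complex_vector.subspace_neg)
  have zero: "\<phi> 0 = 0" using scale[of 0 0] X(1) complex_vector.subspace_0 by fastforce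
  have subZ: "csubspace Z"
    using X(1) zero by (auto simp: Z_def complex_vector.subspace_def add scale)
  have "closed Z"
    unfolding closed_sequential_limits
  proof (intro allI impI, elim conjE)
    fix s l assume s: "\<forall>n. s n \<in> Z" "s \<longlonglongrightarrow> l"
    have l: "l \<in> X" using s X(2) unfolding Z_def by (metis (no_types, lifting) closed_sequentially mem_Collect_eq)
    have "cmod (\<phi> l) \<le> K * norm (l - s n)" for n
      using s(1) bound[of "l - s n"] diff[of l "s n"] l X(1) by (simp add: Z_def complex_vector.subspace_diff)
    moreover have "(\<lambda>n. K * norm (l - s n)) \<longlonglongrightarrow> K * norm (l - l)"
      by (intro tendsto_intros s(2))
    ultimately have "cmod (\<phi> l) \<le> K * norm (l - l)"
      by (intro LIMSEQ_le_const) auto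
    then show "l \<in> Z" using l by (simp add: Z_def)
  qed
  show ?thesis
  proof (cases "X \<subseteq> Z")
    case True
    then show ?thesis using X(1) by (intro bexI[of _ 0]) (auto simp: Z_def complex_vector.subspace_0)
  next
    case False
    then obtain x0 where x0: "x0 \<in> X" "x0 \<notin> Z" by blast
    define e where "e = x0 - proj Z x0"
    have "proj Z x0 \<in> Z" using proj_in[OF subZ \<open>closed Z\<close>] .
    then have eX: "e \<in> X" and ne: "\<phi> e \<noteq> 0" and e0: "e \<noteq> 0"
      using x0 X(1) by (auto simp: e_def Z_def diff complex_vector.subspace_diff)
    have orth: "cinner e z = 0" if "z \<in> Z" for z
      using that proj_diff_orth[OF subZ \<open>closed Z\<close>] unfolding e_def by (rule orth_sym)
    define w where "w = cnj (\<phi> e / cinner e e) *\<^sub>C e"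
    have "\<phi> x = cinner w x" if x: "x \<in> X" for x
    proof -
      have "x - (\<phi> x / \<phi> e) *\<^sub>C e \<in> Z"
        using x eX ne X(1) by (simp add: Z_def diff scale complex_vector.subspace_diff complex_vector.subspace_scale)
      from orth[OF this] have "cinner e x = \<phi> x / \<phi> e * cinner e e"
        by (simp add: cinner_diff_right cinner_scaleC_right)
      then show ?thesis using e0 ne by (simp add: w_def cinner_scaleC_left)
    qed
    moreover have "w \<in> X" using eX X(1) by (simp add: w_def complex_vector.subspace_scale)
    ultimately show ?thesis by blast
  qed
qed

lemma adjoint_exists:
  fixes X :: "'a::chilbert_space set" and Y :: "'b::chilbert_space set"
  assumes X: "csubspace X" "closed X" and f: "bounded_op X Y f"
  shows "\<exists>x\<in>X. \<forall>u\<in>X. cinner (f u) y = cinner u x"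
proof -
  obtain K where K: "\<And>x. x \<in> X \<Longrightarrow> norm (f x) \<le> K * norm x"
    using f by (auto simp: bounded_op_def)
  have lin: "clinear_on X f" using f by (simp add: bounded_op_def lin_op_def)
  have "\<exists>z\<in>X. \<forall>x\<in>X. cinner y (f x) = cinner z x"
  proof (rule riesz_representation[OF X, where K="norm y * K"])
    fix x assume "x \<in> X"
    then show "cmod (cinner y (f x)) \<le> norm y * K * norm x"
      using cinner_cauchy_schwarz[of y "f x"] mult_left_mono[OF K[of x] norm_ge_zero[of y]]
      by (simp add: mult.assoc)
  qed (simp_all add: clinear_on_add[OF lin] clinear_on_scale[OF lin] cinner_add_right cinner_scaleC_right)
  then show ?thesis by (metis cinner_commute)
qed

lemma adj_op_eqI:
  fixes X :: "'a::chilbert_space set" and Y :: "'b::chilbert_space set"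
  assumes X: "csubspace X" and "x \<in> X" "y \<in> Y" "\<And>u. u \<in> X \<Longrightarrow> cinner (f u) y = cinner u x"
  shows "adj_op X Y f y = x"
  unfolding adj_op_def
proof (rule the_equality)
  show "(y, x) \<in> adj_rel X Y (graph_on X f)"
    using assms by (auto simp: adj_rel_def graph_on_def)
next
  fix z assume "(y, z) \<in> adj_rel X Y (graph_on X f)"
  then have "z \<in> X" "\<And>u. u \<in> X \<Longrightarrow> cinner u z = cinner u x"
    using assms(4) by (auto simp: adj_rel_def graph_on_def)
  then show "z = x"
    using X assms(2) by (intro cinner_ext[of X]) (auto simp: complex_vector.subspace_diff)
qed

lemma
  fixes X :: "'a::chilbert_space set" and Y :: "'b::chilbert_space set"
  assumes X: "csubspace X" "closed X" and f: "bounded_op X Y f" and y: "y \<in> Y"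
  shows adj_op_in: "adj_op X Y f y \<in> X"
    and cinner_adj_op: "\<And>u. u \<in> X \<Longrightarrow> cinner (f u) y = cinner u (adj_op X Y f y)"
proof -
  obtain x where x: "x \<in> X" "\<And>u. u \<in> X \<Longrightarrow> cinner (f u) y = cinner u x"
    using adjoint_exists[OF X f] by blast
  have "adj_op X Y f y = x" by (rule adj_op_eqI[OF X(1) x(1) y x(2)])
  then show "adj_op X Y f y \<in> X" "\<And>u. u \<in> X \<Longrightarrow> cinner (f u) y = cinner u (adj_op X Y f y)"
    using x by auto
qed

lemma bounded_op_bound_pos:
  assumes "bounded_op X Y f"
  obtains K where "K > 0" "\<And>x. x \<in> X \<Longrightarrow> norm (f x) \<le> K * norm x"
proof -
  obtain K where K: "\<And>x. x \<in> X \<Longrightarrow> norm (f x) \<le> K * norm x"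
    using assms by (auto simp: bounded_op_def)
  have "norm (f x) \<le> (\<bar>K\<bar> + 1) * norm x" if "x \<in> X" for x
    by (rule order_trans[OF K[OF that]]) (intro mult_right_mono, auto)
  then show ?thesis by (intro that[of "\<bar>K\<bar> + 1"]) auto
qed

lemma bounded_op_adj_op:
  fixes X :: "'a::chilbert_space set" and Y :: "'b::chilbert_space set"
  assumes X: "csubspace X" "closed X" and Y: "csubspace Y" and f: "bounded_op X Y f"
  shows "bounded_op Y X (adj_op X Y f)"
proof -
  obtain K where K: "K > 0" "\<And>x. x \<in> X \<Longrightarrow> norm (f x) \<le> K * norm x"
    using bounded_op_bound_pos[OF f] by blast
  note * = adj_op_in[OF X f] cinner_adj_op[OF X f]
  have "clinear_on Y (adj_op X Y f)"
    unfolding clinear_on_def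
    by (auto intro!: adj_op_eqI X(1) simp: * complex_vector.subspace_add[OF X(1)] complex_vector.subspace_scale[OF X(1)]
       complex_vector.subspace_add[OF Y] complex_vector.subspace_scale[OF Y] cinner_add_right cinner_scaleC_right)
  then have "lin_op Y X (adj_op X Y f)" using *(1) by (rule lin_opI)
  moreover have "norm (adj_op X Y f y) \<le> K * norm y" if y: "y \<in> Y" for y
  proof (cases "adj_op X Y f y = 0")
    case False
    let ?a = "adj_op X Y f y"
    have "(norm ?a)\<^sup>2 = cmod (cinner (f ?a) y)"
      using * y by (simp add: cinner_self norm_power)
    also have "\<dots> \<le> norm (f ?a) * norm y" by (rule cinner_cauchy_schwarz)
    also have "\<dots> \<le> (K * norm ?a) * norm y" using * y K by (intro mult_right_mono) auto
    finally have "norm ?a * norm ?a \<le> norm ?a * (K * norm y)" by (simp add: power2_eq_square mult_ac)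
    then show ?thesis using False by simp
  qed (use K in simp)
  ultimately show ?thesis unfolding bounded_op_def by blast
qed

lemma homeo_op_inv:
  assumes "homeo_op X Y f"
  shows "x \<in> X \<Longrightarrow> inv_into X f (f x) = x" "y \<in> Y \<Longrightarrow> f (inv_into X f y) = y" 
    "y \<in> Y \<Longrightarrow> inv_into X f y \<in> X" "x \<in> X \<Longrightarrow> f x \<in> Y"
  using assms by (auto simp: homeo_op_def bij_betw_def f_inv_into_f inv_into_into)

text \<open>The adjoint of the inverse is an inverse of the adjoint.\<close>

lemma bij_betw_adj_op:
  fixes X :: "'a::chilbert_space set" and Y :: "'b::chilbert_space set"
  assumes X: "csubspace X" "closed X" and Y: "csubspace Y" "closed Y" and f: "homeo_op X Y f"
  shows "bij_betw (adj_op X Y f) Y X"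
proof -
  have b: "bounded_op X Y f" "bounded_op Y X (inv_into X f)" using f by (auto simp: homeo_op_def)
  note * = adj_op_in[OF X b(1)] cinner_adj_op[OF X b(1)]
  note ** = adj_op_in[OF Y b(2)] cinner_adj_op[OF Y b(2)]
  note inv = homeo_op_inv[OF f]
  show ?thesis
  proof (rule bij_betw_byWitness[where f'="adj_op Y X (inv_into X f)"])
    show "\<forall>y\<in>Y. adj_op Y X (inv_into X f) (adj_op X Y f y) = y"
    proof
      fix y assume y: "y \<in> Y"
      have "cinner (inv_into X f u) (adj_op X Y f y) = cinner u y" if "u \<in> Y" for u
        using *(2)[OF y, of "inv_into X f u"] inv that by simp
      then show "adj_op Y X (inv_into X f) (adj_op X Y f y) = y"
        using y * by (intro adj_op_eqI Y) auto
    qed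
    show "\<forall>x\<in>X. adj_op X Y f (adj_op Y X (inv_into X f) x) = x"
    proof
      fix x assume x: "x \<in> X"
      have "cinner (f u) (adj_op Y X (inv_into X f) x) = cinner u x" if "u \<in> X" for u
        using **(2)[OF x, of "f u"] inv that by simp
      then show "adj_op X Y f (adj_op Y X (inv_into X f) x) = x"
        using x ** by (intro adj_op_eqI X) auto
    qed
  qed (auto simp: * **)
qed

lemma homeo_op_bounds:
  assumes "homeo_op X Y f"
  shows "\<exists>K L. K > 0 \<and> L > 0 \<and> (\<forall>x\<in>X. norm (f x) \<le> K * norm x) \<and> (\<forall>x\<in>X. norm x \<le> L * norm (f x))"
proof -
  have b: "bounded_op X Y f" "bounded_op Y X (inv_into X f)" using assms by (simp_all add: homeo_op_def)
  obtain K where K: "K > 0" "\<And>x. x \<in> X \<Longrightarrow> norm (f x) \<le> K * norm x" using bounded_op_bound_pos[OF b(1)] by blast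
  obtain L where L: "L > 0" "\<And>y. y \<in> Y \<Longrightarrow> norm (inv_into X f y) \<le> L * norm y" using bounded_op_bound_pos[OF b(2)] by blast
  have "norm x \<le> L * norm (f x)" if "x \<in> X" for x
    using L(2)[OF homeo_op_inv(4)[OF assms that]] homeo_op_inv(1)[OF assms that] by simp
  then show ?thesis using K L(1) by blast
qed

lemma homeo_opD: "homeo_op X Y f \<Longrightarrow> lin_op X Y f" "homeo_op X Y f \<Longrightarrow> bij_betw f X Y"
  unfolding homeo_op_def bounded_op_def by blast+

lemma homeo_op_inv_into:
  assumes X: "csubspace X" and f: "homeo_op X Y f" and Y: "csubspace Y"
  shows "homeo_op Y X (inv_into X f)"
proof -
  obtain K L where KL: "\<And>x. x \<in> X \<Longrightarrow> norm (f x) \<le> K * norm x" "\<And>x. x \<in> X \<Longrightarrow> norm x \<le> L * norm (f x)" "K > 0" "L > 0"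
    using homeo_op_bounds[OF f] by blast
  have "bounded_op Y X (inv_into X f)" using f by (simp add: homeo_op_def)
  then show ?thesis
    using KL(1)[OF homeo_op_inv(3)[OF f]] KL(2)[OF homeo_op_inv(3)[OF f]] homeo_op_inv(2)[OF f]
    by (intro homeo_opI[where K=L and L=K] Y bounded_opD bij_betw_inv_into homeo_opD(2)[OF f]) simp_all
qed

lemma homeo_op_adj_op:
  fixes X :: "'a::chilbert_space set" and Y :: "'b::chilbert_space set"
  assumes X: "csubspace X" "closed X" and Y: "csubspace Y" "closed Y" and f: "homeo_op X Y f"
  shows "homeo_op Y X (adj_op X Y f)"
proof -
  have b: "bounded_op X Y f" using f by (simp add: homeo_op_def)
  have badj: "bounded_op Y X (adj_op X Y f)" by (rule bounded_op_adj_op[OF X Y(1) b])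
  obtain K where K: "\<And>y. y \<in> Y \<Longrightarrow> norm (adj_op X Y f y) \<le> K * norm y"
    using badj unfolding bounded_op_def by blast
  obtain K' L where L: "\<And>x. x \<in> X \<Longrightarrow> norm (f x) \<le> K' * norm x" "\<And>x. x \<in> X \<Longrightarrow> norm x \<le> L * norm (f x)"
    "K' > 0" "L > 0"
    using homeo_op_bounds[OF f] by blast
  have below: "norm y \<le> L * norm (adj_op X Y f y)" if y: "y \<in> Y" for y
  proof (cases "y = 0")
    case False
    let ?x = "inv_into X f y"
    have x: "?x \<in> X" "f ?x = y" using homeo_op_inv[OF f] y by auto
    have "(norm y)\<^sup>2 = cmod (cinner (f ?x) y)" by (simp add: x cinner_self norm_power)
    also have "\<dots> = cmod (cinner ?x (adj_op X Y f y))" by (simp only: cinner_adj_op[OF X b y x(1)])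
    also have "\<dots> \<le> norm ?x * norm (adj_op X Y f y)" by (rule cinner_cauchy_schwarz)
    also have "\<dots> \<le> (L * norm y) * norm (adj_op X Y f y)"
      using L(2)[OF x(1)] x(2) by (intro mult_right_mono) auto
    finally have "norm y * norm y \<le> norm y * (L * norm (adj_op X Y f y))"
      by (simp add: power2_eq_square mult_ac)
    then show ?thesis using False by simp
  next
    case True
    then have "adj_op X Y f y = 0"
      using clinear_on_zero[OF lin_opD(1)[OF bounded_opD[OF badj]] Y(1)] by simp
    then show ?thesis using True by simp
  qed
  show ?thesis
    by (intro homeo_opI[where K=K and L=L] Y(1) bounded_opD[OF badj] bij_betw_adj_op[OF X Y f] K below)
qed

text \<open>For an everywhere defined operator, symmetry already forces equality with the adjoint relation: a pair
\<open>(y, x)\<close> in the adjoint satisfies $\langle u, x\rangle = \langle u, A y\rangle$ for all \<open>u\<close>.\<close>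

lemma bounded_selfadjoint_iff:
  assumes X: "csubspace X"
  shows "bounded_selfadjoint X A \<longleftrightarrow>
    bounded_op X X A \<and> (\<forall>x\<in>X. \<forall>y\<in>X. cinner (A x) y = cinner x (A y))"
proof (cases "bounded_op X X A")
  case True
  then have A: "A x \<in> X" if "x \<in> X" for x using that by (auto simp: bounded_op_def lin_op_def)
  have "adj_rel X X (graph_on X A) = graph_on X A \<longleftrightarrow> (\<forall>x\<in>X. \<forall>y\<in>X. cinner (A x) y = cinner x (A y))"
    (is "?l = ?r")
  proof
    assume ?l
    then have "(y, A y) \<in> adj_rel X X (graph_on X A)" if "y \<in> X" for y using that by (auto simp: graph_on_def)
    then show ?r by (fastforce simp: adj_rel_def graph_on_def)
  next
    assume r: ?r
    show ?l
    proof (intro equalityI subsetI)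
      fix p assume "p \<in> adj_rel X X (graph_on X A)"
      then obtain y x where p: "p = (y, x)" "y \<in> X" "x \<in> X" "\<And>u. u \<in> X \<Longrightarrow> cinner (A u) y = cinner u x"
        by (auto simp: adj_rel_def graph_on_def)
      have "x = A y"
        using p r A X by (intro cinner_ext[of X]) (auto simp: complex_vector.subspace_diff)
      then show "p \<in> graph_on X A" using p by (auto simp: graph_on_def)
    qed (use r A in \<open>auto simp: adj_rel_def graph_on_def\<close>)
  qed
  then show ?thesis using True by (simp add: bounded_selfadjoint_def)
qed (simp add: bounded_selfadjoint_def)

lemma has_matrix_2x2:
  "has_matrix V [X1, X2] [Y1, Y2] [[a, b], [c, d]] \<longleftrightarrow>
    lin_op X1 Y1 a \<and> lin_op X2 Y1 b \<and> lin_op X1 Y2 c \<and> lin_op X2 Y2 d \<and>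
    V = {(x1 + x2, (a x1 + b x2) + (c x1 + d x2)) | x1 x2. x1 \<in> X1 \<and> x2 \<in> X2}"
proof -
  have "{(sum_list xs, \<Sum>row\<leftarrow>[[a, b], [c, d]]. \<Sum>(f, x)\<leftarrow>zip row xs. f x) | xs.
           list_all2 (\<lambda>x X. x \<in> X) xs [X1, X2]} = 
     {(x1 + x2, (a x1 + b x2) + (c x1 + d x2)) | x1 x2. x1 \<in> X1 \<and> x2 \<in> X2}"
    by (force simp: list_all2_Cons2)
  then show ?thesis unfolding has_matrix_def by auto
qed

lemma has_matrix_4x4:
  "has_matrix V [X1, X2, X3, X4] [Y1, Y2, Y3, Y4]
     [[a11, a12, a13, a14], [a21, a22, a23, a24], [a31, a32, a33, a34], [a41, a42, a43, a44]] \<longleftrightarrow>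
    (lin_op X1 Y1 a11 \<and> lin_op X2 Y1 a12 \<and> lin_op X3 Y1 a13 \<and> lin_op X4 Y1 a14) \<and>
    (lin_op X1 Y2 a21 \<and> lin_op X2 Y2 a22 \<and> lin_op X3 Y2 a23 \<and> lin_op X4 Y2 a24) \<and>
    (lin_op X1 Y3 a31 \<and> lin_op X2 Y3 a32 \<and> lin_op X3 Y3 a33 \<and> lin_op X4 Y3 a34) \<and>
    (lin_op X1 Y4 a41 \<and> lin_op X2 Y4 a42 \<and> lin_op X3 Y4 a43 \<and> lin_op X4 Y4 a44) \<and>
    V = {(x1 + (x2 + (x3 + x4)),
          (a11 x1 + (a12 x2 + (a13 x3 + a14 x4))) + ((a21 x1 + (a22 x2 + (a23 x3 + a24 x4))) +
          ((a31 x1 + (a32 x2 + (a33 x3 + a34 x4))) + (a41 x1 + (a42 x2 + (a43 x3 + a44 x4)))))) |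
         x1 x2 x3 x4. x1 \<in> X1 \<and> x2 \<in> X2 \<and> x3 \<in> X3 \<and> x4 \<in> X4}"
proof -
  have "{(sum_list xs, \<Sum>row\<leftarrow>[[a11, a12, a13, a14], [a21, a22, a23, a24], [a31, a32, a33, a34], [a41, a42, a43, a44]].
         \<Sum>(f, x)\<leftarrow>zip row xs. f x) | xs. list_all2 (\<lambda>x X. x \<in> X) xs [X1, X2, X3, X4]} =
     {(x1 + (x2 + (x3 + x4)),
          (a11 x1 + (a12 x2 + (a13 x3 + a14 x4))) + ((a21 x1 + (a22 x2 + (a23 x3 + a24 x4))) +
          ((a31 x1 + (a32 x2 + (a33 x3 + a34 x4))) + (a41 x1 + (a42 x2 + (a43 x3 + a44 x4)))))) |
         x1 x2 x3 x4. x1 \<in> X1 \<and> x2 \<in> X2 \<and> x3 \<in> X3 \<and> x4 \<in> X4}" (is "?A = ?B")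
  proof
    show "?A \<subseteq> ?B" by (clarsimp simp: list_all2_Cons2) blast
    show "?B \<subseteq> ?A"
    proof clarify
      fix x1 x2 x3 x4 assume x: "x1 \<in> X1" "x2 \<in> X2" "x3 \<in> X3" "x4 \<in> X4"
      show "\<exists>xs. (x1 + (x2 + (x3 + x4)),
          (a11 x1 + (a12 x2 + (a13 x3 + a14 x4))) + ((a21 x1 + (a22 x2 + (a23 x3 + a24 x4))) +
          ((a31 x1 + (a32 x2 + (a33 x3 + a34 x4))) + (a41 x1 + (a42 x2 + (a43 x3 + a44 x4)))))) =
          (sum_list xs, \<Sum>row\<leftarrow>[[a11, a12, a13, a14], [a21, a22, a23, a24], [a31, a32, a33, a34], [a41, a42, a43, a44]].
         \<Sum>(f, x)\<leftarrow>zip row xs. f x) \<and> list_all2 (\<lambda>x X. x \<in> X) xs [X1, X2, X3, X4]"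
        using x by (intro exI[of _ "[x1, x2, x3, x4]"]) simp
    qed
  qed
  then show ?thesis unfolding has_matrix_def by auto
qed

text \<open>An operator in \<open>\<V>\<close> may be defined on a part of \<open>T\<close> only.  Extending it by zero on an algebraic complement enlarges
its domain to all of \<open>T\<close> without changing its range.\<close>

lemma clinear_extension:
  fixes f :: "'a::complex_vector \<Rightarrow> 'b::complex_vector"
  assumes D: "csubspace D" and f: "clinear_on D f"
  shows "\<exists>g. clinear_on UNIV g \<and> (\<forall>x\<in>D. g x = f x) \<and> range g = f ` D"
proof -
  interpret vector_space_pair "scaleC :: complex \<Rightarrow> 'a \<Rightarrow> 'a" "scaleC :: complex \<Rightarrow> 'b \<Rightarrow> 'b" ..
  obtain B where B: "B \<subseteq> D" "\<not> cdependent B" "D \<subseteq> cspan B"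
    using complex_vector.maximal_independent_subset by blast
  obtain g where g: "Vector_Spaces.linear scaleC scaleC g" "\<forall>x\<in>B. g x = f x" "range g = cspan (f ` B)"
    using linear_independent_extend_subspace[of B f] B(2)
    unfolding cdependent_def cspan_def by auto
  interpret g: Vector_Spaces.linear scaleC scaleC g by fact
  have lin: "clinear_on UNIV g" by (simp add: clinear_on_def g.add g.scale)
  have "csubspace {x \<in> D. g x = f x}"
    using D clinear_on_zero[OF f D]
    by (auto simp: complex_vector.subspace_def g.add g.scale g.zero clinear_on_add[OF f] clinear_on_scale[OF f])
  then have "cspan B \<subseteq> {x \<in> D. g x = f x}"
    using B(1) g(2) by (intro complex_vector.span_minimal) auto
  then have eq: "\<forall>x\<in>D. g x = f x" using B(3) by blast
  have "cspan (f ` B) \<subseteq> f ` D"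
    using B(1) by (intro complex_vector.span_minimal csubspace_image[OF f D]) auto
  then have "range g = f ` D" using g(3) eq by (metis image_cong subset_UNIV subset_antisym image_mono)
  then show ?thesis using lin eq by blast
qed

lemma single_valued_csubspace_graph:
  assumes V: "csubspace V" "single_valued V"
  obtains f where "clinear_on (Domain V) f" "V = graph_on (Domain V) f" "csubspace (Domain V)"
proof -
  define f where "f x = (THE y. (x, y) \<in> V)" for x
  have f: "(x, y) \<in> V \<longleftrightarrow> x \<in> Domain V \<and> y = f x" for x y
  proof -
    have "f x = y" if "(x, y) \<in> V" for y
      unfolding f_def using that V(2) by (auto intro!: the_equality dest: single_valuedD)
    then show ?thesis by blast
  qed
  have zero: "(0, 0) \<in> V"
    using complex_vector.subspace_0[OF V(1)] by (simp add: zero_prod_def)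
  have add: "(x + u, y + v) \<in> V" if "(x, y) \<in> V" "(u, v) \<in> V" for x y u v
    using complex_vector.subspace_add[OF V(1) that] by simp
  have scale: "(c *\<^sub>C x, c *\<^sub>C y) \<in> V" if "(x, y) \<in> V" for c x y
    using complex_vector.subspace_scale[OF V(1) that, of c] by (simp add: scaleC_prod_def)
  have "clinear_on (Domain V) f"
    unfolding clinear_on_def
  proof (intro conjI ballI allI)
    fix x y assume "x \<in> Domain V" "y \<in> Domain V"
    then have "(x, f x) \<in> V" "(y, f y) \<in> V" using f by blast+
    from add[OF this] show "f (x + y) = f x + f y" using f by simp
  next
    fix c x assume "x \<in> Domain V"
    then have "(x, f x) \<in> V" using f by blast
    from scale[OF this] show "f (c *\<^sub>C x) = c *\<^sub>C f x" using f by simp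
  qed
  moreover have "V = graph_on (Domain V) f" using f by (auto simp: graph_on_def)
  moreover have "csubspace (Domain V)"
    unfolding complex_vector.subspace_def using zero add scale by blast
  ultimately show ?thesis using that by blast
qed

lemma csubspace_graph_on:
  assumes "clinear_on X f" "csubspace X"
  shows "csubspace (graph_on X f)"
  unfolding complex_vector.subspace_def graph_on_def
  using assms clinear_on_zero[OF assms]
  by (auto simp: zero_prod_def scaleC_prod_def clinear_on_add clinear_on_scale complex_vector.subspace_0 
    complex_vector.subspace_add complex_vector.subspace_scale)

lemma graph_on_iff: "(x, y) \<in> graph_on X f \<longleftrightarrow> x \<in> X \<and> y = f x"
  by (auto simp: graph_on_def)

lemma Domain_graph_on [simp]: "Domain (graph_on X f) = X"
  by (auto simp: graph_on_def)

lemma single_valued_graph_on [simp]: "single_valued (graph_on X f)"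
  by (auto simp: graph_on_def single_valued_def)

text \<open>For the graph of a function on \<open>X1 + X2\<close> the matrix equation becomes a pointwise formula.  Different
decompositions of the same point must give the same value, namely that of \<open>F\<close>.\<close>

lemma has_matrix_graph_iff:
  assumes "\<And>x. x \<in> X \<longleftrightarrow> (\<exists>x1\<in>X1. \<exists>x2\<in>X2. x = x1 + x2)"
  shows "has_matrix (graph_on X F) [X1, X2] [Y1, Y2] [[a, b], [c, d]] \<longleftrightarrow>
    lin_op X1 Y1 a \<and> lin_op X2 Y1 b \<and> lin_op X1 Y2 c \<and> lin_op X2 Y2 d \<and>
    (\<forall>x1\<in>X1. \<forall>x2\<in>X2. F (x1 + x2) = (a x1 + b x2) + (c x1 + d x2))"
proof -
  have "graph_on X F = {(x1 + x2, (a x1 + b x2) + (c x1 + d x2)) | x1 x2. x1 \<in> X1 \<and> x2 \<in> X2} \<longleftrightarrow>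
    (\<forall>x1\<in>X1. \<forall>x2\<in>X2. F (x1 + x2) = (a x1 + b x2) + (c x1 + d x2))" (is "?G = ?M \<longleftrightarrow> ?r")
  proof
    assume eq: "?G = ?M"
    show ?r
    proof (intro ballI)
      fix x1 x2 assume "x1 \<in> X1" "x2 \<in> X2"
      then have "(x1 + x2, (a x1 + b x2) + (c x1 + d x2)) \<in> ?G" unfolding eq by blast
      then show "F (x1 + x2) = (a x1 + b x2) + (c x1 + d x2)" by (simp add: graph_on_iff)
    qed
  next
    assume r: ?r
    show "?G = ?M"
    proof (intro equalityI subsetI)
      fix p assume "p \<in> ?G"
      then obtain x where x: "p = (x, F x)" "x \<in> X" by (auto simp: graph_on_def)
      then obtain x1 x2 where "x1 \<in> X1" "x2 \<in> X2" "x = x1 + x2" using assms by blast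
      then show "p \<in> ?M" using x r by blast
    next
      fix p assume "p \<in> ?M"
      then obtain x1 x2 where "x1 \<in> X1" "x2 \<in> X2" "p = (x1 + x2, (a x1 + b x2) + (c x1 + d x2))" by blast
      then show "p \<in> ?G" using r assms[of "x1 + x2"] by (auto simp: graph_on_iff)
    qed
  qed
  then show ?thesis by (simp add: has_matrix_2x2)
qed

lemma standard_unitary_graph_iff:
  fixes f :: "'a::chilbert_space \<Rightarrow> 'b::chilbert_space"
  assumes "clinear_on UNIV f"
  shows "standard_unitary ip ip' (graph_on UNIV f) \<longleftrightarrow>
    bij f \<and> (\<exists>K. \<forall>x. norm (f x) \<le> K * norm x) \<and> (\<forall>x u. ip' (f x) (f u) = ip x u)"
proof -
  have "single_valued ((graph_on UNIV f)\<inverse>) \<longleftrightarrow> inj f"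
    by (auto simp: single_valued_def graph_on_def inj_on_def)
  moreover have "Range (graph_on UNIV f) = range f" by (auto simp: graph_on_def)
  moreover have "csubspace (graph_on UNIV f)"
    by (rule csubspace_graph_on[OF assms complex_vector.subspace_UNIV])
  moreover have ball: "(\<forall>p\<in>graph_on UNIV f. Q p) \<longleftrightarrow> (\<forall>x. Q (x, f x))" for Q
    by (auto simp: graph_on_def)
  ultimately show ?thesis
    unfolding standard_unitary_def bij_def ball by simp
qed

section \<open>The geometry of one boundary triple\<close>

text \<open>In the doubled space the Krein adjoint \<open>T\<^sup>+\<close> is the orthogonal companion of \<open>T\<close> for the indefinite
product.  Working with this companion in an arbitrary Krein space avoids all reference to pairs until the very end.\<close>

definition ip_orth :: "('a \<Rightarrow> 'a \<Rightarrow> complex) \<Rightarrow> 'a set \<Rightarrow> 'a set"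
  where "ip_orth ip S = {y. \<forall>x\<in>S. ip x y = 0}"

context krein_space
begin

lemma J_add: "J (x + y) = J x + J y" and J_scale: "J (c *\<^sub>C x) = c *\<^sub>C J x"
  using J_linear by (auto simp: clinear_on_def)

lemma J_zero [simp]: "J 0 = 0" using J_scale[of 0 0] by simp

lemma J_minus: "J (- x) = - J x" using J_scale[of "-1" x] by (simp add: scaleC_minus1)

lemma J_diff: "J (x - y) = J x - J y" using J_add[of x "- y"] by (simp add: J_minus)

lemma J_J [simp]: "J (J x) = x" by (rule J_involution)

lemma ip_eq: "ip x y = cinner x (J y)" using ip_J[of x "J y"] by simp

lemma cinner_J_left: "cinner (J x) y = cinner x (J y)"
proof -
  have "cinner (J x) y = ip (J x) (J y)" by (simp add: ip_J)
  also have "\<dots> = cnj (ip (J y) (J x))" by (rule ip_commute)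
  also have "\<dots> = cinner x (J y)" by (simp add: ip_J flip: cinner_commute)
  finally show ?thesis .
qed

lemma cinner_J_J [simp]: "cinner (J x) (J y) = cinner x y"
  by (simp add: cinner_J_left)

lemma norm_J [simp]: "norm (J x) = norm x"
proof -
  have "complex_of_real ((norm (J x))\<^sup>2) = of_real ((norm x)\<^sup>2)"
    by (simp only: cinner_J_J flip: cinner_self)
  then show ?thesis unfolding of_real_eq_iff by (subst (asm) power2_eq_iff_nonneg) auto
qed

lemma in_J_image: "x \<in> J ` S \<longleftrightarrow> J x \<in> S"
  by (metis J_J image_eqI image_iff)

lemma J_J_image [simp]: "J ` J ` S = S"
  by (simp add: image_image)

lemma clinear_on_J: "clinear_on X J"
  by (simp add: clinear_on_def J_add J_scale)

lemma csubspace_J_image: "csubspace S \<Longrightarrow> csubspace (J ` S)"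
  by (intro csubspace_image clinear_on_J)

lemma closed_J: assumes "closed S" shows "closed (J ` S)"
proof -
  have "continuous_on UNIV J"
    unfolding continuous_on_def by (auto intro!: tendstoI simp: dist_norm simp flip: J_diff)
     (auto simp: eventually_at dist_norm)
  then have "closed (J -` S)" using assms by (simp add: closed_vimage)
  moreover have "J -` S = J ` S" by (auto simp: in_J_image)
  ultimately show ?thesis by simp
qed

lemma orth_J_image: "orth (J ` S) = J ` orth S"
  by (auto simp: in_J_image orth_def cinner_J_left)

lemma ip_orth_eq: "ip_orth ip S = orth (J ` S)"
  by (auto simp: ip_orth_def orth_def ip_eq cinner_J_left)

lemma ip_orth_ip_orth: "csubspace S \<Longrightarrow> closed S \<Longrightarrow> ip_orth ip (ip_orth ip S) = S"
  by (simp add: ip_orth_eq orth_J_image orth_orth)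

end

text \<open>The factor \<open>\<i>\<close> in Green's identity is the one that relates $[f,g'] - [f',g]$ to the inner product
$-i[f,g'] + i[f',g]$ of the doubled space.\<close>

locale boundary_triple_space = krein_space ip J
  for ip :: "'a::chilbert_space \<Rightarrow> 'a \<Rightarrow> complex" and J :: "'a \<Rightarrow> 'a" +
  fixes T :: "'a set" and \<Gamma>0 \<Gamma>1 :: "'a \<Rightarrow> 'l::chilbert_space"
  assumes csubspace_T: "csubspace T" and closed_T: "closed T"
    and neutral_T: "T \<subseteq> ip_orth ip T"
    and clinear_\<Gamma>0: "clinear_on (ip_orth ip T) \<Gamma>0" and clinear_\<Gamma>1: "clinear_on (ip_orth ip T) \<Gamma>1"
    and surj_\<Gamma>: "(\<lambda>x. (\<Gamma>0 x, \<Gamma>1 x)) ` ip_orth ip T = UNIV"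
    and green: "\<And>x y. x \<in> ip_orth ip T \<Longrightarrow> y \<in> ip_orth ip T \<Longrightarrow>
       \<i> * ip x y = cinner (\<Gamma>0 x) (\<Gamma>1 y) - cinner (\<Gamma>1 x) (\<Gamma>0 y)"
begin

abbreviation Tadj :: "'a set" where "Tadj \<equiv> ip_orth ip T"

definition T0 :: "'a set" where "T0 = {x \<in> Tadj. \<Gamma>0 x = 0}"

definition N :: "'a set" where "N = T0 \<inter> orth T"

definition G0inv :: "'l \<Rightarrow> 'a" where "G0inv = inv_into (J ` N) \<Gamma>0"

definition G1inv :: "'l \<Rightarrow> 'a" where "G1inv = inv_into N \<Gamma>1"

definition \<beta> :: "'l \<Rightarrow> 'l" where "\<beta> l = \<Gamma>1 (G0inv l)"

lemma csubspace_Tadj: "csubspace Tadj"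
  by (simp add: ip_orth_eq csubspace_orth)

lemma csubspace_T0: "csubspace T0"
  unfolding T0_def by (rule csubspace_kernel[OF clinear_\<Gamma>0 csubspace_Tadj])

lemma csubspace_N: "csubspace N"
  unfolding N_def by (rule complex_vector.subspace_inter[OF csubspace_T0 csubspace_orth])

lemmas \<Gamma>_add = clinear_on_add[OF clinear_\<Gamma>0] clinear_on_add[OF clinear_\<Gamma>1]
lemmas \<Gamma>_diff = clinear_on_diff[OF clinear_\<Gamma>0 csubspace_Tadj] clinear_on_diff[OF clinear_\<Gamma>1 csubspace_Tadj]

lemma T0_subset: "T0 \<subseteq> Tadj" by (auto simp: T0_def)

lemma \<Gamma>_onto: obtains x where "x \<in> Tadj" "\<Gamma>0 x = a" "\<Gamma>1 x = b"
proof -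
  have "(a, b) \<in> (\<lambda>x. (\<Gamma>0 x, \<Gamma>1 x)) ` Tadj" using surj_\<Gamma> by simp
  then show ?thesis using that by auto
qed

text \<open>Green's identity makes \<open>(\<Gamma>0 x, \<Gamma>1 x)\<close> vanish when tested against the surjective \<open>\<Gamma>\<close>; conversely, an element of the kernel
is orthogonal to all of \<open>T\<^sup>+\<close>, and \<open>T\<close> is closed, so it equals its second companion.\<close>

lemma T_eq_kernel: "T = {x \<in> Tadj. \<Gamma>0 x = 0 \<and> \<Gamma>1 x = 0}"
proof (intro equalityI subsetI)
  fix x assume x: "x \<in> T"
  then have xa: "x \<in> Tadj" using neutral_T by blast
  have eq: "cinner (\<Gamma>0 x) (\<Gamma>1 y) = cinner (\<Gamma>1 x) (\<Gamma>0 y)" if "y \<in> Tadj" for y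
    using green[OF xa that] x that by (simp add: ip_orth_def)
  obtain y where "y \<in> Tadj" "\<Gamma>0 y = 0" "\<Gamma>1 y = \<Gamma>0 x" by (rule \<Gamma>_onto)
  then have "\<Gamma>0 x = 0" using eq[of y] by simp
  moreover obtain z where "z \<in> Tadj" "\<Gamma>0 z = \<Gamma>1 x" "\<Gamma>1 z = 0" by (rule \<Gamma>_onto)
  then have "\<Gamma>1 x = 0" using eq[of z] by simp
  ultimately show "x \<in> {x \<in> Tadj. \<Gamma>0 x = 0 \<and> \<Gamma>1 x = 0}" using xa by simp
next
  fix x assume x: "x \<in> {x \<in> Tadj. \<Gamma>0 x = 0 \<and> \<Gamma>1 x = 0}"
  have "ip y x = 0" if "y \<in> Tadj" for y
    using green[of y x] x that by simp
  then have "x \<in> ip_orth ip Tadj" by (simp add: ip_orth_def)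
  then show "x \<in> T" by (simp add: ip_orth_ip_orth csubspace_T closed_T)
qed

lemma T_subset_T0: "T \<subseteq> T0"
  using T_eq_kernel by (auto simp: T0_def)

text \<open>On \<open>T0\<close> the right-hand side of Green's identity reduces to $-\langle \Gamma_1 x, \Gamma_0 y\rangle$, and \<open>\<Gamma>1\<close> maps \<open>T0\<close> onto the whole
boundary space.  In the doubled space this says that \<open>T0\<close> is self-adjoint.\<close>

lemma ip_orth_T0: "ip_orth ip T0 = T0"
proof (intro equalityI subsetI)
  fix x assume x: "x \<in> T0"
  have "ip y x = 0" if "y \<in> T0" for y
    using green[of y x] x that by (simp add: T0_def)
  then show "x \<in> ip_orth ip T0" by (simp add: ip_orth_def)
next
  fix y assume y: "y \<in> ip_orth ip T0"
  then have ya: "y \<in> Tadj" using T_subset_T0 by (auto simp: ip_orth_def)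
  obtain x where x: "x \<in> Tadj" "\<Gamma>0 x = 0" "\<Gamma>1 x = \<Gamma>0 y" by (rule \<Gamma>_onto)
  then have "ip x y = 0" using y by (auto simp: ip_orth_def T0_def)
  then have "\<Gamma>0 y = 0" using green[OF x(1) ya] x by simp
  then show "y \<in> T0" using ya by (simp add: T0_def)
qed

lemma orth_J_T0: "orth (J ` T0) = T0"
  using ip_orth_T0 by (simp add: ip_orth_eq)

lemma orth_T0: "orth T0 = J ` T0"
  using orth_J_T0 by (simp add: orth_J_image) (metis J_J_image)

lemma closed_T0: "closed T0" using closed_orth[of "J ` T0"] by (simp add: orth_J_T0)

lemma closed_J_T0: "closed (J ` T0)" using closed_orth[of T0] by (simp add: orth_T0)

lemma closed_N: "closed N" unfolding N_def by (intro closed_Int closed_T0 closed_orth)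

lemma csubspace_J_T0: "csubspace (J ` T0)" and csubspace_J_N: "csubspace (J ` N)"
  and csubspace_J_T: "csubspace (J ` T)"
  by (simp_all add: csubspace_J_image csubspace_T0 csubspace_N csubspace_T)

lemma cinner_T0_J_T0: "x \<in> T0 \<Longrightarrow> y \<in> T0 \<Longrightarrow> cinner x (J y) = 0"
  using ip_orth_T0 by (auto simp: ip_orth_def ip_eq)

lemma cinner_T_N: "t \<in> T \<Longrightarrow> n \<in> N \<Longrightarrow> cinner t n = 0"
  by (auto simp: N_def orth_def)

lemma N_subset_T0: "N \<subseteq> T0" by (auto simp: N_def)

lemma J_N_subset: "J ` N \<subseteq> Tadj"
  by (auto simp: ip_orth_def ip_eq cinner_T_N)

lemma decompose_T0:
  assumes "x \<in> T0" obtains t n where "t \<in> T" "n \<in> N" "x = t + n"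
proof -
  obtain t where t: "t \<in> T" "x - t \<in> orth T"
    using projection_exists[OF csubspace_T closed_T] by blast
  moreover have "x - t \<in> T0"
    using assms t T_subset_T0 csubspace_T0 by (simp add: complex_vector.subspace_diff subset_iff)
  ultimately show ?thesis using that[of t "x - t"] by (auto simp: N_def)
qed

lemma decompose:
  obtains a b where "a \<in> T0" "b \<in> J ` T0" "x = a + b"
proof -
  obtain a where "a \<in> T0" "x - a \<in> orth T0"
    using projection_exists[OF csubspace_T0 closed_T0] by blast
  then show ?thesis using that[of a "x - a"] by (simp add: orth_T0)
qed

lemma decompose_J_T0:
  assumes "x \<in> J ` T0" obtains t n where "t \<in> J ` T" "n \<in> J ` N" "x = t + n"
proof -
  have "J x \<in> T0" using assms by (simp add: in_J_image)
  then obtain t n where "t \<in> T" "n \<in> N" "J x = t + n" by (rule decompose_T0)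
  moreover from this have "x = J t + J n" by (metis J_J J_add)
  ultimately show ?thesis using that by blast
qed

lemma T0_Int_J_T0: "x \<in> T0 \<Longrightarrow> x \<in> J ` T0 \<Longrightarrow> x = 0"
  using orth_Int_zero[of x T0] by (simp add: orth_T0)

lemma Tadj_Int_J_T0: "x \<in> J ` T0 \<Longrightarrow> x \<in> Tadj \<Longrightarrow> x \<in> J ` N"
  by (auto simp: N_def ip_orth_eq orth_J_image in_J_image)

text \<open>Subtracting the \<open>T0\<close>-part leaves an element of \<open>J ` T0\<close> that is still in \<open>T\<^sup>+ = orth (J ` T)\<close>, and that is \<open>J ` N\<close>.\<close>

lemma decompose_Tadj:
  assumes "x \<in> Tadj" obtains a u where "a \<in> T0" "u \<in> J ` N" "x = a + u"
proof -
  obtain a b where ab: "a \<in> T0" "b \<in> J ` T0" "x = a + b" by (rule decompose)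
  then have "x - a \<in> Tadj" using assms T0_subset csubspace_Tadj complex_vector.subspace_diff by blast
  then have "b \<in> J ` N" using ab by (simp add: Tadj_Int_J_T0)
  then show ?thesis using that ab by blast
qed

text \<open>In \<open>T\<^sup>+ = T0 + J N\<close> the summand \<open>T0\<close> is the kernel of \<open>\<Gamma>0\<close>.\<close>

lemma bij_\<Gamma>0: "bij_betw \<Gamma>0 (J ` N) UNIV"
  unfolding bij_betw_def
proof
  show "inj_on \<Gamma>0 (J ` N)"
  proof (rule inj_onI)
    fix x y assume xy: "x \<in> J ` N" "y \<in> J ` N" "\<Gamma>0 x = \<Gamma>0 y"
    then have "x - y \<in> J ` N" using csubspace_J_N complex_vector.subspace_diff by blast
    moreover from this have "x - y \<in> T0" "x - y \<in> J ` T0" 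
      using xy J_N_subset N_subset_T0 by (auto simp: T0_def \<Gamma>_diff subset_iff in_J_image)
    ultimately have "x - y = 0" using T0_Int_J_T0 by blast
    then show "x = y" by simp
  qed
  show "\<Gamma>0 ` J ` N = UNIV"
  proof (intro set_eqI iffI UNIV_I)
    fix l
    obtain x where x: "x \<in> Tadj" "\<Gamma>0 x = l" "\<Gamma>1 x = 0" by (rule \<Gamma>_onto)
    obtain a u where au: "a \<in> T0" "u \<in> J ` N" "x = a + u" using x(1) by (rule decompose_Tadj)
    then have "\<Gamma>0 u = l" using x J_N_subset by (auto simp: T0_def \<Gamma>_add subset_iff)
    then show "l \<in> \<Gamma>0 ` J ` N" using au by blast
  qed
qed

text \<open>On \<open>T0 = T + N\<close> the kernel of \<open>\<Gamma>1\<close> is \<open>T\<close>, and \<open>\<Gamma>1\<close> is still onto there.\<close>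

lemma bij_\<Gamma>1: "bij_betw \<Gamma>1 N UNIV"
  unfolding bij_betw_def
proof
  have sub: "N \<subseteq> Tadj" using N_subset_T0 T0_subset by blast
  show "inj_on \<Gamma>1 N"
  proof (rule inj_onI)
    fix x y assume xy: "x \<in> N" "y \<in> N" "\<Gamma>1 x = \<Gamma>1 y"
    then have d: "x - y \<in> N" using csubspace_N complex_vector.subspace_diff by blast
    then have "x - y \<in> Tadj" "\<Gamma>0 (x - y) = 0" "\<Gamma>1 (x - y) = 0"
      using xy sub by (auto simp: N_def T0_def \<Gamma>_diff subset_iff)
    then have "x - y \<in> T" using T_eq_kernel by blast
    then have "x - y = 0" using d orth_Int_zero[of "x - y" T] by (auto simp: N_def)
    then show "x = y" by simp
  qed
  show "\<Gamma>1 ` N = UNIV"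
  proof (intro set_eqI iffI UNIV_I)
    fix l
    obtain x where x: "x \<in> Tadj" "\<Gamma>0 x = 0" "\<Gamma>1 x = l" by (rule \<Gamma>_onto)
    then have "x \<in> T0" by (simp add: T0_def)
    then obtain t n where tn: "t \<in> T" "n \<in> N" "x = t + n" by (rule decompose_T0)
    then have "t \<in> Tadj" "\<Gamma>1 t = 0" "n \<in> Tadj" using sub T_eq_kernel by auto
    then have "\<Gamma>1 n = l" using x tn by (simp add: \<Gamma>_add)
    then show "l \<in> \<Gamma>1 ` N" using tn by blast
  qed
qed

lemma G0inv_in: "G0inv l \<in> J ` N" and \<Gamma>0_G0inv [simp]: "\<Gamma>0 (G0inv l) = l"
  and G0inv_\<Gamma>0: "u \<in> J ` N \<Longrightarrow> G0inv (\<Gamma>0 u) = u"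
  using bij_\<Gamma>0 unfolding G0inv_def bij_betw_def by (auto simp: inv_into_into f_inv_into_f)

lemma G1inv_in: "G1inv l \<in> N" and \<Gamma>1_G1inv [simp]: "\<Gamma>1 (G1inv l) = l"
  and G1inv_\<Gamma>1: "n \<in> N \<Longrightarrow> G1inv (\<Gamma>1 n) = n"
  using bij_\<Gamma>1 unfolding G1inv_def bij_betw_def by (auto simp: inv_into_into f_inv_into_f)

lemma N_subset: "N \<subseteq> Tadj" using N_subset_T0 T0_subset by blast

lemma T_subset: "T \<subseteq> Tadj" by (rule neutral_T)

lemma clinear_G0inv: "clinear_on UNIV G0inv"
  unfolding G0inv_def
  by (rule clinear_on_inv_into[OF clinear_on_subset[OF clinear_\<Gamma>0 J_N_subset] csubspace_J_N bij_\<Gamma>0])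

lemma clinear_G1inv: "clinear_on UNIV G1inv"
  unfolding G1inv_def
  by (rule clinear_on_inv_into[OF clinear_on_subset[OF clinear_\<Gamma>1 N_subset] csubspace_N bij_\<Gamma>1])

lemma clinear_\<beta>: "clinear_on UNIV \<beta>"
  unfolding \<beta>_def[abs_def]
  by (rule clinear_on_compose[OF clinear_G0inv _ clinear_\<Gamma>1]) (use G0inv_in J_N_subset in blast)

lemma \<Gamma>_T [simp]: "t \<in> T \<Longrightarrow> \<Gamma>0 t = 0" "t \<in> T \<Longrightarrow> \<Gamma>1 t = 0"
  using T_eq_kernel by blast+

lemma \<Gamma>0_T0: "a \<in> T0 \<Longrightarrow> \<Gamma>0 a = 0" by (simp add: T0_def)

lemma \<Gamma>1_J_N: "u \<in> J ` N \<Longrightarrow> \<Gamma>1 u = \<beta> (\<Gamma>0 u)"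
  by (simp add: \<beta>_def G0inv_\<Gamma>0)

text \<open>The space \<open>J N\<close> is neutral, so Green's identity has left-hand side zero on it.\<close>

lemma \<beta>_symmetric: "cinner (\<beta> l) m = cinner l (\<beta> m)"
proof -
  have u: "G0inv l \<in> Tadj" "G0inv m \<in> Tadj" using G0inv_in J_N_subset by blast+
  have "ip (G0inv l) (G0inv m) = 0"
    using cinner_T0_J_T0[of "J (G0inv l)" "J (G0inv m)"] G0inv_in[of l] G0inv_in[of m] N_subset_T0
    by (auto simp: ip_eq in_J_image cinner_J_left)
  then show ?thesis using green[OF u] by (simp add: \<beta>_def)
qed

text \<open>This identity is the only link between \<open>\<Gamma>0\<close> on \<open>J N\<close> and \<open>\<Gamma>1\<close> on \<open>N\<close>; the relation between \<open>w0\<close> and \<open>w1\<close> and the symmetry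
of \<open>E0\<close> both come from it.\<close>

lemma green_J_N_N: "u \<in> J ` N \<Longrightarrow> n \<in> N \<Longrightarrow> cinner (\<Gamma>0 u) (\<Gamma>1 n) = \<i> * cinner u (J n)"
  using green[OF subsetD[OF J_N_subset] subsetD[OF N_subset], of u n] \<Gamma>0_T0[OF subsetD[OF N_subset_T0], of n]
  by (simp add: ip_eq)

lemma closed_J_T: "closed (J ` T)" and closed_J_N: "closed (J ` N)"
  by (simp_all add: closed_J closed_T closed_N)

lemma J_image_mono: "A \<subseteq> B \<Longrightarrow> J ` A \<subseteq> J ` B" by blast

lemma N_orth_T: "N \<subseteq> orth T"
  by (auto simp: N_def)

lemma decompose4:
  obtains t n u s where "t \<in> T" "n \<in> N" "u \<in> J ` N" "s \<in> J ` T" "x = t + (n + (u + s))"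
proof -
  obtain a b where "a \<in> T0" "b \<in> J ` T0" "x = a + b" by (rule decompose)
  moreover from this(1) obtain t n where "t \<in> T" "n \<in> N" "a = t + n" by (rule decompose_T0)
  moreover from \<open>b \<in> J ` T0\<close> obtain s u where "s \<in> J ` T" "u \<in> J ` N" "b = s + u" by (rule decompose_J_T0)
  ultimately show ?thesis using that[of t n u s] by (simp add: add_ac)
qed

lemma components_orthogonal:
  assumes "t \<in> T" "n \<in> N" "u \<in> J ` N" "s \<in> J ` T"
  shows "cinner t n = 0" "cinner t u = 0" "cinner t s = 0" "cinner n t = 0" "cinner n u = 0" "cinner n s = 0"
    "cinner u t = 0" "cinner u n = 0" "cinner u s = 0" "cinner s t = 0" "cinner s n = 0" "cinner s u = 0"
proof -
  have sym: "cinner x y = 0 \<Longrightarrow> cinner y x = 0" for x y :: 'a using cinner_commute[of y x] by simp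
  show tn: "cinner t n = 0" using assms cinner_T_N by blast
  show "cinner t u = 0" "cinner t s = 0" "cinner n u = 0" "cinner n s = 0"
    using assms T_subset_T0 N_subset_T0 by (auto intro!: cinner_T0_J_T0)
  moreover show "cinner u s = 0"
    using assms by (auto intro: sym[OF cinner_T_N])
  ultimately show "cinner n t = 0" "cinner u t = 0" "cinner u n = 0" "cinner s t = 0" "cinner s n = 0" "cinner s u = 0"
    using tn by (auto intro: sym)
qed

lemma proj_components:
  assumes "t \<in> T" "n \<in> N" "u \<in> J ` N" "s \<in> J ` T"
  shows "proj T (t + (n + (u + s))) = t" "proj N (t + (n + (u + s))) = n"
    "proj (J ` N) (t + (n + (u + s))) = u" "proj (J ` T) (t + (n + (u + s))) = s"
proof -
  note * = components_orthogonal
  show "proj T (t + (n + (u + s))) = t"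
    using assms by (intro proj_eqI csubspace_T closed_T) (simp_all add: orth_def cinner_add_right *[of _ n u s])
  show "proj N (t + (n + (u + s))) = n"
    using assms by (intro proj_eqI csubspace_N closed_N)
      (simp_all add: orth_def cinner_add_right cinner_diff_right *[of t _ u s])
  show "proj (J ` N) (t + (n + (u + s))) = u"
    using assms(1,2,4) by (intro proj_eqI csubspace_J_N closed_J_N assms(3))
      (simp add: orth_def cinner_add_right cinner_diff_right *[of t n _ s] del: ball_simps image_iff)
  show "proj (J ` T) (t + (n + (u + s))) = s"
    using assms(1,2,3) by (intro proj_eqI csubspace_J_T closed_J_T assms(4))
      (simp add: orth_def cinner_add_right cinner_diff_right *[of t n u] del: ball_simps image_iff)
qed

lemmas proj_T_in = proj_in[OF csubspace_T closed_T]
lemmas proj_N_in = proj_in[OF csubspace_N closed_N]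
lemmas proj_J_N_in = proj_in[OF csubspace_J_N closed_J_N]
lemmas proj_J_T_in = proj_in[OF csubspace_J_T closed_J_T]
lemmas proj_T0_in = proj_in[OF csubspace_T0 closed_T0]
lemmas proj_J_T0_in = proj_in[OF csubspace_J_T0 closed_J_T0]
lemmas clinear_proj_T = clinear_on_proj[OF csubspace_T closed_T]
lemmas clinear_proj_J_N = clinear_on_proj[OF csubspace_J_N closed_J_N]
lemmas clinear_proj_J_T = clinear_on_proj[OF csubspace_J_T closed_J_T]
lemmas clinear_proj_T0 = clinear_on_proj[OF csubspace_T0 closed_T0]
lemmas clinear_proj_J_T0 = clinear_on_proj[OF csubspace_J_T0 closed_J_T0]

lemma proj4: "x = proj T x + (proj N x + (proj (J ` N) x + proj (J ` T) x))"
proof -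
  obtain t n u s where "t \<in> T" "n \<in> N" "u \<in> J ` N" "s \<in> J ` T" "x = t + (n + (u + s))" by (rule decompose4)
  then show ?thesis by (simp add: proj_components)
qed

lemma proj_J_T0_eq: "x \<in> J ` T0 \<Longrightarrow> a \<in> T0 \<Longrightarrow> proj (J ` T0) (x + a) = x"
  by (rule proj_eqI[OF csubspace_J_T0 closed_J_T0]) (simp_all add: orth_J_T0)

lemma proj_T0_eq: "x \<in> J ` T0 \<Longrightarrow> a \<in> T0 \<Longrightarrow> proj T0 (x + a) = a"
  by (rule proj_eqI[OF csubspace_T0 closed_T0]) (simp_all add: orth_T0)

lemma proj_J_T0_T0: "x = proj (J ` T0) x + proj T0 x"
proof -
  obtain a b where "a \<in> T0" "b \<in> J ` T0" "x = a + b" by (rule decompose)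
  then show ?thesis using proj_J_T0_eq[of b a] proj_T0_eq[of b a] by (simp add: add.commute)
qed

lemma proj_J_T_eq: "s \<in> J ` T \<Longrightarrow> u \<in> J ` N \<Longrightarrow> proj (J ` T) (s + u) = s"
  and proj_J_N_eq: "s \<in> J ` T \<Longrightarrow> u \<in> J ` N \<Longrightarrow> proj (J ` N) (s + u) = u"
  using proj_components[OF complex_vector.subspace_0[OF csubspace_T] complex_vector.subspace_0[OF csubspace_N], of u s]
  by (simp_all add: add.commute)

lemma proj_J_T0_split: "x \<in> J ` T0 \<Longrightarrow> x = proj (J ` T) x + proj (J ` N) x"
  using decompose_J_T0[of x] proj_J_T_eq proj_J_N_eq by metis

lemma J_T0_sum: "s \<in> J ` T \<Longrightarrow> u \<in> J ` N \<Longrightarrow> s + u \<in> J ` T0"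
  using J_image_mono[OF T_subset_T0] J_image_mono[OF N_subset_T0] complex_vector.subspace_add[OF csubspace_J_T0] by blast

lemma J_T0_iff: "x \<in> J ` T0 \<longleftrightarrow> (\<exists>s\<in>J ` T. \<exists>u\<in>J ` N. x = s + u)"
  using J_T0_sum decompose_J_T0[of x] by metis

lemma UNIV_iff: "x \<in> UNIV \<longleftrightarrow> (\<exists>y\<in>J ` T0. \<exists>a\<in>T0. x = y + a)"
  using proj_J_T0_T0[of x] proj_J_T0_in proj_T0_in by blast

end

section \<open>Comparing two boundary triples\<close>

locale two_boundary_triples =
  X: boundary_triple_space ip J T \<Gamma>0 \<Gamma>1 + Y: boundary_triple_space ip' J' T' \<Gamma>0' \<Gamma>1'
  for ip :: "'a::chilbert_space \<Rightarrow> 'a \<Rightarrow> complex" and J T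
    and \<Gamma>0 \<Gamma>1 :: "'a \<Rightarrow> 'l::chilbert_space"
    and ip' :: "'b::chilbert_space \<Rightarrow> 'b \<Rightarrow> complex" and J' T'
    and \<Gamma>0' \<Gamma>1' :: "'b \<Rightarrow> 'l"
begin

definition w0 :: "'a \<Rightarrow> 'b" where "w0 x = J' (Y.G0inv (\<Gamma>0 (J x)))"

definition w1 :: "'a \<Rightarrow> 'b" where "w1 x = Y.G1inv (\<Gamma>1 x)"

definition w01 :: "'a \<Rightarrow> 'b" where "w01 x = Y.G1inv (X.\<beta> (\<Gamma>0 x) - Y.\<beta> (\<Gamma>0 x))"

definition E0 :: "'b \<Rightarrow> 'b"
  where "E0 y = (- \<i>) *\<^sub>C J' (Y.G1inv (X.\<beta> (\<Gamma>0' y) - Y.\<beta> (\<Gamma>0' y)))"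

definition \<V> :: "('a \<times> 'b) set set"
  where "\<V> = transforms (graph_on X.Tadj (\<lambda>x. (\<Gamma>0 x, \<Gamma>1 x))) (graph_on Y.Tadj (\<lambda>y. (\<Gamma>0' y, \<Gamma>1' y)))"

lemma w0_in: "w0 x \<in> Y.N"
  using Y.G0inv_in[of "\<Gamma>0 (J x)"] by (simp add: w0_def Y.in_J_image)

lemma w1_in: "w1 x \<in> Y.N" by (simp add: w1_def Y.G1inv_in)

lemma w01_in: "w01 x \<in> Y.N" by (simp add: w01_def Y.G1inv_in)

lemma E0_in: "E0 y \<in> J' ` Y.N"
  unfolding E0_def by (intro complex_vector.subspace_scale[OF Y.csubspace_J_N] imageI Y.G1inv_in)

lemma clinear_w0: "clinear_on X.N w0"
proof -
  have "clinear_on X.N (\<lambda>x. \<Gamma>0 (J x))"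
    by (rule clinear_on_compose[OF X.clinear_on_J _ X.clinear_\<Gamma>0]) (use X.J_N_subset in blast)
  then have "clinear_on X.N (\<lambda>x. Y.G0inv (\<Gamma>0 (J x)))"
    by (rule clinear_on_compose[OF _ UNIV_I Y.clinear_G0inv])
  from clinear_on_compose[OF this UNIV_I Y.clinear_on_J] show ?thesis
    by (simp add: w0_def[abs_def])
qed

lemma clinear_w1: "clinear_on X.N w1"
  unfolding w1_def[abs_def]
  by (rule clinear_on_compose[OF clinear_on_subset[OF X.clinear_\<Gamma>1 X.N_subset] UNIV_I Y.clinear_G1inv])

lemma clinear_\<beta>_diff: "clinear_on UNIV (\<lambda>l. Y.G1inv (X.\<beta> l - Y.\<beta> l))"
  by (rule clinear_on_compose[OF clinear_on_sub[OF X.clinear_\<beta> Y.clinear_\<beta>] UNIV_I Y.clinear_G1inv])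

lemma clinear_w01: "clinear_on (J ` X.N) w01"
  unfolding w01_def[abs_def]
  by (rule clinear_on_compose[OF clinear_on_subset[OF X.clinear_\<Gamma>0 X.J_N_subset] UNIV_I clinear_\<beta>_diff])

lemma clinear_E0: "clinear_on (J' ` Y.N) E0"
proof -
  have "clinear_on (J' ` Y.N) (\<lambda>y. Y.G1inv (X.\<beta> (\<Gamma>0' y) - Y.\<beta> (\<Gamma>0' y)))"
    by (rule clinear_on_compose[OF clinear_on_subset[OF Y.clinear_\<Gamma>0 Y.J_N_subset] UNIV_I clinear_\<beta>_diff])
  from clinear_on_scaleC[OF clinear_on_compose[OF this UNIV_I Y.clinear_on_J]] show ?thesis
    unfolding E0_def[abs_def] .
qed

lemma bij_w0: "bij_betw w0 X.N Y.N"
  and inv_into_w0: "y \<in> Y.N \<Longrightarrow> inv_into X.N w0 y = J (X.G0inv (\<Gamma>0' (J' y)))"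
proof -
  let ?g = "\<lambda>y. J (X.G0inv (\<Gamma>0' (J' y)))"
  have g: "?g y \<in> X.N" for y using X.G0inv_in[of "\<Gamma>0' (J' y)"] by (simp add: X.in_J_image)
  have gw: "?g (w0 x) = x" if "x \<in> X.N" for x
    using that X.G0inv_\<Gamma>0[of "J x"] by (simp add: w0_def)
  have wg: "w0 (?g y) = y" if "y \<in> Y.N" for y
    using that Y.G0inv_\<Gamma>0[of "J' y"] by (simp add: w0_def)
  show bij: "bij_betw w0 X.N Y.N"
    by (rule bij_betw_byWitness[where f'="?g"]) (use g gw wg w0_in in auto)
  show "inv_into X.N w0 y = ?g y" if "y \<in> Y.N"
    using bij g wg that by (auto intro!: inv_into_f_eq simp: bij_betw_def)
qed

text \<open>Both \<open>w0\<close> and \<open>w1\<close> preserve boundary values, and by \<open>green_J_N_N\<close> the pairing of boundary values is the inner product on either side.\<close>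

lemma cinner_w0_w1: "m \<in> X.N \<Longrightarrow> n \<in> X.N \<Longrightarrow> cinner (w0 m) (w1 n) = cinner m n"
proof -
  assume mn: "m \<in> X.N" "n \<in> X.N"
  have "\<i> * cinner (J' (w0 m)) (J' (w1 n)) = cinner (\<Gamma>0' (J' (w0 m))) (\<Gamma>1' (w1 n))"
    using Y.green_J_N_N[of "J' (w0 m)" "w1 n"] w0_in[of m] w1_in[of n] by simp
  also have "\<dots> = cinner (\<Gamma>0 (J m)) (\<Gamma>1 n)" by (simp add: w0_def w1_def)
  also have "\<dots> = \<i> * cinner (J m) (J n)" using X.green_J_N_N[of "J m" n] mn by simp
  finally show ?thesis by simp
qed

text \<open>The inverse of \<open>w1\<close> is a formal adjoint of \<open>w0\<close>.\<close>

lemma w0_bounded: "\<exists>K. \<forall>x\<in>X.N. norm (w0 x) \<le> K * norm x"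
proof (rule bounded_of_formal_adjoint[OF X.csubspace_N X.closed_N _ _ _ Y.csubspace_N])
  let ?g = "\<lambda>y. X.G1inv (\<Gamma>1' y)"
  show "?g y \<in> X.N" for y by (rule X.G1inv_in)
  show "cinner y (w0 x) = cinner (?g y) x" if "x \<in> X.N" "y \<in> Y.N" for x y
  proof -
    have "w1 (?g y) = y" using that by (simp add: w1_def Y.G1inv_\<Gamma>1)
    then have "cinner (w0 x) y = cinner x (?g y)" using cinner_w0_w1[OF that(1) X.G1inv_in] by metis
    then show ?thesis by (metis cinner_commute)
  qed
qed (use w0_in clinear_on_scale[OF clinear_w0] in auto)

text \<open>Here \<open>w1\<close> is a formal adjoint of the inverse of \<open>w0\<close>.\<close>

lemma w0_bounded_below: "\<exists>K. \<forall>x\<in>X.N. norm x \<le> K * norm (w0 x)"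
proof -
  let ?g = "\<lambda>y. inv_into X.N w0 y"
  have g: "?g y \<in> X.N" "w0 (?g y) = y" if "y \<in> Y.N" for y
    using that bij_w0 by (auto simp: bij_betw_def inv_into_into f_inv_into_f)
  have "\<exists>K. \<forall>y\<in>Y.N. norm (?g y) \<le> K * norm y"
  proof (rule bounded_of_formal_adjoint[OF Y.csubspace_N Y.closed_N _ _ _ X.csubspace_N])
    show "cinner x (?g y) = cinner (w1 x) y" if "x \<in> X.N" "y \<in> Y.N" for x y
      using cinner_w0_w1[of "?g y" x] g that by (metis cinner_commute)
  qed (use g w1_in clinear_on_scale[OF clinear_on_inv_into[OF clinear_w0 X.csubspace_N bij_w0]] in auto)
  then obtain K where K: "\<And>y. y \<in> Y.N \<Longrightarrow> norm (?g y) \<le> K * norm y" by blast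
  have "norm x \<le> K * norm (w0 x)" if "x \<in> X.N" for x
    using K[OF w0_in, of x] that bij_w0 by (simp add: bij_betw_def)
  then show ?thesis by blast
qed

text \<open>By \<open>green_J_N_N\<close>, the form of \<open>E0\<close> at \<open>x, y\<close> is
$-\langle \Gamma_0' x, (\beta - \beta') \Gamma_0' y\rangle$, and \<open>\<beta>\<close> and \<open>\<beta>'\<close> are symmetric.\<close>

lemma E0_symmetric: "x \<in> J' ` Y.N \<Longrightarrow> y \<in> J' ` Y.N \<Longrightarrow> cinner (E0 x) y = cinner x (E0 y)"
proof -
  have key: "cinner x (E0 y) = - cinner (\<Gamma>0' x) (X.\<beta> (\<Gamma>0' y) - Y.\<beta> (\<Gamma>0' y))" if "x \<in> J' ` Y.N" for x y
    using Y.green_J_N_N[OF that Y.G1inv_in] by (simp add: E0_def cinner_scaleC_right)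
  assume "x \<in> J' ` Y.N" "y \<in> J' ` Y.N"
  then have "cinner x (E0 y) = cnj (cinner y (E0 x))"
    by (simp add: key cinner_diff_right X.\<beta>_symmetric Y.\<beta>_symmetric cinner_diff_left flip: cinner_commute)
  then show ?thesis by (simp flip: cinner_commute)
qed

lemma E0_bounded: "\<exists>K. \<forall>y\<in>J' ` Y.N. norm (E0 y) \<le> K * norm y"
  by (rule bounded_of_formal_adjoint[OF Y.csubspace_J_N Y.closed_J_N E0_in E0_in _ Y.csubspace_J_N])
     (rule E0_symmetric[symmetric], assumption+, rule clinear_on_scale[OF clinear_E0])

text \<open>Closedness of the graph follows from symmetry on the closed domain: limits may be moved to the other side of the inner product.\<close>

lemma closed_symmetric_E0: "closed_symmetric_op (J' ` Y.T0) (J' ` Y.N) E0"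
  unfolding closed_symmetric_op_def
proof (intro conjI)
  show sub: "J' ` Y.N \<subseteq> J' ` Y.T0" by (intro Y.J_image_mono Y.N_subset_T0)
  show "csubspace (J' ` Y.N)" by (rule Y.csubspace_J_N)
  show "lin_op (J' ` Y.N) (J' ` Y.T0) E0" using sub E0_in by (intro lin_opI clinear_E0) blast
  show "graph_on (J' ` Y.N) E0 \<subseteq> adj_rel (J' ` Y.T0) (J' ` Y.T0) (graph_on (J' ` Y.N) E0)"
    using sub E0_in by (auto simp: adj_rel_def graph_on_def E0_symmetric)
  show "closed (graph_on (J' ` Y.N) E0)"
    unfolding closed_sequential_limits
  proof (intro allI impI, elim conjE)
    fix s l assume s: "\<forall>n. s n \<in> graph_on (J' ` Y.N) E0" and lim: "s \<longlonglongrightarrow> l"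
    have mem: "fst (s n) \<in> J' ` Y.N" "snd (s n) = E0 (fst (s n))" for n
      using s[rule_format, of n] by (auto simp: graph_on_def)
    have l1: "(\<lambda>n. fst (s n)) \<longlonglongrightarrow> fst l" and l2: "(\<lambda>n. snd (s n)) \<longlonglongrightarrow> snd l"
      using lim by (auto intro: tendsto_intros)
    have in1: "fst l \<in> J' ` Y.N" using closed_sequentially[OF Y.closed_J_N _ l1] mem(1) by blast
    have in2: "snd l \<in> J' ` Y.N" using closed_sequentially[OF Y.closed_J_N _ l2] mem(2) E0_in by simp
    have "snd l = E0 (fst l)"
    proof (rule cinner_ext[of "J' ` Y.N"])
      show "snd l - E0 (fst l) \<in> J' ` Y.N"
        using in2 E0_in by (intro complex_vector.subspace_diff Y.csubspace_J_N)
      fix z assume z: "z \<in> J' ` Y.N"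
      have "(\<lambda>n. cinner z (snd (s n))) \<longlonglongrightarrow> cinner z (snd l)" by (intro tendsto_intros l2)
      moreover have "(\<lambda>n. cinner (E0 z) (fst (s n))) \<longlonglongrightarrow> cinner (E0 z) (fst l)" by (intro tendsto_intros l1)
      moreover have "cinner z (snd (s n)) = cinner (E0 z) (fst (s n))" for n
        using mem z by (simp add: E0_symmetric)
      ultimately show "cinner z (snd l) = cinner z (E0 (fst l))"
        using LIMSEQ_unique in1 z by (simp add: E0_symmetric)
    qed
    then show "l \<in> graph_on (J' ` Y.N) E0" using in1 by (cases l) (simp add: graph_on_iff)
  qed
qed

text \<open>The equation \<open>\<Gamma>' = \<Gamma> V\<^sup>-\<^sup>1\<close> for the graph of a function: that the right-hand side is contained in \<open>\<Gamma>'\<close>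
says that \<open>f\<close> preserves boundary values, the other inclusion that it reaches all of \<open>T'\<^sup>+\<close>.\<close>

lemma graph_in_\<V>_iff:
  assumes "clinear_on D f" "csubspace D"
  shows "graph_on D f \<in> \<V> \<longleftrightarrow>
    (\<forall>x\<in>D \<inter> X.Tadj. f x \<in> Y.Tadj \<and> \<Gamma>0' (f x) = \<Gamma>0 x \<and> \<Gamma>1' (f x) = \<Gamma>1 x) \<and> (\<forall>y\<in>Y.Tadj. \<exists>x\<in>D \<inter> X.Tadj. f x = y)"
  (is "_ \<longleftrightarrow> ?a \<and> ?b")
proof -
  let ?G = "graph_on X.Tadj (\<lambda>x. (\<Gamma>0 x, \<Gamma>1 x))" and ?G' = "graph_on Y.Tadj (\<lambda>y. (\<Gamma>0' y, \<Gamma>1' y))"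
  have comp: "(y, l) \<in> (graph_on D f)\<inverse> O ?G \<longleftrightarrow> (\<exists>x\<in>D \<inter> X.Tadj. f x = y \<and> l = (\<Gamma>0 x, \<Gamma>1 x))" for y l
    by (auto simp: graph_on_def)
  have "graph_on D f \<in> \<V> \<longleftrightarrow> ?G' = (graph_on D f)\<inverse> O ?G"
    using csubspace_graph_on[OF assms] by (simp add: \<V>_def transforms_def)
  also have "\<dots> \<longleftrightarrow> ?a \<and> ?b"
  proof (intro iffI conjI ballI)
    assume eq: "?G' = (graph_on D f)\<inverse> O ?G"
    show "f x \<in> Y.Tadj" "\<Gamma>0' (f x) = \<Gamma>0 x" "\<Gamma>1' (f x) = \<Gamma>1 x" if "x \<in> D \<inter> X.Tadj" for x
    proof -
      have "(f x, (\<Gamma>0 x, \<Gamma>1 x)) \<in> ?G'" unfolding eq comp using that by blast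
      then show "f x \<in> Y.Tadj" "\<Gamma>0' (f x) = \<Gamma>0 x" "\<Gamma>1' (f x) = \<Gamma>1 x" by (simp_all add: graph_on_iff)
    qed
    fix y assume "y \<in> Y.Tadj"
    then have "(y, (\<Gamma>0' y, \<Gamma>1' y)) \<in> ?G'" by (simp add: graph_on_iff)
    then show "\<exists>x\<in>D \<inter> X.Tadj. f x = y" unfolding eq comp by blast
  next
    assume ab: "?a \<and> ?b"
    show "?G' = (graph_on D f)\<inverse> O ?G"
    proof (rule set_eqI)
      fix p :: "'b \<times> 'l \<times> 'l"
      obtain y l where p: "p = (y, l)" by (cases p)
      show "p \<in> ?G' \<longleftrightarrow> p \<in> (graph_on D f)\<inverse> O ?G"
        unfolding p comp graph_on_iff using ab by fastforce
    qed
  qed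
  finally show ?thesis .
qed

section \<open>Operators that transform one triple into the other\<close>

lemma \<V>_graphD:
  assumes "clinear_on D f" "csubspace D" "graph_on D f \<in> \<V>" "x \<in> D" "x \<in> X.Tadj"
  shows "f x \<in> Y.Tadj" "\<Gamma>0' (f x) = \<Gamma>0 x" "\<Gamma>1' (f x) = \<Gamma>1 x"
  using assms graph_in_\<V>_iff[OF assms(1,2)] by auto

lemma \<V>_graph_onto:
  assumes "clinear_on D f" "csubspace D" "graph_on D f \<in> \<V>" "y \<in> Y.Tadj"
  obtains x where "x \<in> D" "x \<in> X.Tadj" "f x = y"
  using assms graph_in_\<V>_iff[OF assms(1,2)] by blast

text \<open>Points of \<open>T\<close> and of \<open>T'\<close> are those with boundary values zero.\<close>

lemma image_T:
  assumes f: "clinear_on D f" "csubspace D" "graph_on D f \<in> \<V>"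
  shows "f ` (T \<inter> D) = T'"
proof (intro equalityI subsetI)
  fix y assume "y \<in> f ` (T \<inter> D)"
  then obtain x where "x \<in> T" "x \<in> D" "y = f x" by blast
  then show "y \<in> T'" using \<V>_graphD[OF f, of x] X.T_subset Y.T_eq_kernel by auto
next
  fix y assume y: "y \<in> T'"
  then obtain x where x: "x \<in> D" "x \<in> X.Tadj" "f x = y" using \<V>_graph_onto[OF f] Y.T_subset by blast
  then have "x \<in> T" using \<V>_graphD[OF f x(1,2)] y by (subst X.T_eq_kernel) (simp add: x)
  then show "y \<in> f ` (T \<inter> D)" using x by blast
qed

text \<open>The operator keeps the boundary values of \<open>x\<close> by lifting them to \<open>N' + J' N'\<close>, and uses \<open>\<tau>\<close> on the \<open>T\<close>-component.
It reaches every \<open>y\<close>, because a preimage of the boundary values is correct up to an element of \<open>T' = \<tau> T\<close>.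
Its kernel lies in \<open>T\<close>, hence it is injective along with \<open>\<tau>\<close>.\<close>

lemma operator_of_surjection:
  assumes \<tau>: "clinear_on T \<tau>" "\<tau> ` T = T'"
  obtains f where "clinear_on X.Tadj f" "graph_on X.Tadj f \<in> \<V>" "inj_on \<tau> T \<Longrightarrow> inj_on f X.Tadj"
proof -
  \<comment> \<open>In \<open>lift l m\<close> the first summand has boundary values \<open>(l, \<beta>' l)\<close>; the second corrects the \<open>\<Gamma>1\<close>-value to \<open>m\<close>.\<close>
  define lift where "lift l m = Y.G0inv l + Y.G1inv (m - Y.\<beta> l)" for l m
  have G: "Y.G0inv l \<in> Y.Tadj" "Y.G1inv m \<in> Y.Tadj" "\<Gamma>0' (Y.G1inv m) = 0" for l m
    using subsetD[OF Y.J_N_subset Y.G0inv_in] subsetD[OF Y.N_subset Y.G1inv_in]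
      Y.\<Gamma>0_T0[OF subsetD[OF Y.N_subset_T0 Y.G1inv_in]] by blast+
  have lift: "lift l m \<in> Y.Tadj" "\<Gamma>0' (lift l m) = l" "\<Gamma>1' (lift l m) = m" for l m
    using G by (simp_all add: lift_def Y.\<Gamma>_add complex_vector.subspace_add[OF Y.csubspace_Tadj] Y.\<beta>_def)
  define f where "f x = \<tau> (proj T x) + lift (\<Gamma>0 x) (\<Gamma>1 x)" for x
  have \<tau>_in: "\<tau> (proj T x) \<in> T'" for x using \<tau>(2) X.proj_T_in by blast
  have lin: "clinear_on X.Tadj f"
  proof -
    have "clinear_on X.Tadj (\<lambda>x. \<tau> (proj T x))"
      by (rule clinear_on_compose[OF X.clinear_proj_T X.proj_T_in \<tau>(1)])
    moreover have "clinear_on X.Tadj (\<lambda>x. Y.G0inv (\<Gamma>0 x))"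
      by (rule clinear_on_compose[OF X.clinear_\<Gamma>0 UNIV_I Y.clinear_G0inv])
    moreover have "clinear_on X.Tadj (\<lambda>x. Y.\<beta> (\<Gamma>0 x))"
      by (rule clinear_on_compose[OF X.clinear_\<Gamma>0 UNIV_I Y.clinear_\<beta>])
    then have "clinear_on X.Tadj (\<lambda>x. Y.G1inv (\<Gamma>1 x - Y.\<beta> (\<Gamma>0 x)))"
      by (intro clinear_on_compose[OF _ UNIV_I Y.clinear_G1inv] clinear_on_sub X.clinear_\<Gamma>1)
    ultimately show ?thesis
      unfolding f_def[abs_def] lift_def by (intro clinear_on_plus)
  qed
  have fmem: "f x \<in> Y.Tadj" "\<Gamma>0' (f x) = \<Gamma>0 x" "\<Gamma>1' (f x) = \<Gamma>1 x" for x
    using \<tau>_in[of x] lift subsetD[OF Y.T_subset \<tau>_in[of x]]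
    by (simp_all add: f_def Y.\<Gamma>_add complex_vector.subspace_add[OF Y.csubspace_Tadj])
  have fT: "f x = \<tau> x" if "x \<in> T" for x
  proof -
    have "proj T x = x" using that
      by (intro proj_eqI X.csubspace_T X.closed_T) (simp_all add: complex_vector.subspace_0[OF csubspace_orth])
    moreover have "lift 0 0 = 0"
      by (simp add: lift_def clinear_on_zero[OF Y.clinear_G0inv] clinear_on_zero[OF Y.clinear_G1inv]
          clinear_on_zero[OF Y.clinear_\<beta>])
    ultimately show ?thesis using that by (simp add: f_def)
  qed
  have "graph_on X.Tadj f \<in> \<V>"
    unfolding graph_in_\<V>_iff[OF lin X.csubspace_Tadj]
  proof (intro conjI ballI)
    fix y assume y: "y \<in> Y.Tadj"
    obtain x where x: "x \<in> X.Tadj" "\<Gamma>0 x = \<Gamma>0' y" "\<Gamma>1 x = \<Gamma>1' y" by (rule X.\<Gamma>_onto)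
    have "y - f x \<in> T'"
      using y x fmem[of x] by (subst Y.T_eq_kernel)
        (simp add: Y.\<Gamma>_diff complex_vector.subspace_diff[OF Y.csubspace_Tadj])
    then obtain t where t: "t \<in> T" "\<tau> t = y - f x" using \<tau>(2) by (metis imageE)
    have "f (x + t) = f x + f t" using x t X.T_subset by (intro clinear_on_add[OF lin]) auto
    then show "\<exists>x\<in>X.Tadj \<inter> X.Tadj. f x = y"
      using t x X.T_subset by (intro bexI[of _ "x + t"]) 
        (auto simp: fT intro!: complex_vector.subspace_add[OF X.csubspace_Tadj])
  qed (use fmem in auto)
  moreover have "inj_on f X.Tadj" if inj: "inj_on \<tau> T"
  proof (rule inj_onI)
    fix x y assume xy: "x \<in> X.Tadj" "y \<in> X.Tadj" "f x = f y"
    then have "x - y \<in> T"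
      using fmem[of x] fmem[of y] 
      by (subst X.T_eq_kernel) (simp add: X.\<Gamma>_diff complex_vector.subspace_diff[OF X.csubspace_Tadj])
    moreover have "f (x - y) = 0" using xy clinear_on_diff[OF lin X.csubspace_Tadj] by simp
    ultimately have "\<tau> (x - y) = \<tau> 0" using fT clinear_on_zero[OF \<tau>(1) X.csubspace_T] by simp
    from inj_onD[OF inj this \<open>x - y \<in> T\<close> complex_vector.subspace_0[OF X.csubspace_T]] have "x - y = 0" .
    then show "x = y" by simp
  qed
  ultimately show ?thesis using that lin by blast
qed

lemma csubspace_\<V>: "V \<in> \<V> \<Longrightarrow> csubspace V"
  by (simp add: \<V>_def transforms_def)

theorem operator_iff_surjection:
  "(\<exists>V\<in>\<V>. single_valued V) \<longleftrightarrow> (\<exists>\<tau>. clinear_on T \<tau> \<and> \<tau> ` T = T')"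
proof
  assume "\<exists>V\<in>\<V>. single_valued V"
  then obtain V where V: "V \<in> \<V>" "single_valued V" by blast
  obtain f where f: "clinear_on (Domain V) f" "V = graph_on (Domain V) f" "csubspace (Domain V)"
    using single_valued_csubspace_graph[OF csubspace_\<V>[OF V(1)] V(2)] .
  let ?D = "T \<inter> Domain V"
  have sub: "csubspace ?D" by (rule complex_vector.subspace_inter[OF X.csubspace_T f(3)])
  obtain g where g: "clinear_on UNIV g" "\<forall>x\<in>?D. g x = f x" "range g = f ` ?D"
    using clinear_extension[OF sub clinear_on_subset[OF f(1)]] by blast
  have im: "f ` ?D = T'" using image_T[OF f(1,3)] f(2) V(1) by metis
  have "g ` T = T'"
    using g(2,3) im by (intro equalityI) (blast, metis (no_types, lifting) image_cong image_mono inf_le1)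
  then show "\<exists>\<tau>. clinear_on T \<tau> \<and> \<tau> ` T = T'" using clinear_on_subset[OF g(1)] by blast
next
  assume "\<exists>\<tau>. clinear_on T \<tau> \<and> \<tau> ` T = T'"
  then obtain \<tau> where \<tau>: "clinear_on T \<tau>" "\<tau> ` T = T'" by blast
  obtain f where "graph_on X.Tadj f \<in> \<V>" by (rule operator_of_surjection[OF \<tau>])
  then show "\<exists>V\<in>\<V>. single_valued V" using single_valued_graph_on by blast
qed

lemma single_valued_converse_graph: "single_valued ((graph_on D f)\<inverse>) \<longleftrightarrow> inj_on f D"
  by (auto simp: single_valued_def graph_on_def inj_on_def)

theorem injective_operator_iff_bijection:
  "(\<exists>V\<in>\<V>. single_valued V \<and> single_valued (V\<inverse>) \<and> T \<subseteq> Domain V) \<longleftrightarrow>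
    (\<exists>\<tau>. clinear_on T \<tau> \<and> bij_betw \<tau> T T')"
proof
  assume "\<exists>V\<in>\<V>. single_valued V \<and> single_valued (V\<inverse>) \<and> T \<subseteq> Domain V"
  then obtain V where V: "V \<in> \<V>" "single_valued V" "single_valued (V\<inverse>)" "T \<subseteq> Domain V" by blast
  obtain f where f: "clinear_on (Domain V) f" "V = graph_on (Domain V) f" "csubspace (Domain V)"
    using single_valued_csubspace_graph[OF csubspace_\<V>[OF V(1)] V(2)] .
  have "f ` (T \<inter> Domain V) = T'" using image_T[OF f(1,3)] f(2) V(1) by metis
  moreover have "inj_on f (Domain V)" using V(3) f(2) single_valued_converse_graph by metis
  ultimately have "bij_betw f T T'" using V(4) by (metis bij_betw_def inf.absorb1 inj_on_subset)
  then show "\<exists>\<tau>. clinear_on T \<tau> \<and> bij_betw \<tau> T T'" using clinear_on_subset[OF f(1) V(4)] by blast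
next
  assume "\<exists>\<tau>. clinear_on T \<tau> \<and> bij_betw \<tau> T T'"
  then obtain \<tau> where \<tau>: "clinear_on T \<tau>" "\<tau> ` T = T'" "inj_on \<tau> T" by (auto simp: bij_betw_def)
  obtain f where f: "graph_on X.Tadj f \<in> \<V>" "inj_on f X.Tadj" 
    using operator_of_surjection[OF \<tau>(1,2)] \<tau>(3) by blast
  then show "\<exists>V\<in>\<V>. single_valued V \<and> single_valued (V\<inverse>) \<and> T \<subseteq> Domain V"
    by (intro bexI[OF _ f(1)]) (simp add: f(2) single_valued_converse_graph X.T_subset)
qed

text \<open>An element of \<open>N\<close> has \<open>\<Gamma>0\<close>-value zero, so its image lies in \<open>T0' = T' + N'\<close>, and the \<open>\<Gamma>1\<close>-value fixes the \<open>N'\<close>-component.\<close>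

lemma image_N_component:
  assumes "clinear_on D f" "csubspace D" "graph_on D f \<in> \<V>" "n \<in> X.N" "n \<in> D"
  shows "f n = proj T' (f n) + w1 n"
proof -
  have "n \<in> X.Tadj" using assms(4) X.N_subset by blast
  note m = \<V>_graphD[OF assms(1,2,3,5) this]
  have "f n \<in> Y.T0" using m(1,2) X.\<Gamma>0_T0[OF subsetD[OF X.N_subset_T0 assms(4)]] by (simp add: Y.T0_def)
  then obtain t n' where tn: "t \<in> T'" "n' \<in> Y.N" "f n = t + n'" by (rule Y.decompose_T0)
  have "\<Gamma>1' n' = \<Gamma>1 n"
    using m(3) tn subsetD[OF Y.T_subset tn(1)] subsetD[OF Y.N_subset tn(2)] by (simp add: Y.\<Gamma>_add)
  then have "w1 n = n'" using Y.G1inv_\<Gamma>1[OF tn(2)] by (simp add: w1_def)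
  moreover have "proj T' (f n) = t"
    using tn Y.N_orth_T by (intro proj_eqI Y.csubspace_T Y.closed_T) auto
  ultimately show ?thesis using tn(3) by simp
qed

text \<open>The \<open>\<Gamma>0\<close>-value fixes the \<open>J' N'\<close>-component.  That component contributes \<open>\<beta>' (\<Gamma>0 u)\<close> to the \<open>\<Gamma>1\<close>-value
\<open>\<beta> (\<Gamma>0 u)\<close>, and the \<open>N'\<close>-component has to supply the difference.\<close>

lemma image_J_N_component:
  assumes "clinear_on D f" "csubspace D" "graph_on D f \<in> \<V>" "u \<in> J ` X.N" "u \<in> D"
  shows "f u = proj T' (f u) + (w01 u + J' (w0 (J u)))"
proof -
  have "u \<in> X.Tadj" using assms(4) X.J_N_subset by blast
  note m = \<V>_graphD[OF assms(1,2,3,5) this]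
  obtain a v where av: "a \<in> Y.T0" "v \<in> J' ` Y.N" "f u = a + v" using m(1) by (rule Y.decompose_Tadj)
  obtain t n where tn: "t \<in> T'" "n \<in> Y.N" "a = t + n" using av(1) by (rule Y.decompose_T0)
  have mem: "t \<in> Y.Tadj" "n \<in> Y.Tadj" "v \<in> Y.Tadj" "a \<in> Y.Tadj"
    using av tn Y.T_subset Y.N_subset Y.J_N_subset Y.T0_subset by auto
  have v: "\<Gamma>0' v = \<Gamma>0 u" using m(2) av mem by (simp add: Y.\<Gamma>_add Y.\<Gamma>0_T0)
  have "\<Gamma>1' n + Y.\<beta> (\<Gamma>0 u) = X.\<beta> (\<Gamma>0 u)"
    using m(3) av tn mem v Y.\<Gamma>1_J_N[OF av(2)] X.\<Gamma>1_J_N[OF assms(4)] by (simp add: Y.\<Gamma>_add)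
  then have "\<Gamma>1' n = X.\<beta> (\<Gamma>0 u) - Y.\<beta> (\<Gamma>0 u)" by (simp add: eq_diff_eq)
  then have "w01 u = Y.G1inv (\<Gamma>1' n)" by (simp add: w01_def)
  then have "w01 u = n" using Y.G1inv_\<Gamma>1[OF tn(2)] by simp
  moreover have "J' (w0 (J u)) = v" using Y.G0inv_\<Gamma>0[OF av(2)] v by (simp add: w0_def)
  moreover have "proj T' (f u) = t"
    using Y.proj_components(1)[OF tn(1,2) av(2) complex_vector.subspace_0[OF Y.csubspace_J_T]] tn(3) av(3)
    by (simp add: add.assoc)
  ultimately show ?thesis using tn(3) av(3) by (simp add: add.assoc)
qed

text \<open>Once \<open>T\<close> lies in the domain, so does \<open>T\<^sup>+\<close>: any \<open>x \<in> T\<^sup>+\<close> differs from some point of the domain with the same boundary values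
by an element of \<open>T\<close>.  The unspecified entries are the orthogonal projections of \<open>V\<close>.\<close>

theorem operator_matrix:
  assumes V: "V \<in> \<V>" "single_valued V" "T \<subseteq> Domain V"
  shows "X.Tadj \<subseteq> Domain V \<and>
       (\<exists>\<tau> a12 a13 a14 a24 a34 a44.
          clinear_on T \<tau> \<and> \<tau> ` T = T' \<and> (single_valued (V\<inverse>) \<longrightarrow> bij_betw \<tau> T T') \<and>
          V \<inter> (T \<times> UNIV) = graph_on T \<tau> \<and>
          has_matrix V [T, X.N, J ` X.N, J ` T \<inter> Domain V] [T', Y.N, J' ` Y.N, J' ` T']
            [[\<tau>,      a12,    a13,                     a14],
             [\<lambda>_. 0, w1,     w01,                     a24],
             [\<lambda>_. 0, \<lambda>_. 0, \<lambda>x. J' (w0 (J x)),  a34],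
             [\<lambda>_. 0, \<lambda>_. 0, \<lambda>_. 0,                a44]])"
proof -
  define D where "D = Domain V"
  obtain f where f0: "clinear_on (Domain V) f" "V = graph_on (Domain V) f" "csubspace (Domain V)"
    using single_valued_csubspace_graph[OF csubspace_\<V>[OF V(1)] V(2)] .
  have f: "clinear_on D f" "csubspace D" "graph_on D f \<in> \<V>" and Vf: "V = graph_on D f"
    using f0 V(1) unfolding D_def by auto
  have TD: "T \<subseteq> D" using V(3) by (simp add: D_def)
  have im: "f ` T = T'" using image_T[OF f] TD by (simp add: inf.absorb1)
  have dom: "X.Tadj \<subseteq> D"
  proof
    fix x assume x: "x \<in> X.Tadj"
    obtain y where y: "y \<in> Y.Tadj" "\<Gamma>0' y = \<Gamma>0 x" "\<Gamma>1' y = \<Gamma>1 x" by (rule Y.\<Gamma>_onto)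
    obtain z where z: "z \<in> D" "z \<in> X.Tadj" "f z = y" using \<V>_graph_onto[OF f y(1)] .
    have "x - z \<in> T"
      using x y z \<V>_graphD[OF f z(1,2)]
      by (subst X.T_eq_kernel) (simp add: X.\<Gamma>_diff complex_vector.subspace_diff[OF X.csubspace_Tadj])
    then have "(x - z) + z \<in> D" using z(1) TD by (intro complex_vector.subspace_add[OF f(2)]) auto
    then show "x \<in> D" by simp
  qed
  have bij: "bij_betw f T T'" if "single_valued (V\<inverse>)"
    using that im TD unfolding Vf single_valued_converse_graph bij_betw_def by (auto intro: inj_on_subset)
  have sub: "X.N \<subseteq> D" "J ` X.N \<subseteq> D" using dom X.N_subset X.J_N_subset by auto
  have domJT: "J ` T \<inter> Domain V \<subseteq> D" by (simp add: D_def)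
  have linD: "clinear_on S (\<lambda>x. proj Z (f x))" if "S \<subseteq> D" "csubspace Z" "closed Z" for S and Z :: "'b set"
    by (rule clinear_on_compose[OF clinear_on_subset[OF f(1) that(1)] UNIV_I clinear_on_proj[OF that(2,3)]])
  have matrix: "has_matrix V [T, X.N, J ` X.N, J ` T \<inter> Domain V] [T', Y.N, J' ` Y.N, J' ` T']
            [[f, \<lambda>x. proj T' (f x), \<lambda>x. proj T' (f x), \<lambda>x. proj T' (f x)],
             [\<lambda>_. 0, w1, w01, \<lambda>x. proj Y.N (f x)],
             [\<lambda>_. 0, \<lambda>_. 0, \<lambda>x. J' (w0 (J x)), \<lambda>x. proj (J' ` Y.N) (f x)],
             [\<lambda>_. 0, \<lambda>_. 0, \<lambda>_. 0, \<lambda>x. proj (J' ` T') (f x)]]"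
    unfolding has_matrix_4x4
  proof (intro conjI)
    show "lin_op T T' f" using im clinear_on_subset[OF f(1) TD] by (auto simp: lin_op_def)
    have "clinear_on (J ` X.N) (\<lambda>x. J' (w0 (J x)))"
      by (rule clinear_on_compose[OF clinear_on_compose[OF X.clinear_on_J _ clinear_w0] UNIV_I Y.clinear_on_J])
         (simp add: X.in_J_image)
    then show "lin_op (J ` X.N) (J' ` Y.N) (\<lambda>x. J' (w0 (J x)))"
      using w0_in by (auto intro: lin_opI)
    show "V = {(x1 + (x2 + (x3 + x4)),
        f x1 + (proj T' (f x2) + (proj T' (f x3) + proj T' (f x4))) +
        (0 + (w1 x2 + (w01 x3 + proj Y.N (f x4))) +
         (0 + (0 + (J' (w0 (J x3)) + proj (J' ` Y.N) (f x4))) + (0 + (0 + (0 + proj (J' ` T') (f x4))))))) |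
       x1 x2 x3 x4. x1 \<in> T \<and> x2 \<in> X.N \<and> x3 \<in> J ` X.N \<and> x4 \<in> J ` T \<inter> Domain V}" (is "V = ?M")
    proof -
      have entry: "f (x1 + (x2 + (x3 + x4))) = f x1 + (proj T' (f x2) + (proj T' (f x3) + proj T' (f x4))) +
        (0 + (w1 x2 + (w01 x3 + proj Y.N (f x4))) +
         (0 + (0 + (J' (w0 (J x3)) + proj (J' ` Y.N) (f x4))) + (0 + (0 + (0 + proj (J' ` T') (f x4))))))"
        and inD: "x1 + (x2 + (x3 + x4)) \<in> D"
        if "x1 \<in> T" "x2 \<in> X.N" "x3 \<in> J ` X.N" "x4 \<in> J ` T \<inter> Domain V" for x1 x2 x3 x4
      proof -
        have mem: "x1 \<in> D" "x2 \<in> D" "x3 \<in> D" "x4 \<in> D" using that sub TD unfolding D_def by blast+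
        then have mem': "x3 + x4 \<in> D" "x2 + (x3 + x4) \<in> D" 
          using complex_vector.subspace_add[OF f(2)] by blast+
        then show "x1 + (x2 + (x3 + x4)) \<in> D" using mem complex_vector.subspace_add[OF f(2)] by blast
        have "f (x1 + (x2 + (x3 + x4))) = f x1 + (f x2 + (f x3 + f x4))"
          using mem mem' by (simp add: clinear_on_add[OF f(1)])
        also have "\<dots> = f x1 + ((proj T' (f x2) + w1 x2) + ((proj T' (f x3) + (w01 x3 + J' (w0 (J x3)))) +
            (proj T' (f x4) + (proj Y.N (f x4) + (proj (J' ` Y.N) (f x4) + proj (J' ` T') (f x4))))))"
          using image_N_component[OF f that(2) mem(2)] image_J_N_component[OF f that(3) mem(3)] Y.proj4[of "f x4"]
          by simp
        finally show "f (x1 + (x2 + (x3 + x4))) = f x1 + (proj T' (f x2) + (proj T' (f x3) + proj T' (f x4))) +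
          (0 + (w1 x2 + (w01 x3 + proj Y.N (f x4))) +
         (0 + (0 + (J' (w0 (J x3)) + proj (J' ` Y.N) (f x4))) + (0 + (0 + (0 + proj (J' ` T') (f x4))))))"
          by (simp add: add_ac)
      qed
      show ?thesis
      proof (intro equalityI subsetI)
        fix p assume "p \<in> V"
        then obtain x where x: "p = (x, f x)" "x \<in> D" by (auto simp: Vf graph_on_def)
        obtain x1 x2 x3 x4 where dec: "x1 \<in> T" "x2 \<in> X.N" "x3 \<in> J ` X.N" "x4 \<in> J ` T" "x = x1 + (x2 + (x3 + x4))"
          by (rule X.decompose4)
        have "x4 = x - x1 - x2 - x3" using dec(5) by simp
        also have "\<dots> \<in> D" using dec x(2) sub TD by (intro complex_vector.subspace_diff[OF f(2)]) auto
        finally have "x4 \<in> J ` T \<inter> Domain V" using dec(4) D_def by simp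
        then show "p \<in> ?M" using entry[OF dec(1-3)] dec x(1) by blast
      next
        fix p assume "p \<in> ?M"
        then show "p \<in> V" using entry inD unfolding Vf graph_on_def by (smt (verit) mem_Collect_eq)
      qed
    qed
  qed (intro lin_op_zero lin_opI linD clinear_w1 clinear_w01 w1_in w01_in sub domJT
        Y.csubspace_T Y.csubspace_N Y.csubspace_J_N Y.csubspace_J_T Y.closed_T Y.closed_N Y.closed_J_N Y.closed_J_T
        Y.proj_T_in Y.proj_N_in Y.proj_J_N_in Y.proj_J_T_in)+
  have "graph_on T f = V \<inter> (T \<times> UNIV)" using TD by (auto simp: Vf graph_on_def)
  then show ?thesis
    using dom im bij clinear_on_subset[OF f(1) TD] matrix unfolding D_def by blast
qed

section \<open>The block form of a unitary operator\<close>

lemma graph_sum_iff: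
  "graph_on (J' ` Y.T0) E = graph_sum (graph_on (J' ` Y.N) E0) (graph_on (J' ` T') \<Theta>) \<longleftrightarrow>
    (\<forall>u\<in>J' ` Y.N. \<forall>s\<in>J' ` T'. E (s + u) = E0 u + \<Theta> s)" (is "?l \<longleftrightarrow> ?r")
proof
  assume eq: ?l
  show ?r
  proof (intro ballI)
    fix u s assume "u \<in> J' ` Y.N" "s \<in> J' ` T'"
    then have "(u + s, E0 u + \<Theta> s) \<in> graph_on (J' ` Y.T0) E"
      unfolding eq graph_sum_def graph_on_iff by blast
    then show "E (s + u) = E0 u + \<Theta> s" by (simp add: graph_on_iff add.commute)
  qed
next
  assume r: ?r
  show ?l
    unfolding graph_sum_def graph_on_iff
  proof (intro equalityI subsetI)
    fix p assume "p \<in> graph_on (J' ` Y.T0) E"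
    then obtain y where y: "p = (y, E y)" "y \<in> J' ` Y.T0" by (auto simp: graph_on_def)
    then obtain s u where su: "s \<in> J' ` T'" "u \<in> J' ` Y.N" "y = s + u" using Y.J_T0_iff by blast
    then have "p = (u + s, E0 u + \<Theta> s)" using y r by (simp add: add.commute)
    then show "p \<in> {(x + u, y + v) |x y u v. (x \<in> J' ` Y.N \<and> y = E0 x) \<and> u \<in> J' ` T' \<and> v = \<Theta> u}"
      using su by blast
  next
    fix p assume "p \<in> {(x + u, y + v) |x y u v. (x \<in> J' ` Y.N \<and> y = E0 x) \<and> u \<in> J' ` T' \<and> v = \<Theta> u}"
    then obtain u s where us: "u \<in> J' ` Y.N" "s \<in> J' ` T'" "p = (u + s, E0 u + \<Theta> s)" by blast
    have "E (s + u) = E0 u + \<Theta> s" using r us(1,2) by blast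
    then have "p = (s + u, E (s + u))" by (simp add: us(3) add.commute[of u s])
    then show "p \<in> graph_on (J' ` Y.T0) E"
      using Y.J_T0_sum[OF us(2,1)] by (simp add: graph_on_iff)
  qed
qed

definition unitary_parameters :: "('b \<Rightarrow> 'a) \<Rightarrow> ('b \<Rightarrow> 'b) \<Rightarrow> ('a \<Rightarrow> 'b) \<Rightarrow> ('b \<Rightarrow> 'a) \<Rightarrow> bool"
  where "unitary_parameters B \<Theta> \<tau> b \<longleftrightarrow>
    homeo_op (J' ` Y.T0) (J ` X.T0) B \<and> bounded_selfadjoint (J' ` T') \<Theta> \<and> homeo_op T T' \<tau> \<and>
    has_matrix (graph_on (J' ` Y.T0) B) [J' ` T', J' ` Y.N] [J ` T, J ` X.N]
      [[\<lambda>x. J (adj_op T T' \<tau> (J' x)), \<lambda>_. 0],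
       [b,                                \<lambda>x. J (inv_into X.N w0 (J' x))]]"

definition unitary_matrix :: "('a \<times> 'b) set \<Rightarrow> ('b \<Rightarrow> 'a) \<Rightarrow> ('b \<Rightarrow> 'b) \<Rightarrow> bool"
  where "unitary_matrix V B E \<longleftrightarrow>
    has_matrix V [J ` X.T0, X.T0] [J' ` Y.T0, Y.T0]
      [[inv_into (J' ` Y.T0) B, \<lambda>_. 0],
       [\<lambda>x. \<i> *\<^sub>C J' (E (inv_into (J' ` Y.T0) B x)),
        \<lambda>x. J' (adj_op (J' ` Y.T0) (J ` X.T0) B (J x))]]"

end

locale unitary_of_triples = two_boundary_triples ip J T \<Gamma>0 \<Gamma>1 ip' J' T' \<Gamma>0' \<Gamma>1'
  for ip :: "'a::chilbert_space \<Rightarrow> 'a \<Rightarrow> complex" and J T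
    and \<Gamma>0 \<Gamma>1 :: "'a \<Rightarrow> 'l::chilbert_space"
    and ip' :: "'b::chilbert_space \<Rightarrow> 'b \<Rightarrow> complex" and J' T'
    and \<Gamma>0' \<Gamma>1' :: "'b \<Rightarrow> 'l" +
  fixes f :: "'a \<Rightarrow> 'b" and K :: real
  assumes f_linear: "clinear_on UNIV f" and f_bij: "bij f"
    and f_bound: "\<And>x. norm (f x) \<le> K * norm x" and K_pos: "K > 0"
    and f_ip: "\<And>x u. ip' (f x) (f u) = ip x u"
    and f_in_\<V>: "graph_on UNIV f \<in> \<V>"
begin

lemmas f_add = clinear_on_add[OF f_linear UNIV_I UNIV_I]
lemmas f_diff = clinear_on_diff[OF f_linear complex_vector.subspace_UNIV UNIV_I UNIV_I]

lemma f_inv [simp]: "f (inv f y) = y" "inv f (f x) = x"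
  using f_bij by (simp_all add: bij_is_surj surj_f_inv_f bij_is_inj)

text \<open>For a unitary operator of Krein spaces the bound on the inverse is automatic:
$\|x\|^2 = [x, Jx] = [f x, f (J x)] \le \|f x\|\, K \|x\|$.\<close>

lemma f_bound_below: "norm x \<le> K * norm (f x)"
proof (cases "x = 0")
  case False
  have "(norm x)\<^sup>2 = cmod (ip x (J x))" by (simp add: X.ip_J cinner_self norm_power)
  also have "\<dots> = cmod (cinner (f x) (J' (f (J x))))" by (simp add: Y.ip_eq flip: f_ip)
  also have "\<dots> \<le> norm (f x) * norm (f (J x))" using cinner_cauchy_schwarz[of "f x" "J' (f (J x))"] by simp
  also have "\<dots> \<le> norm (f x) * (K * norm x)" using f_bound[of "J x"] by (intro mult_left_mono) auto
  finally have "norm x * norm x \<le> norm x * (K * norm (f x))" by (simp add: power2_eq_square mult_ac)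
  then show ?thesis using False by simp
qed (use K_pos in simp)

lemma f_Tadj_iff: "f x \<in> Y.Tadj \<longleftrightarrow> x \<in> X.Tadj"
  using \<V>_graphD(1)[OF f_linear complex_vector.subspace_UNIV f_in_\<V> UNIV_I]
    \<V>_graph_onto[OF f_linear complex_vector.subspace_UNIV f_in_\<V>, of "f x"] f_bij
  by (metis bij_is_inj injD)

lemmas \<Gamma>_f = \<V>_graphD(2,3)[OF f_linear complex_vector.subspace_UNIV f_in_\<V> UNIV_I]

lemma f_T0: "x \<in> X.T0 \<Longrightarrow> f x \<in> Y.T0"
  by (simp add: X.T0_def Y.T0_def f_Tadj_iff \<Gamma>_f)

lemma inv_T0: "y \<in> Y.T0 \<Longrightarrow> inv f y \<in> X.T0"
  using f_Tadj_iff[of "inv f y"] \<Gamma>_f[of "inv f y"] by (simp add: X.T0_def Y.T0_def)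

lemma f_image_T: "f ` T = T'"
  using image_T[OF f_linear complex_vector.subspace_UNIV f_in_\<V>] by simp

text \<open>The entries of the block matrix of \<open>f\<close> and of its inverse: \<open>A\<close> and \<open>B\<close> are their compressions to the spaces \<open>J T0\<close> and \<open>J' T0'\<close>,
and they turn out to be inverse to each other because \<open>f\<close> maps \<open>T0\<close> onto \<open>T0'\<close>.  The lower left entry of \<open>f\<close> is
\<open>\<lambda>x. f x - A x\<close>, so \<open>E\<close> solves \<open>\<i> J' E y = f (B y) - y\<close>.\<close>

definition A :: "'a \<Rightarrow> 'b" where "A x = proj (J' ` Y.T0) (f x)"

definition B :: "'b \<Rightarrow> 'a" where "B y = proj (J ` X.T0) (inv f y)"

definition E :: "'b \<Rightarrow> 'b" where "E y = (- \<i>) *\<^sub>C J' (f (B y) - y)"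

lemma B_in: "B y \<in> J ` X.T0" by (simp add: B_def X.proj_J_T0_in)

lemma A_in: "A y \<in> J' ` Y.T0" by (simp add: A_def Y.proj_J_T0_in)

lemma f_B: "y \<in> J' ` Y.T0 \<Longrightarrow> f (B y) - y \<in> Y.T0"
proof -
  assume "y \<in> J' ` Y.T0"
  have "proj X.T0 (inv f y) \<in> X.T0" by (rule X.proj_T0_in)
  then have "- f (proj X.T0 (inv f y)) \<in> Y.T0" using f_T0 Y.csubspace_T0 complex_vector.subspace_neg by blast
  moreover have "f (B y) + f (proj X.T0 (inv f y)) = y"
    using arg_cong[OF X.proj_J_T0_T0[of "inv f y"], of f] by (simp add: f_add B_def)
  then have "f (B y) - y = - f (proj X.T0 (inv f y))" by (metis add_diff_cancel_left' minus_diff_eq)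
  ultimately show ?thesis by simp
qed

lemma A_B: "y \<in> J' ` Y.T0 \<Longrightarrow> A (B y) = y"
  using Y.proj_J_T0_eq[OF _ f_B, of y y] by (simp add: A_def)

lemma B_A: "x \<in> J ` X.T0 \<Longrightarrow> B (A x) = x"
proof -
  assume x: "x \<in> J ` X.T0"
  have "proj Y.T0 (f x) \<in> Y.T0" by (rule Y.proj_T0_in)
  then have a: "inv f (proj Y.T0 (f x)) \<in> X.T0" by (rule inv_T0)
  have "f (x - inv f (proj Y.T0 (f x))) = A x"
    using Y.proj_J_T0_T0[of "f x"] by (simp add: f_diff A_def diff_eq_eq)
  then have "inv f (A x) = x + - inv f (proj Y.T0 (f x))" by (metis add_uminus_conv_diff f_inv(2))
  moreover have "- inv f (proj Y.T0 (f x)) \<in> X.T0" using a X.csubspace_T0 complex_vector.subspace_neg by blast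
  ultimately show ?thesis using X.proj_J_T0_eq[OF x, of "- inv f (proj Y.T0 (f x))"] by (simp add: B_def)
qed

lemma bij_B: "bij_betw B (J' ` Y.T0) (J ` X.T0)"
  by (rule bij_betw_byWitness[where f'=A]) (use A_B B_A A_in B_in in auto)

lemma inv_B: "x \<in> J ` X.T0 \<Longrightarrow> inv_into (J' ` Y.T0) B x = A x"
  using bij_B A_in B_A by (intro inv_into_f_eq) (auto simp: bij_betw_def)

lemma clinear_inv_f: "clinear_on UNIV (inv f)"
  by (rule clinear_on_inv_into[OF f_linear complex_vector.subspace_UNIV f_bij])

lemma clinear_A: "clinear_on S A"
  unfolding A_def[abs_def]
  by (rule clinear_on_compose[OF clinear_on_subset[OF f_linear subset_UNIV] UNIV_I Y.clinear_proj_J_T0])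

lemma clinear_B: "clinear_on S B"
  unfolding B_def[abs_def]
  by (rule clinear_on_compose[OF clinear_on_subset[OF clinear_inv_f subset_UNIV] UNIV_I X.clinear_proj_J_T0])

lemma norm_B: "norm (B y) \<le> K * norm y"
  using norm_proj_le[OF X.csubspace_J_T0 X.closed_J_T0, of "inv f y"] f_bound_below[of "inv f y"] by (simp add: B_def)

lemma homeo_B: "homeo_op (J' ` Y.T0) (J ` X.T0) B"
proof (rule homeo_opI[OF Y.csubspace_J_T0 _ bij_B])
  show "lin_op (J' ` Y.T0) (J ` X.T0) B" by (intro lin_opI clinear_B B_in)
  show "norm (B x) \<le> K * norm x" for x by (rule norm_B)
  fix y assume "y \<in> J' ` Y.T0"
  then have "norm y = norm (A (B y))" by (simp add: A_B)
  also have "\<dots> \<le> norm (f (B y))" unfolding A_def by (rule norm_proj_le[OF Y.csubspace_J_T0 Y.closed_J_T0])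
  also have "\<dots> \<le> K * norm (B y)" by (rule f_bound)
  finally show "norm y \<le> K * norm (B y)" .
qed

lemma E_in: "y \<in> J' ` Y.T0 \<Longrightarrow> E y \<in> J' ` Y.T0"
  unfolding E_def by (intro complex_vector.subspace_scale[OF Y.csubspace_J_T0] imageI f_B)

lemma clinear_E: "clinear_on S E"
proof -
  have "clinear_on S (\<lambda>y. f (B y) - y)"
    by (intro clinear_on_sub clinear_on_id clinear_on_compose[OF clinear_B UNIV_I f_linear])
  from clinear_on_scaleC[OF clinear_on_compose[OF this UNIV_I Y.clinear_on_J]] show ?thesis
    unfolding E_def[abs_def] .
qed

lemma cinner_Y_zero: "x \<in> J' ` Y.T0 \<Longrightarrow> a \<in> Y.T0 \<Longrightarrow> cinner x a = 0"
  using Y.orth_J_T0 by (auto simp: orth_def)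

lemma cinner_Y_T0: "a \<in> Y.T0 \<Longrightarrow> c \<in> Y.T0 \<Longrightarrow> cinner a (J' c) = 0"
  by (rule Y.cinner_T0_J_T0)

text \<open>The spaces \<open>J T0\<close>, \<open>J' T0'\<close> and \<open>T0'\<close> are neutral.  Expanding $0 = [f (B z), f (B w)]$ with
\<open>f (B z) = z + \<i> J' E z\<close> leaves only the two mixed terms.\<close>

lemma E_symmetric:
  assumes z: "z \<in> J' ` Y.T0" and w: "w \<in> J' ` Y.T0"
  shows "cinner (E z) w = cinner z (E w)"
proof -
  define c d where "c = f (B z) - z" and "d = f (B w) - w"
  have cd: "c \<in> Y.T0" "d \<in> Y.T0" using f_B z w by (simp_all add: c_def d_def)
  have "ip (B z) (B w) = 0"
    using X.cinner_T0_J_T0[of "J (B z)" "J (B w)"] B_in[of z] B_in[of w] by (simp add: X.in_J_image X.ip_eq X.cinner_J_left)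
  then have "cinner (z + c) (J' (w + d)) = 0"
    using f_ip[of "B z" "B w"] by (simp add: c_def d_def Y.ip_eq)
  moreover have "cinner z (J' w) = 0" using cinner_Y_zero[OF z, of "J' w"] w by (simp add: Y.in_J_image)
  moreover have "cinner c (J' d) = 0" by (rule cinner_Y_T0[OF cd])
  ultimately have "cinner c (J' w) = - cinner z (J' d)"
    by (simp add: Y.J_add cinner_add_left cinner_add_right eq_neg_iff_add_eq_0 add.commute)
  then show ?thesis
    by (simp add: E_def cinner_scaleC_left cinner_scaleC_right Y.cinner_J_left flip: c_def d_def)
qed

lemma selfadjoint_E: "bounded_selfadjoint (J' ` Y.T0) E"
  unfolding bounded_selfadjoint_iff[OF Y.csubspace_J_T0] bounded_op_def
proof (intro conjI ballI exI[of _ "K * K + 1"])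
  show "lin_op (J' ` Y.T0) (J' ` Y.T0) E" by (intro lin_opI clinear_E E_in)
  fix y
  have "norm (E y) \<le> norm (f (B y)) + norm y" using norm_triangle_ineq4 by (auto simp: E_def norm_scaleC)
  also have "norm (f (B y)) \<le> K * (K * norm y)"
    by (rule order_trans[OF f_bound mult_left_mono[OF norm_B less_imp_le[OF K_pos]]])
  finally show "norm (E y) \<le> (K * K + 1) * norm y" by (simp add: algebra_simps)
qed (rule E_symmetric)

text \<open>Pairing \<open>B y\<close> with \<open>x\<close> equals $[f (B y), f (J x)]$, and the part \<open>f (B y) - y\<close> is orthogonal to \<open>J' (f (J x))\<close>.
This determines the second diagonal entry of \<open>f\<close>.\<close>

lemma adj_B: 
  assumes x: "x \<in> J ` X.T0" 
  shows "adj_op (J' ` Y.T0) (J ` X.T0) B x = J' (f (J x))"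
proof (rule adj_op_eqI[OF Y.csubspace_J_T0 _ x])
  have fx: "f (J x) \<in> Y.T0" using x by (intro f_T0) (simp add: X.in_J_image)
  then show "J' (f (J x)) \<in> J' ` Y.T0" by blast
  fix y assume y: "y \<in> J' ` Y.T0"
  have "cinner (B y) x = ip' (f (B y)) (f (J x))" by (simp add: f_ip X.ip_J)
  also have "\<dots> = cinner (y + (f (B y) - y)) (J' (f (J x)))" by (simp add: Y.ip_eq)
  also have "\<dots> = cinner y (J' (f (J x)))"
    using cinner_Y_T0[OF f_B[OF y] fx] by (simp only: cinner_add_left add_0_right)
  finally show "cinner (B y) x = cinner y (J' (f (J x)))" .
qed

lemma homeo_T: "homeo_op T T' f"
proof (rule homeo_opI[OF X.csubspace_T])
  show "lin_op T T' f" using f_image_T clinear_on_subset[OF f_linear subset_UNIV] by (auto simp: lin_op_def)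
  show "bij_betw f T T'" using f_image_T f_bij by (auto simp: bij_betw_def intro: inj_on_subset)
qed (rule f_bound f_bound_below)+

text \<open>Restricting \<open>adj_B\<close> to \<open>T\<close>, where \<open>f\<close> is \<open>\<tau>\<close>, gives the corner of \<open>B\<close> from \<open>J' T'\<close> to \<open>J T\<close>.\<close>

lemma adj_f_T:
  assumes y: "y \<in> J' ` T'"
  shows "adj_op T T' f (J' y) = J (proj (J ` T) (B y))"
proof (rule adj_op_eqI[OF X.csubspace_T])
  show "J (proj (J ` T) (B y)) \<in> T" using X.proj_J_T_in[of "B y"] by (simp add: X.in_J_image)
  show "J' y \<in> T'" using y by (simp add: Y.in_J_image)
  fix t assume t: "t \<in> T"
  then have t0: "J t \<in> J ` X.T0" using X.T_subset_T0 by blast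
  have y0: "y \<in> J' ` Y.T0" using y Y.T_subset_T0 by blast
  have "cinner (B y) (J t) = cinner y (J' (f t))"
    using cinner_adj_op[OF Y.csubspace_J_T0 Y.closed_J_T0 _ t0 y0, of B] homeo_B adj_B[OF t0]
    by (simp add: homeo_op_def)
  then have "cinner (J t) (B y) = cinner (f t) (J' y)"
    by (metis cinner_commute Y.cinner_J_left)
  moreover have "cinner (J t) (B y) = cinner t (J (proj (J ` T) (B y)))"
    using t cinner_proj[OF X.csubspace_J_T X.closed_J_T, of "J t" "B y"] by (simp add: X.cinner_J_left)
  ultimately show "cinner (f t) (J' y) = cinner t (J (proj (J ` T) (B y)))" by simp
qed

text \<open>For \<open>y \<in> J' N'\<close> the point \<open>f (B y)\<close> lies in \<open>y + T0'\<close>, hence in \<open>T'\<^sup>+\<close> and with the \<open>\<Gamma>0'\<close>-value of \<open>y\<close>.  So \<open>B y\<close> is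
the element of \<open>J N\<close> with that value.\<close>

lemma B_J_N:
  assumes y: "y \<in> J' ` Y.N"
  shows "B y \<in> J ` X.N" "\<Gamma>0 (B y) = \<Gamma>0' y" "B y = J (inv_into X.N w0 (J' y))"
proof -
  have y0: "y \<in> J' ` Y.T0" using y Y.N_subset_T0 by blast
  have c: "f (B y) - y \<in> Y.T0" using f_B[OF y0] .
  have mem: "y \<in> Y.Tadj" "f (B y) - y \<in> Y.Tadj" using y Y.J_N_subset c Y.T0_subset by auto
  then have "y + (f (B y) - y) \<in> Y.Tadj" by (intro complex_vector.subspace_add[OF Y.csubspace_Tadj])
  then have Bt: "B y \<in> X.Tadj" by (simp add: f_Tadj_iff)
  then show BN: "B y \<in> J ` X.N" using X.Tadj_Int_J_T0[OF B_in] by blast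
  have "\<Gamma>0' (y + (f (B y) - y)) = \<Gamma>0' y"
    using mem Y.\<Gamma>0_T0[OF c] by (subst Y.\<Gamma>_add) auto
  then show \<Gamma>: "\<Gamma>0 (B y) = \<Gamma>0' y" using \<Gamma>_f(1)[OF Bt] by simp
  show "B y = J (inv_into X.N w0 (J' y))"
    using inv_into_w0[of "J' y"] y X.G0inv_\<Gamma>0[OF BN] \<Gamma> by (simp add: Y.in_J_image)
qed

lemma matrix_B:
  "has_matrix (graph_on (J' ` Y.T0) B) [J' ` T', J' ` Y.N] [J ` T, J ` X.N]
      [[\<lambda>x. J (adj_op T T' f (J' x)), \<lambda>_. 0],
       [\<lambda>x. proj (J ` X.N) (B x), \<lambda>x. J (inv_into X.N w0 (J' x))]]"
  unfolding has_matrix_graph_iff[OF Y.J_T0_iff]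
proof (intro conjI ballI)
  have eq: "J (adj_op T T' f (J' y)) = proj (J ` T) (B y)" if "y \<in> J' ` T'" for y
    by (simp add: adj_f_T[OF that])
  have "clinear_on (J' ` T') (\<lambda>x. proj (J ` T) (B x))"
    by (rule clinear_on_compose[OF clinear_B UNIV_I X.clinear_proj_J_T])
  then show "lin_op (J' ` T') (J ` T) (\<lambda>x. J (adj_op T T' f (J' x)))"
    using eq clinear_on_cong[OF eq Y.csubspace_J_T] X.proj_J_T_in by (intro lin_opI) simp_all
  show "lin_op (J' ` Y.N) (J ` T) (\<lambda>_. 0)" by (intro lin_op_zero X.csubspace_J_T)
  show "lin_op (J' ` T') (J ` X.N) (\<lambda>x. proj (J ` X.N) (B x))"
    by (intro lin_opI X.proj_J_N_in clinear_on_compose[OF clinear_B UNIV_I X.clinear_proj_J_N])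
  show "lin_op (J' ` Y.N) (J ` X.N) (\<lambda>x. J (inv_into X.N w0 (J' x)))"
    using clinear_on_cong[OF B_J_N(3)[symmetric] Y.csubspace_J_N] B_J_N(1,3) clinear_B by (intro lin_opI) simp_all
  fix s u assume "s \<in> J' ` T'" "u \<in> J' ` Y.N"
  then show "B (s + u) = J (adj_op T T' f (J' s)) + 0 + (proj (J ` X.N) (B s) + J (inv_into X.N w0 (J' u)))"
    using X.proj_J_T0_split[OF B_in[of s]] B_J_N(3)[of u] clinear_on_add[OF clinear_B[of UNIV] UNIV_I UNIV_I, of s u]
    by (simp add: eq)
qed

text \<open>The \<open>\<Gamma>1'\<close>-value of \<open>f (B y)\<close> is \<open>\<beta> (\<Gamma>0' y)\<close>, of which \<open>y\<close> contributes \<open>\<beta>' (\<Gamma>0' y)\<close>.\<close>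

lemma E_J_N:
  assumes y: "y \<in> J' ` Y.N"
  shows "E y = proj (J' ` T') (E y) + E0 y"
proof -
  have y0: "y \<in> J' ` Y.T0" using y Y.N_subset_T0 by blast
  define c where "c = f (B y) - y"
  have c: "c \<in> Y.T0" using f_B[OF y0] by (simp add: c_def)
  obtain t n where tn: "t \<in> T'" "n \<in> Y.N" "c = t + n" using c by (rule Y.decompose_T0)
  note [simp] = subsetD[OF Y.T_subset tn(1)] subsetD[OF Y.N_subset tn(2)] subsetD[OF Y.J_N_subset y] subsetD[OF Y.T0_subset c]
  have "B y \<in> X.Tadj" using B_J_N(1)[OF y] X.J_N_subset by blast
  then have "\<Gamma>1' (y + c) = X.\<beta> (\<Gamma>0' y)"
    using \<Gamma>_f(2) X.\<Gamma>1_J_N[OF B_J_N(1)[OF y]] B_J_N(2)[OF y] by (simp add: c_def)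
  moreover have "\<Gamma>1' (y + c) = \<Gamma>1' y + \<Gamma>1' c" by (simp add: Y.\<Gamma>_add)
  moreover have "\<Gamma>1' c = \<Gamma>1' n" using tn(1) by (simp add: tn(3) Y.\<Gamma>_add)
  ultimately have "\<Gamma>1' n = X.\<beta> (\<Gamma>0' y) - Y.\<beta> (\<Gamma>0' y)"
    using Y.\<Gamma>1_J_N[OF y] by (simp add: eq_diff_eq add.commute)
  then have E0: "E0 y = (- \<i>) *\<^sub>C J' n"
    using Y.G1inv_\<Gamma>1[OF tn(2)] by (simp add: E0_def)
  have E: "E y = (- \<i>) *\<^sub>C J' t + (- \<i>) *\<^sub>C J' n"
    unfolding E_def by (simp only: tn(3) Y.J_add scaleC_add_right flip: c_def)
  have "proj (J' ` T') (E y) = (- \<i>) *\<^sub>C J' t"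
    unfolding E using tn
    by (intro Y.proj_J_T_eq complex_vector.subspace_scale Y.csubspace_J_T Y.csubspace_J_N) auto
  then show ?thesis using E E0 by simp
qed

definition \<Theta> :: "'b \<Rightarrow> 'b" where "\<Theta> y = proj (J' ` T') (E y)"

lemma J_T_subset: "J' ` T' \<subseteq> J' ` Y.T0" "J' ` Y.N \<subseteq> J' ` Y.T0"
  using Y.T_subset_T0 Y.N_subset_T0 by auto

lemma selfadjoint_\<Theta>: "bounded_selfadjoint (J' ` T') \<Theta>"
  unfolding bounded_selfadjoint_iff[OF Y.csubspace_J_T] bounded_op_def
proof (intro conjI ballI)
  show "lin_op (J' ` T') (J' ` T') \<Theta>"
    unfolding \<Theta>_def[abs_def] by (intro lin_opI Y.proj_J_T_in clinear_on_compose[OF clinear_E UNIV_I Y.clinear_proj_J_T])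
  obtain L where L: "\<And>y. y \<in> J' ` Y.T0 \<Longrightarrow> norm (E y) \<le> L * norm y"
    using selfadjoint_E unfolding bounded_selfadjoint_def bounded_op_def by blast
  have "norm (\<Theta> y) \<le> L * norm y" if "y \<in> J' ` T'" for y
    using L[of y] that J_T_subset norm_proj_le[OF Y.csubspace_J_T Y.closed_J_T, of "E y"] unfolding \<Theta>_def by fastforce
  then show "\<exists>K. \<forall>x\<in>J' ` T'. norm (\<Theta> x) \<le> K * norm x" by blast
  fix x y assume "x \<in> J' ` T'" "y \<in> J' ` T'"
  then show "cinner (\<Theta> x) y = cinner x (\<Theta> y)"
    using cinner_proj[OF Y.csubspace_J_T Y.closed_J_T, of x "E y"] cinner_proj_left[OF Y.csubspace_J_T Y.closed_J_T, of y "E x"]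
      E_symmetric[of x y] J_T_subset unfolding \<Theta>_def by (simp add: subsetD)
qed

lemma matrix_E:
  "has_matrix (graph_on (J' ` Y.T0) E) [J' ` T', J' ` Y.N] [J' ` T', J' ` Y.N]
     [[\<Theta>, \<lambda>y. proj (J' ` T') (E y)], [\<lambda>y. proj (J' ` Y.N) (E y), E0]]"
  unfolding has_matrix_graph_iff[OF Y.J_T0_iff]
proof (intro conjI ballI)
  fix s u assume su: "s \<in> J' ` T'" "u \<in> J' ` Y.N"
  then have "E s \<in> J' ` Y.T0" using E_in J_T_subset by blast
  have "E (s + u) = E s + E u" by (rule clinear_on_add[OF clinear_E[of UNIV] UNIV_I UNIV_I])
  also have "\<dots> = (\<Theta> s + proj (J' ` Y.N) (E s)) + (proj (J' ` T') (E u) + E0 u)"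
    unfolding \<Theta>_def
    by (rule arg_cong2[OF Y.proj_J_T0_split[OF \<open>E s \<in> _\<close>] E_J_N[OF su(2)]])
  finally show "E (s + u) = \<Theta> s + proj (J' ` T') (E u) + (proj (J' ` Y.N) (E s) + E0 u)"
    by (simp add: add_ac)
qed (unfold \<Theta>_def[abs_def], (intro lin_opI clinear_on_compose[OF clinear_E UNIV_I Y.clinear_proj_J_T]
    clinear_on_compose[OF clinear_E UNIV_I Y.clinear_proj_J_N] clinear_E0 E0_in Y.proj_J_T_in Y.proj_J_N_in)+)

lemma matrix_V: "unitary_matrix (graph_on UNIV f) B E"
  unfolding unitary_matrix_def has_matrix_graph_iff[OF X.UNIV_iff]
proof (intro conjI ballI)
  have CE: "\<i> *\<^sub>C J' (E (A x)) = f x - A x" if "x \<in> J ` X.T0" for x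
    by (simp add: E_def B_A[OF that] Y.J_scale Y.J_minus scaleC_scaleC scaleC_one)
  have Ta: "J' (adj_op (J' ` Y.T0) (J ` X.T0) B (J a)) = f a" if "a \<in> X.T0" for a
    using that by (simp add: adj_B)
  show "lin_op (J ` X.T0) (J' ` Y.T0) (inv_into (J' ` Y.T0) B)"
    using clinear_on_cong[OF inv_B X.csubspace_J_T0] clinear_A A_in inv_B by (intro lin_opI) simp_all
  show "lin_op X.T0 (J' ` Y.T0) (\<lambda>_. 0)" by (intro lin_op_zero Y.csubspace_J_T0)
  have lin: "clinear_on (J ` X.T0) (\<lambda>x. f x - A x)" 
    by (intro clinear_on_sub clinear_A clinear_on_subset[OF f_linear subset_UNIV])
  have mem: "f x - A x \<in> Y.T0" for x
    using Y.proj_J_T0_T0[of "f x"] Y.proj_T0_in[of "f x"] unfolding A_def by (metis add_diff_cancel_left')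
  have eq: "\<i> *\<^sub>C J' (E (inv_into (J' ` Y.T0) B x)) = f x - A x" if "x \<in> J ` X.T0" for x
    by (simp only: inv_B[OF that] CE[OF that])
  show "lin_op (J ` X.T0) Y.T0 (\<lambda>x. \<i> *\<^sub>C J' (E (inv_into (J' ` Y.T0) B x)))"
    using clinear_on_cong[OF eq X.csubspace_J_T0] lin mem eq by (intro lin_opI) simp_all
  show "lin_op X.T0 Y.T0 (\<lambda>a. J' (adj_op (J' ` Y.T0) (J ` X.T0) B (J a)))"
    using clinear_on_cong[OF Ta X.csubspace_T0] clinear_on_subset[OF f_linear subset_UNIV] f_T0 Ta
    by (intro lin_opI) simp_all
  fix x a assume "x \<in> J ` X.T0" "a \<in> X.T0"
  then show "f (x + a) = inv_into (J' ` Y.T0) B x + 0 + (\<i> *\<^sub>C J' (E (inv_into (J' ` Y.T0) B x)) +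
     J' (adj_op (J' ` Y.T0) (J ` X.T0) B (J a)))"
    by (simp only: CE Ta inv_B f_add) simp
qed

lemma parameters: "unitary_parameters B \<Theta> f (\<lambda>x. proj (J ` X.N) (B x))"
  by (simp add: unitary_parameters_def homeo_B selfadjoint_\<Theta> homeo_T matrix_B)

text \<open>The condition says that \<open>f (B y) - y\<close> has no \<open>T'\<close>-component for \<open>y \<in> J' N'\<close>, so \<open>E = E0\<close> there; by symmetry of \<open>E\<close> the
opposite corner vanishes as well.\<close>

lemma E_orthogonal_sum:
  assumes orth: "f ` J ` X.N \<subseteq> orth T'"
  shows "graph_on (J' ` Y.T0) E = graph_sum (graph_on (J' ` Y.N) E0) (graph_on (J' ` T') \<Theta>)"
proof -
  have EN: "E y = E0 y" if y: "y \<in> J' ` Y.N" for y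
  proof -
    have "f (B y) \<in> orth T'" using orth B_J_N(1)[OF y] by blast
    moreover have "y \<in> orth T'" using y Y.components_orthogonal(2)[OF _ complex_vector.subspace_0[OF Y.csubspace_N] y complex_vector.subspace_0[OF Y.csubspace_J_T]]
      by (simp add: orth_def)
    ultimately have "f (B y) - y \<in> orth T'" by (intro complex_vector.subspace_diff csubspace_orth)
    moreover have "f (B y) - y \<in> Y.T0" using f_B y J_T_subset by blast
    ultimately have "f (B y) - y \<in> Y.N" by (simp add: Y.N_def)
    then have "E y \<in> J' ` Y.N" 
      unfolding E_def by (intro complex_vector.subspace_scale[OF Y.csubspace_J_N] imageI)
    then have "proj (J' ` T') (0 + E y) = 0"
      by (intro Y.proj_J_T_eq complex_vector.subspace_0 Y.csubspace_J_T)
    then show ?thesis using E_J_N[OF y] by simp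
  qed
  have ET: "E y = \<Theta> y" if y: "y \<in> J' ` T'" for y
  proof -
    have y0: "y \<in> J' ` Y.T0" "E y \<in> J' ` Y.T0" using y J_T_subset E_in by blast+
    have "cinner u (proj (J' ` Y.N) (E y)) = 0" if u: "u \<in> J' ` Y.N" for u
    proof -
      have "cinner u (proj (J' ` Y.N) (E y)) = cinner u (E y)"
        by (rule cinner_proj[OF Y.csubspace_J_N Y.closed_J_N u])
      also have "\<dots> = cinner (E0 u) y" using E_symmetric[of u y] y0 u J_T_subset EN[OF u] by auto
      also have "\<dots> = 0"
        by (rule Y.components_orthogonal(9)[OF complex_vector.subspace_0[OF Y.csubspace_T] complex_vector.subspace_0[OF Y.csubspace_N] E0_in y])
      finally show ?thesis .
    qed
    from this[OF Y.proj_J_N_in[of "E y"]] have "proj (J' ` Y.N) (E y) = 0" by simp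
    then show ?thesis using Y.proj_J_T0_split[OF y0(2)] by (simp add: \<Theta>_def)
  qed
  have sum: "E (u + s) = E0 u + \<Theta> s" if "u \<in> J' ` Y.N" "s \<in> J' ` T'" for u s
    using clinear_on_add[OF clinear_E[of UNIV] UNIV_I UNIV_I, of u s] EN[OF that(1)] ET[OF that(2)] by simp
  show ?thesis
    unfolding graph_sum_iff by (intro ballI) (subst add.commute, rule sum)
qed

end

section \<open>Unitary operators from parameters\<close>

context two_boundary_triples
begin

lemma orthogonal_sum_on_parts:
  assumes \<Theta>: "bounded_selfadjoint (J' ` T') \<Theta>"
    and E: "graph_on (J' ` Y.T0) E = graph_sum (graph_on (J' ` Y.N) E0) (graph_on (J' ` T') \<Theta>)"
  shows "\<And>u s. u \<in> J' ` Y.N \<Longrightarrow> s \<in> J' ` T' \<Longrightarrow> E (s + u) = E0 u + \<Theta> s"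
    and "\<And>u. u \<in> J' ` Y.N \<Longrightarrow> E u = E0 u"
proof -
  show *: "E (s + u) = E0 u + \<Theta> s" if "u \<in> J' ` Y.N" "s \<in> J' ` T'" for u s
    using E that unfolding graph_sum_iff by blast
  have "clinear_on (J' ` T') \<Theta>"
    using \<Theta> unfolding bounded_selfadjoint_def bounded_op_def lin_op_def by blast
  then have "\<Theta> 0 = 0" by (rule clinear_on_zero[OF _ Y.csubspace_J_T])
  then show "E u = E0 u" if "u \<in> J' ` Y.N" for u
    using *[OF that complex_vector.subspace_0[OF Y.csubspace_J_T]] by simp
qed

text \<open>The summands act in orthogonal subspaces, and \<open>E0\<close> is bounded because it is symmetric and everywhere defined on
\<open>J' N'\<close>.\<close>

lemma orthogonal_sum_selfadjoint:
  assumes \<Theta>: "bounded_selfadjoint (J' ` T') \<Theta>"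
    and E: "graph_on (J' ` Y.T0) E = graph_sum (graph_on (J' ` Y.N) E0) (graph_on (J' ` T') \<Theta>)"
  shows "bounded_selfadjoint (J' ` Y.T0) E"
proof -
  note sum = orthogonal_sum_on_parts(1)[OF \<Theta> E]
  have \<Theta>lin: "clinear_on (J' ` T') \<Theta>" and \<Theta>in: "\<And>s. s \<in> J' ` T' \<Longrightarrow> \<Theta> s \<in> J' ` T'"
    and \<Theta>b: "\<exists>L. \<forall>s\<in>J' ` T'. norm (\<Theta> s) \<le> L * norm s"
    and \<Theta>sym: "\<And>s t. s \<in> J' ` T' \<Longrightarrow> t \<in> J' ` T' \<Longrightarrow> cinner (\<Theta> s) t = cinner s (\<Theta> t)"
    using \<Theta> unfolding bounded_selfadjoint_iff[OF Y.csubspace_J_T] bounded_op_def lin_op_def by blast+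
  have Eproj: "E y = E0 (proj (J' ` Y.N) y) + \<Theta> (proj (J' ` T') y)" if "y \<in> J' ` Y.T0" for y
    using sum[OF Y.proj_J_N_in Y.proj_J_T_in, of y y] Y.proj_J_T0_split[OF that] by simp
  have "clinear_on (J' ` Y.T0) (\<lambda>y. E0 (proj (J' ` Y.N) y) + \<Theta> (proj (J' ` T') y))"
    by (intro clinear_on_plus clinear_on_compose[OF Y.clinear_proj_J_N Y.proj_J_N_in clinear_E0]
      clinear_on_compose[OF Y.clinear_proj_J_T Y.proj_J_T_in \<Theta>lin])
  then have lin: "clinear_on (J' ` Y.T0) E" using clinear_on_cong[where f=E, OF Eproj Y.csubspace_J_T0] by blast
  have inn: "E y \<in> J' ` Y.T0" if "y \<in> J' ` Y.T0" for y
    using Y.J_T0_sum[OF \<Theta>in[OF Y.proj_J_T_in] E0_in] Eproj[OF that] by (simp add: add.commute)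
  obtain K where K: "\<And>y. y \<in> J' ` Y.N \<Longrightarrow> norm (E0 y) \<le> K * norm y" using E0_bounded by blast
  obtain L where L: "\<And>y. y \<in> J' ` T' \<Longrightarrow> norm (\<Theta> y) \<le> L * norm y" using \<Theta>b by blast
  have bound: "norm (E y) \<le> (\<bar>K\<bar> + \<bar>L\<bar>) * norm y" if y: "y \<in> J' ` Y.T0" for y
  proof -
    have "norm (E0 (proj (J' ` Y.N) y)) \<le> \<bar>K\<bar> * norm y"
      by (rule order_trans[OF K[OF Y.proj_J_N_in]])
         (rule mult_mono[OF abs_ge_self norm_proj_le[OF Y.csubspace_J_N Y.closed_J_N]], auto)
    moreover have "norm (\<Theta> (proj (J' ` T') y)) \<le> \<bar>L\<bar> * norm y"
      by (rule order_trans[OF L[OF Y.proj_J_T_in]])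
         (rule mult_mono[OF abs_ge_self norm_proj_le[OF Y.csubspace_J_T Y.closed_J_T]], auto)
    ultimately show ?thesis
      unfolding Eproj[OF y] by (simp add: distrib_right norm_triangle_mono)
  qed
  have sym: "cinner (E x) y = cinner x (E y)" if xy: "x \<in> J' ` Y.T0" "y \<in> J' ` Y.T0" for x y
  proof -
    obtain s u where su: "s \<in> J' ` T'" "u \<in> J' ` Y.N" "x = s + u" using xy(1) Y.J_T0_iff by blast
    obtain t v where tv: "t \<in> J' ` T'" "v \<in> J' ` Y.N" "y = t + v" using xy(2) Y.J_T0_iff by blast
    note o = Y.components_orthogonal(9,12)[OF complex_vector.subspace_0[OF Y.csubspace_T] complex_vector.subspace_0[OF Y.csubspace_N]]
    have "cinner (E x) y = cinner (E0 u) v + cinner (\<Theta> s) t"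
      using sum[OF su(2,1)] su tv o[OF E0_in tv(1)] o[OF tv(2) \<Theta>in[OF su(1)]]
      by (simp add: cinner_add_left cinner_add_right)
    moreover have "cinner x (E y) = cinner u (E0 v) + cinner s (\<Theta> t)"
      using sum[OF tv(2,1)] su tv o[OF E0_in su(1)] o[OF su(2) \<Theta>in[OF tv(1)]]
      by (simp add: cinner_add_left cinner_add_right)
    ultimately show ?thesis using E0_symmetric[OF su(2) tv(2)] \<Theta>sym[OF su(1) tv(1)] by simp
  qed
  show ?thesis
    unfolding bounded_selfadjoint_iff[OF Y.csubspace_J_T0] bounded_op_def
    by (intro conjI ballI sym lin_opI lin inn exI[of _ "\<bar>K\<bar> + \<bar>L\<bar>"] bound)
qed

lemma orthogonal_sum_canonical:
  assumes \<Theta>: "bounded_selfadjoint (J' ` T') \<Theta>"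
    and E: "graph_on (J' ` Y.T0) E = graph_sum (graph_on (J' ` Y.N) E0) (graph_on (J' ` T') \<Theta>)"
  shows "graph_on (J' ` Y.N) E0 \<subseteq> graph_on (J' ` Y.T0) E"
    and "graph_on (J' ` Y.T0) E \<subseteq> adj_rel (J' ` Y.T0) (J' ` Y.T0) (graph_on (J' ` Y.N) E0)"
proof -
  have sub: "J' ` Y.N \<subseteq> J' ` Y.T0" using Y.N_subset_T0 by blast
  note ext = orthogonal_sum_on_parts(2)[OF \<Theta> E]
  show "graph_on (J' ` Y.N) E0 \<subseteq> graph_on (J' ` Y.T0) E"
    using sub ext by (force simp: graph_on_def)
  then have "adj_rel (J' ` Y.T0) (J' ` Y.T0) (graph_on (J' ` Y.T0) E)
      \<subseteq> adj_rel (J' ` Y.T0) (J' ` Y.T0) (graph_on (J' ` Y.N) E0)"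
    unfolding adj_rel_def by blast
  then show "graph_on (J' ` Y.T0) E \<subseteq> adj_rel (J' ` Y.T0) (J' ` Y.T0) (graph_on (J' ` Y.N) E0)"
    using orthogonal_sum_selfadjoint[OF \<Theta> E] unfolding bounded_selfadjoint_def by simp
qed

text \<open>The given matrix defines a function \<open>f\<close> with diagonal entries \<open>Bi\<close>, \<open>D\<close> and lower left entry \<open>g\<close>.  Self-adjointness of \<open>E\<close> and
the definition of \<open>D\<close> through the adjoint of \<open>B\<close> make \<open>f\<close> preserve the indefinite product, which also gives injectivity.
The first row of \<open>B\<close> yields \<open>f = \<tau>\<close> on \<open>T\<close>; therefore \<open>f\<close> maps \<open>T\<^sup>+\<close> onto \<open>T'\<^sup>+\<close>.
The corner on \<open>J' N'\<close> gives the correct boundary values on \<open>N\<close> and, together with \<open>E0\<close>, on \<open>J N\<close>.\<close>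

lemma unitary_of_parameters:
  assumes par: "unitary_parameters B \<Theta> \<tau> b"
    and E: "graph_on (J' ` Y.T0) E = graph_sum (graph_on (J' ` Y.N) E0) (graph_on (J' ` T') \<Theta>)"
    and mat: "unitary_matrix V B E"
  shows "V \<in> \<V>" and "standard_unitary ip ip' V" and "V `` (J ` X.N) \<subseteq> orth T'"
proof -
  have hB: "homeo_op (J' ` Y.T0) (J ` X.T0) B" and h\<tau>: "homeo_op T T' \<tau>"
    and \<Theta>: "bounded_selfadjoint (J' ` T') \<Theta>"
    and mB: "has_matrix (graph_on (J' ` Y.T0) B) [J' ` T', J' ` Y.N] [J ` T, J ` X.N]
      [[\<lambda>x. J (adj_op T T' \<tau> (J' x)), \<lambda>_. 0], [b, \<lambda>x. J (inv_into X.N w0 (J' x))]]"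
    using par by (simp_all add: unitary_parameters_def)
  note mB' = mB[unfolded has_matrix_graph_iff[OF Y.J_T0_iff]]
  define Bi where "Bi = inv_into (J' ` Y.T0) B"
  define Bs where "Bs = adj_op (J' ` Y.T0) (J ` X.T0) B"
  have bB: "bounded_op (J' ` Y.T0) (J ` X.T0) B" and bBi: "bounded_op (J ` X.T0) (J' ` Y.T0) Bi"
    using hB by (simp_all add: homeo_op_def Bi_def)
  have bBs: "bounded_op (J ` X.T0) (J' ` Y.T0) Bs"
    unfolding Bs_def by (rule bounded_op_adj_op[OF Y.csubspace_J_T0 Y.closed_J_T0 X.csubspace_J_T0 bB])
  have bijBs: "bij_betw Bs (J ` X.T0) (J' ` Y.T0)"
    unfolding Bs_def by (rule bij_betw_adj_op[OF Y.csubspace_J_T0 Y.closed_J_T0 X.csubspace_J_T0 X.closed_J_T0 hB])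
  have Bs: "cinner (B y) x = cinner y (Bs x)" if "y \<in> J' ` Y.T0" "x \<in> J ` X.T0" for x y
    unfolding Bs_def by (rule cinner_adj_op[OF Y.csubspace_J_T0 Y.closed_J_T0 bB that(2,1)])
  note Binv = homeo_op_inv[OF hB, folded Bi_def]
  have selfE: "bounded_selfadjoint (J' ` Y.T0) E" by (rule orthogonal_sum_selfadjoint[OF \<Theta> E])
  have bE: "bounded_op (J' ` Y.T0) (J' ` Y.T0) E"
    and symE: "\<And>x y. x \<in> J' ` Y.T0 \<Longrightarrow> y \<in> J' ` Y.T0 \<Longrightarrow> cinner (E x) y = cinner x (E y)"
    using selfE unfolding bounded_selfadjoint_iff[OF Y.csubspace_J_T0] by blast+
  note linEs = lin_opD[OF bounded_opD[OF bE]] lin_opD[OF bounded_opD[OF bBi]] lin_opD[OF bounded_opD[OF bBs]]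
  have Jin: "J x \<in> J ` X.T0" if "x \<in> X.T0" for x using that by blast
  define g where "g x = \<i> *\<^sub>C J' (E (Bi x))" for x
  define D where "D a = J' (Bs (J a))" for a
  have g_in: "g x \<in> Y.T0" if "x \<in> J ` X.T0" for x
    unfolding g_def using linEs(2)[OF linEs(4)[OF that]] 
    by (intro complex_vector.subspace_scale[OF Y.csubspace_T0]) (simp add: Y.in_J_image)
  have D_in: "D a \<in> Y.T0" if "a \<in> X.T0" for a
    unfolding D_def using linEs(6)[OF Jin[OF that]] by (simp add: Y.in_J_image)
  define f where "f z = Bi (proj (J ` X.T0) z) + (g (proj (J ` X.T0) z) + D (proj X.T0 z))" for z
  have f_sum: "f (x + a) = Bi x + (g x + D a)" if "x \<in> J ` X.T0" "a \<in> X.T0" for x a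
    using that by (simp add: f_def X.proj_J_T0_eq X.proj_T0_eq)
  have lin_g: "clinear_on (J ` X.T0) g"
    unfolding g_def[abs_def]
    by (intro clinear_on_scaleC clinear_on_compose[OF _ UNIV_I Y.clinear_on_J]
        clinear_on_compose[OF linEs(3) linEs(4) linEs(1)])
  have lin_D: "clinear_on X.T0 D"
    unfolding D_def[abs_def]
    by (intro clinear_on_compose[OF _ UNIV_I Y.clinear_on_J] clinear_on_compose[OF X.clinear_on_J Jin linEs(5)])
  have lin: "clinear_on UNIV f"
    unfolding f_def[abs_def]
    by (intro clinear_on_plus clinear_on_compose[OF X.clinear_proj_J_T0 X.proj_J_T0_in linEs(3)]
       clinear_on_compose[OF X.clinear_proj_J_T0 X.proj_J_T0_in lin_g]
       clinear_on_compose[OF X.clinear_proj_T0 X.proj_T0_in lin_D])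
  have V: "V = graph_on UNIV f"
  proof -
    have "V = {(x1 + x2, (Bi x1 + 0) + (g x1 + D x2)) | x1 x2. x1 \<in> J ` X.T0 \<and> x2 \<in> X.T0}"
      using mat unfolding unitary_matrix_def has_matrix_2x2 g_def D_def Bi_def Bs_def by blast
    also have "\<dots> = {(x1 + x2, f (x1 + x2)) | x1 x2. x1 \<in> J ` X.T0 \<and> x2 \<in> X.T0}"
      by (rule Collect_cong) (metis f_sum add_0_right)
    also have "\<dots> = graph_on UNIV f"
    proof -
      have "(z, f z) \<in> {(x1 + x2, f (x1 + x2)) | x1 x2. x1 \<in> J ` X.T0 \<and> x2 \<in> X.T0}" for z
        using X.proj_J_T0_T0[of z] X.proj_J_T0_in[of z] X.proj_T0_in[of z] by force
      then show ?thesis unfolding graph_on_def by blast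
    qed
    finally show ?thesis .
  qed
  have Yz: "cinner x a = 0" "cinner a x = 0" if "x \<in> J' ` Y.T0" "a \<in> Y.T0" for x a
    using that orthD[of a "J' ` Y.T0" x] orth_sym[of x "J' ` Y.T0" a] by (simp_all add: Y.orth_J_T0)
  have Xz: "cinner x a = 0" "cinner a x = 0" if "x \<in> J ` X.T0" "a \<in> X.T0" for x a
    using that orthD[of a "J ` X.T0" x] orth_sym[of x "J ` X.T0" a] by (simp_all add: X.orth_J_T0)
  have f_ip: "ip' (f z) (f w) = ip z w" for z w
  proof -
    obtain x a where z: "x \<in> J ` X.T0" "a \<in> X.T0" "z = x + a" using X.UNIV_iff[of z] by blast
    obtain x' a' where w: "x' \<in> J ` X.T0" "a' \<in> X.T0" "w = x' + a'" using X.UNIV_iff[of w] by blast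
    note y = linEs(4)[OF z(1)] linEs(4)[OF w(1)]
    note Jy = Y.in_J_image[THEN iffD1, OF y(1)] Y.in_J_image[THEN iffD1, OF y(2)]
    have c: "J' (g x + D a) \<in> J' ` Y.T0" "J' (g x' + D a') \<in> J' ` Y.T0"
      using g_in D_in z w complex_vector.subspace_add[OF Y.csubspace_T0] by blast+
    have "ip' (f z) (f w) = cinner (Bi x) (J' (g x' + D a')) + cinner (g x + D a) (J' (Bi x'))"
      using Yz(1)[OF y(1) Jy(2)] Yz(2)[OF c(2) complex_vector.subspace_add[OF Y.csubspace_T0 g_in[OF z(1)] D_in[OF z(2)]]]
      by (simp only: z w f_sum Y.ip_eq Y.J_add cinner_add_left cinner_add_right) (simp add: add_ac)
    also have "\<dots> = (\<i> * cinner (Bi x) (E (Bi x')) + cinner (Bi x) (Bs (J a')))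
        + (- \<i> * cinner (E (Bi x)) (Bi x') + cinner (Bs (J a)) (Bi x'))"
      by (simp add: g_def D_def Y.J_add Y.J_scale cinner_add_left cinner_add_right cinner_scaleC_left
          cinner_scaleC_right Y.cinner_J_left)
    also have "\<dots> = cinner (Bi x) (Bs (J a')) + cinner (Bs (J a)) (Bi x')"
      using symE[OF y] by simp
    also have "cinner (Bi x) (Bs (J a')) = cinner x (J a')"
      using Bs[OF y(1) Jin[OF w(2)]] Binv(2)[OF z(1)] by simp
    also have "cinner (Bs (J a)) (Bi x') = cinner (J a) x'"
      using Bs[OF y(2) Jin[OF z(2)]] Binv(2)[OF w(1)] by (metis cinner_commute)
    also have "cinner x (J a') + cinner (J a) x' = ip z w"
      using Xz(1)[OF z(1), of "J x'"] Xz(2)[OF Jin[OF w(2)] z(2)] w(1)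
      by (simp add: z w X.ip_eq X.J_add cinner_add_left cinner_add_right X.cinner_J_left X.in_J_image)
    finally show ?thesis .
  qed
  have inj: "inj f"
  proof (rule injI)
    fix z w assume "f z = f w"
    then have "f (z - w) = 0" using clinear_on_diff[OF lin complex_vector.subspace_UNIV UNIV_I UNIV_I] by simp
    then have "cinner (z - w) (z - w) = 0"
      using f_ip[of "z - w" "J (z - w)"] by (simp add: X.ip_J Y.ip_eq)
    then show "z = w" by simp
  qed
  have surj: "\<exists>z. f z = v" for v
  proof -
    obtain y c where v: "y \<in> J' ` Y.T0" "c \<in> Y.T0" "v = y + c" using Y.UNIV_iff[of v] by blast
    have x: "B y \<in> J ` X.T0" "Bi (B y) = y" using Binv v(1) by auto
    have "J' (c - g (B y)) \<in> J' ` Y.T0"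
      using complex_vector.subspace_diff[OF Y.csubspace_T0 v(2) g_in[OF x(1)]] by blast
    then obtain a1 where a1: "a1 \<in> J ` X.T0" "Bs a1 = J' (c - g (B y))"
      using bijBs by (metis bij_betw_imp_surj_on imageE)
    then have "f (B y + J a1) = y + (g (B y) + (c - g (B y)))"
      using f_sum[OF x(1), of "J a1"] x(2) by (simp add: D_def X.in_J_image)
    then show ?thesis using v(3) by auto
  qed
  have bound: "\<exists>K. \<forall>z. norm (f z) \<le> K * norm z"
  proof -
    obtain K1 where K1: "K1 > 0" "\<And>x. x \<in> J ` X.T0 \<Longrightarrow> norm (Bi x) \<le> K1 * norm x" using bounded_op_bound_pos[OF bBi] by blast
    obtain K2 where K2: "K2 > 0" "\<And>x. x \<in> J' ` Y.T0 \<Longrightarrow> norm (E x) \<le> K2 * norm x" using bounded_op_bound_pos[OF bE] by blast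
    obtain K3 where K3: "K3 > 0" "\<And>x. x \<in> J ` X.T0 \<Longrightarrow> norm (Bs x) \<le> K3 * norm x" using bounded_op_bound_pos[OF bBs] by blast
    have "norm (f z) \<le> (K1 + (K2 * K1 + K3)) * norm z" for z
    proof -
      define x a where "x = proj (J ` X.T0) z" and "a = proj X.T0 z"
      have xa: "x \<in> J ` X.T0" "a \<in> X.T0" "norm x \<le> norm z" "norm a \<le> norm z"
        by (simp_all add: x_def a_def X.proj_J_T0_in X.proj_T0_in norm_proj_le X.csubspace_J_T0 X.closed_J_T0
           X.csubspace_T0 X.closed_T0)
      have b1: "norm (Bi x) \<le> K1 * norm z"
        using order_trans[OF K1(2)[OF xa(1)] mult_left_mono[OF xa(3)]] K1(1) by simp
      have "norm (g x) = norm (E (Bi x))" by (simp add: g_def norm_scaleC)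
      also have "\<dots> \<le> K2 * norm (Bi x)" by (rule K2(2)[OF linEs(4)[OF xa(1)]])
      also have "\<dots> \<le> K2 * (K1 * norm z)" using K2(1) b1 by (intro mult_left_mono) auto
      finally have b2: "norm (g x) \<le> K2 * K1 * norm z" by (simp add: mult.assoc)
      have "norm (D a) \<le> K3 * norm a" using K3(2)[OF Jin[OF xa(2)]] by (simp add: D_def)
      also have "\<dots> \<le> K3 * norm z" using K3(1) xa(4) by (intro mult_left_mono) auto
      finally have b3: "norm (D a) \<le> K3 * norm z" .
      have "norm (f z) \<le> norm (Bi x) + (norm (g x) + norm (D a))"
        unfolding f_def x_def[symmetric] a_def[symmetric]
        by (intro norm_triangle_mono norm_triangle_ineq order_refl)
      then show ?thesis using b1 b2 b3 by (simp add: algebra_simps)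
    qed
    then show ?thesis by blast
  qed
  show unitary: "standard_unitary ip ip' V"
    unfolding V standard_unitary_graph_iff[OF lin] using inj bound f_ip surj by (simp add: bij_def surj_def) metis
  have ortho: "cinner s u = 0" "cinner u s = 0" if "s \<in> J' ` T'" "u \<in> J' ` Y.N" for s u
    using Y.components_orthogonal(9,12)[OF complex_vector.subspace_0[OF Y.csubspace_T] complex_vector.subspace_0[OF Y.csubspace_N] that(2,1)] by auto
  have orthoX: "cinner s u = 0" "cinner u s = 0" if "s \<in> J ` T" "u \<in> J ` X.N" for s u
    using X.components_orthogonal(9,12)[OF complex_vector.subspace_0[OF X.csubspace_T] complex_vector.subspace_0[OF X.csubspace_N] that(2,1)] by auto
  have b\<tau>: "bounded_op T T' \<tau>" using h\<tau> by (simp add: homeo_op_def)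
  have Bsum: "B (s + u) = J (adj_op T T' \<tau> (J' s)) + (b s + J (inv_into X.N w0 (J' u)))"
    if "s \<in> J' ` T'" "u \<in> J' ` Y.N" for s u
  proof -
    have "B (s + u) = J (adj_op T T' \<tau> (J' s)) + 0 + (b s + J (inv_into X.N w0 (J' u)))"
      using mB' that by blast
    then show ?thesis by simp
  qed
  have bJN: "b s \<in> J ` X.N" if "s \<in> J' ` T'" for s using mB' that lin_opD(2) by blast
  have wJN: "J (inv_into X.N w0 (J' u)) \<in> J ` X.N" if "u \<in> J' ` Y.N" for u using mB' that lin_opD(2)[of "J' ` Y.N"] by blast
  \<comment> \<open>Only the first row of \<open>B\<close> matters here, since \<open>J t\<close> is orthogonal to \<open>J N\<close>.\<close>
  have f_T: "f t = \<tau> t" if t: "t \<in> T" for t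
  proof -
    have t0: "t \<in> X.T0" and Jt: "J t \<in> J ` T" using t X.T_subset_T0 by blast+
    have \<tau>t: "\<tau> t \<in> T'" using homeo_op_inv(4)[OF h\<tau> t] .
    have "Bs (J t) = J' (\<tau> t)"
      unfolding Bs_def
    proof (rule adj_op_eqI[OF Y.csubspace_J_T0 _ Jin[OF t0]])
      show "J' (\<tau> t) \<in> J' ` Y.T0" using \<tau>t Y.T_subset_T0 by blast
      fix y assume "y \<in> J' ` Y.T0"
      then obtain s u where su: "s \<in> J' ` T'" "u \<in> J' ` Y.N" "y = s + u" using Y.J_T0_iff by blast
      have s: "J' s \<in> T'" using su(1) by (simp add: Y.in_J_image)
      have "cinner (B y) (J t) = cinner (adj_op T T' \<tau> (J' s)) t"
        using orthoX(2)[OF Jt bJN[OF su(1)]] orthoX(2)[OF Jt wJN[OF su(2)]]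
        by (simp add: su(3) Bsum[OF su(1,2)] cinner_add_left)
      also have "\<dots> = cinner (J' s) (\<tau> t)"
        using cinner_adj_op[OF X.csubspace_T X.closed_T b\<tau> s t] by (metis cinner_commute)
      also have "\<dots> = cinner y (J' (\<tau> t))"
        using ortho(2)[OF imageI[OF \<tau>t] su(2)] by (simp add: su(3) cinner_add_left Y.cinner_J_left)
      finally show "cinner (B y) (J t) = cinner y (J' (\<tau> t))" .
    qed
    then show ?thesis
      using f_sum[OF complex_vector.subspace_0[OF X.csubspace_J_T0] t0]
        clinear_on_zero[OF lin_g X.csubspace_J_T0] clinear_on_zero[OF linEs(3) X.csubspace_J_T0]
      by (simp add: D_def)
  qed
  have f_Tadj: "f x \<in> Y.Tadj \<longleftrightarrow> x \<in> X.Tadj" for x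
  proof -
    have "T' = f ` T" using h\<tau> f_T by (metis bij_betw_imp_surj_on homeo_op_def image_cong)
    then show ?thesis by (simp add: ip_orth_def f_ip)
  qed
  have B_JN: "B u = J (inv_into X.N w0 (J' u))" if "u \<in> J' ` Y.N" for u
  proof -
    have z: "0 \<in> J' ` T'" by (rule complex_vector.subspace_0[OF Y.csubspace_J_T])
    have "clinear_on (J' ` T') b" "clinear_on (J' ` T') (\<lambda>x. J (adj_op T T' \<tau> (J' x)))"
      using mB' lin_opD(1) by blast+
    then have "b 0 = 0" "J (adj_op T T' \<tau> (J' 0)) = 0" using clinear_on_zero[OF _ Y.csubspace_J_T] by blast+
    then show ?thesis using Bsum[OF z that] by simp
  qed
  \<comment> \<open>Testing \<open>f n\<close> against \<open>k \<in> N'\<close> moves \<open>B\<close> to the other side, and \<open>cinner_w0_w1\<close> identifies the \<open>N'\<close>-component as \<open>w1 n\<close>.\<close>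
  have f_N: "\<Gamma>0' (f n) = \<Gamma>0 n" "\<Gamma>1' (f n) = \<Gamma>1 n" if n: "n \<in> X.N" for n
  proof -
    have n0: "n \<in> X.T0" using n X.N_subset_T0 by blast
    have fn: "f n = D n"
      using f_sum[OF complex_vector.subspace_0[OF X.csubspace_J_T0] n0]
        clinear_on_zero[OF lin_g X.csubspace_J_T0] clinear_on_zero[OF linEs(3) X.csubspace_J_T0] by simp
    obtain t m where tm: "t \<in> T'" "m \<in> Y.N" "D n = t + m" using D_in[OF n0] by (rule Y.decompose_T0)
    have "m = w1 n"
    proof (rule cinner_ext[of Y.N])
      show "m - w1 n \<in> Y.N" using tm(2) w1_in by (intro complex_vector.subspace_diff[OF Y.csubspace_N])
      fix k assume k: "k \<in> Y.N"
      have k0: "J' k \<in> J' ` Y.T0" and kN: "J' k \<in> J' ` Y.N" using k Y.N_subset_T0 by blast+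
      have iv: "inv_into X.N w0 k \<in> X.N" "w0 (inv_into X.N w0 k) = k"
        using bij_w0 k by (auto simp: bij_betw_def inv_into_into f_inv_into_f)
      have "cinner k m = cinner k (D n)"
        using Y.components_orthogonal(4)[OF tm(1) k complex_vector.subspace_0[OF Y.csubspace_J_N] complex_vector.subspace_0[OF Y.csubspace_J_T]]
        by (simp add: tm(3) cinner_add_right)
      also have "\<dots> = cinner (J' k) (Bs (J n))" by (simp add: D_def Y.cinner_J_left)
      also have "\<dots> = cinner (B (J' k)) (J n)" by (rule Bs[OF k0 Jin[OF n0], symmetric])
      also have "\<dots> = cinner (inv_into X.N w0 k) n" by (simp add: B_JN[OF kN])
      also have "\<dots> = cinner k (w1 n)" using cinner_w0_w1[OF iv(1) n] iv(2) by simp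
      finally show "cinner k m = cinner k (w1 n)" .
    qed
    then have "\<Gamma>1' (f n) = \<Gamma>1 n"
      using tm subsetD[OF Y.T_subset tm(1)] subsetD[OF Y.N_subset tm(2)] by (simp add: fn Y.\<Gamma>_add w1_def)
    then show "\<Gamma>0' (f n) = \<Gamma>0 n" "\<Gamma>1' (f n) = \<Gamma>1 n"
      using X.\<Gamma>0_T0[OF n0] Y.\<Gamma>0_T0[OF D_in[OF n0]] fn by simp_all
  qed
  \<comment> \<open>Here \<open>f u = y + n\<close> with \<open>y \<in> J' N'\<close> carrying the \<open>\<Gamma>0\<close>-value and \<open>n \<in> N'\<close>, produced by \<open>E0\<close>, correcting the \<open>\<Gamma>1\<close>-value.\<close>
  have f_JN: "\<Gamma>0' (f u) = \<Gamma>0 u" "\<Gamma>1' (f u) = \<Gamma>1 u" "f u \<in> orth T'" if u: "u \<in> J ` X.N" for u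
  proof -
    have u0: "u \<in> J ` X.T0" using u X.N_subset_T0 by blast
    have Ju: "J u \<in> X.N" using u by (simp add: X.in_J_image)
    define y where "y = J' (w0 (J u))"
    have y: "y \<in> J' ` Y.N" using w0_in by (simp add: y_def)
    have "inv_into X.N w0 (w0 (J u)) = J u" using bij_w0 Ju by (simp add: bij_betw_def)
    then have "B y = u" using B_JN[OF y] by (simp add: y_def)
    then have Biu: "Bi u = y" using Binv(1)[of y] y Y.N_subset_T0 by blast
    have \<Gamma>y: "\<Gamma>0' y = \<Gamma>0 u" by (simp add: y_def w0_def)
    define n where "n = Y.G1inv (X.\<beta> (\<Gamma>0 u) - Y.\<beta> (\<Gamma>0 u))"
    have n: "n \<in> Y.N" by (simp add: n_def Y.G1inv_in)
    have "g u = n"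
      using orthogonal_sum_on_parts(2)[OF \<Theta> E y] 
      by (simp add: g_def Biu E0_def \<Gamma>y Y.J_scale Y.J_minus scaleC_scaleC scaleC_one flip: n_def)
    moreover have "D 0 = 0" by (rule clinear_on_zero[OF lin_D X.csubspace_T0])
    ultimately have fu: "f u = y + n"
      using f_sum[OF u0 complex_vector.subspace_0[OF X.csubspace_T0]] Biu by simp
    have mem: "y \<in> Y.Tadj" "n \<in> Y.Tadj" using y n Y.J_N_subset Y.N_subset by auto
    show "\<Gamma>0' (f u) = \<Gamma>0 u"
      using mem \<Gamma>y Y.\<Gamma>0_T0[OF subsetD[OF Y.N_subset_T0 n]] by (simp add: fu Y.\<Gamma>_add)
    show "\<Gamma>1' (f u) = \<Gamma>1 u"
      using mem \<Gamma>y Y.\<Gamma>1_J_N[OF y] X.\<Gamma>1_J_N[OF u] by (simp add: fu Y.\<Gamma>_add n_def)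
    show "f u \<in> orth T'"
      unfolding orth_def
    proof (intro CollectI ballI)
      fix t assume t: "t \<in> T'"
      show "cinner t (f u) = 0"
        using Y.components_orthogonal(1,2)[OF t n y complex_vector.subspace_0[OF Y.csubspace_J_T]]
        by (simp add: fu cinner_add_right)
    qed
  qed
  show "V `` (J ` X.N) \<subseteq> orth T'"
    using f_JN(3) by (auto simp: V graph_on_def)
  have lin': "f (x + y) = f x + f y" for x y by (rule clinear_on_add[OF lin UNIV_I UNIV_I])
  show "V \<in> \<V>"
    unfolding V graph_in_\<V>_iff[OF lin complex_vector.subspace_UNIV]
  proof (intro conjI ballI)
    fix x assume x: "x \<in> UNIV \<inter> X.Tadj"
    then show fx: "f x \<in> Y.Tadj" by (simp add: f_Tadj)
    obtain a u where au: "a \<in> X.T0" "u \<in> J ` X.N" "x = a + u" using x X.decompose_Tadj[of x] by blast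
    obtain t n where tn: "t \<in> T" "n \<in> X.N" "a = t + n" using au(1) by (rule X.decompose_T0)
    have memX: "t \<in> X.Tadj" "n \<in> X.Tadj" "u \<in> X.Tadj" "a \<in> X.Tadj"
      using tn au X.T_subset X.N_subset X.J_N_subset X.T0_subset by auto
    have memY: "f t \<in> Y.Tadj" "f n \<in> Y.Tadj" "f u \<in> Y.Tadj" "f t + f n \<in> Y.Tadj"
      using memX f_Tadj complex_vector.subspace_add[OF Y.csubspace_Tadj] by auto
    have ft: "f t \<in> T'" using f_T[OF tn(1)] homeo_op_inv(4)[OF h\<tau> tn(1)] by simp
    have memX': "t + n \<in> X.Tadj" using memX tn(3) by simp
    show "\<Gamma>0' (f x) = \<Gamma>0 x"
      using memX memX' memY f_N(1)[OF tn(2)] f_JN(1)[OF au(2)] ft tn(1)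
      by (simp add: au(3) tn(3) lin' X.\<Gamma>_add Y.\<Gamma>_add)
    show "\<Gamma>1' (f x) = \<Gamma>1 x"
      using memX memX' memY f_N(2)[OF tn(2)] f_JN(2)[OF au(2)] ft tn(1)
      by (simp add: au(3) tn(3) lin' X.\<Gamma>_add Y.\<Gamma>_add)
  next
    fix y assume y: "y \<in> Y.Tadj"
    obtain x where "f x = y" using surj by blast
    then show "\<exists>x\<in>UNIV \<inter> X.Tadj. f x = y" using y f_Tadj by blast
  qed
qed

lemma homeo_w0: "homeo_op X.N Y.N w0"
proof -
  obtain K where "\<And>x. x \<in> X.N \<Longrightarrow> norm (w0 x) \<le> K * norm x" using w0_bounded by blast
  moreover obtain L where "\<And>x. x \<in> X.N \<Longrightarrow> norm x \<le> L * norm (w0 x)" using w0_bounded_below by blast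
  ultimately show ?thesis
    by (intro homeo_opI[OF X.csubspace_N lin_opI[OF clinear_w0 w0_in] bij_w0])
qed

lemma homeo_op_J_conjugate:
  assumes g: "homeo_op S' S g" and S': "csubspace S'"
  shows "homeo_op (J' ` S') (J ` S) (\<lambda>y. J (g (J' y)))"
proof -
  obtain K L where KL: "\<And>x. x \<in> S' \<Longrightarrow> norm (g x) \<le> K * norm x" "\<And>x. x \<in> S' \<Longrightarrow> norm x \<le> L * norm (g x)" "K > 0" "L > 0"
    using homeo_op_bounds[OF g] by blast
  show ?thesis
  proof (rule homeo_opI[where K=K and L=L])
    show "csubspace (J' ` S')" by (rule Y.csubspace_J_image[OF S'])
    show "lin_op (J' ` S') (J ` S) (\<lambda>y. J (g (J' y)))"
      by (intro lin_opI clinear_on_compose[OF _ UNIV_I X.clinear_on_J]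
            clinear_on_compose[OF Y.clinear_on_J _ lin_opD(1)[OF homeo_opD(1)[OF g]]])
         (simp_all add: Y.in_J_image X.in_J_image homeo_op_inv(4)[OF g])
    show "bij_betw (\<lambda>y. J (g (J' y))) (J' ` S') (J ` S)"
      by (rule bij_betw_byWitness[where f'="\<lambda>x. J' (inv_into S' g (J x))"])
         (auto simp: homeo_op_inv[OF g])
    fix y assume "y \<in> J' ` S'"
    then have "J' y \<in> S'" by (simp add: Y.in_J_image)
    from KL(1,2)[OF this] show "norm (J (g (J' y))) \<le> K * norm y" "norm y \<le> L * norm (J (g (J' y)))"
      by simp_all
  qed
qed

lemma homeo_op_sum:
  assumes p: "homeo_op (J' ` T') (J ` T) p" and q: "homeo_op (J' ` Y.N) (J ` X.N) q"
  shows "homeo_op (J' ` Y.T0) (J ` X.T0) (\<lambda>y. p (proj (J' ` T') y) + q (proj (J' ` Y.N) y))"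
    (is "homeo_op _ _ ?B")
proof -
  obtain K L where KL: "\<And>x. x \<in> J' ` T' \<Longrightarrow> norm (p x) \<le> K * norm x" "\<And>x. x \<in> J' ` T' \<Longrightarrow> norm x \<le> L * norm (p x)"
      "K > 0" "L > 0"
    using homeo_op_bounds[OF p] by blast
  obtain K' L' where KL': "\<And>x. x \<in> J' ` Y.N \<Longrightarrow> norm (q x) \<le> K' * norm x" "\<And>x. x \<in> J' ` Y.N \<Longrightarrow> norm x \<le> L' * norm (q x)"
      "K' > 0" "L' > 0"
    using homeo_op_bounds[OF q] by blast
  have pin: "p (proj (J' ` T') y) \<in> J ` T" and qin: "q (proj (J' ` Y.N) y) \<in> J ` X.N" for y
    using homeo_op_inv(4)[OF p Y.proj_J_T_in] homeo_op_inv(4)[OF q Y.proj_J_N_in] by auto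
  let ?C = "\<lambda>x. inv_into (J' ` T') p (proj (J ` T) x) + inv_into (J' ` Y.N) q (proj (J ` X.N) x)"
  have pin': "inv_into (J' ` T') p (proj (J ` T) x) \<in> J' ` T'" and qin': "inv_into (J' ` Y.N) q (proj (J ` X.N) x) \<in> J' ` Y.N" for x
    using homeo_op_inv(3)[OF p X.proj_J_T_in] homeo_op_inv(3)[OF q X.proj_J_N_in] by auto
  have B: "?B y \<in> J ` X.T0" for y by (rule X.J_T0_sum[OF pin qin])
  have C: "?C x \<in> J' ` Y.T0" for x by (rule Y.J_T0_sum[OF pin' qin'])
  have CB: "?C (?B y) = y" if "y \<in> J' ` Y.T0" for y
    using Y.proj_J_T0_split[OF that] X.proj_J_T_eq[OF pin qin] X.proj_J_N_eq[OF pin qin]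
      homeo_op_inv(1)[OF p Y.proj_J_T_in] homeo_op_inv(1)[OF q Y.proj_J_N_in] by simp
  have BC: "?B (?C x) = x" if "x \<in> J ` X.T0" for x
    using X.proj_J_T0_split[OF that] Y.proj_J_T_eq[OF pin' qin'] Y.proj_J_N_eq[OF pin' qin']
      homeo_op_inv(2)[OF p X.proj_J_T_in] homeo_op_inv(2)[OF q X.proj_J_N_in] by simp
  show ?thesis
  proof (rule homeo_opI[where K="K + K'" and L="L + L'"])
    show "csubspace (J' ` Y.T0)" by (rule Y.csubspace_J_T0)
    have "clinear_on (J' ` Y.T0) ?B"
      by (intro clinear_on_plus clinear_on_compose[OF Y.clinear_proj_J_T Y.proj_J_T_in lin_opD(1)[OF homeo_opD(1)[OF p]]]
         clinear_on_compose[OF Y.clinear_proj_J_N Y.proj_J_N_in lin_opD(1)[OF homeo_opD(1)[OF q]]])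
    then show "lin_op (J' ` Y.T0) (J ` X.T0) ?B" using B by (rule lin_opI)
    show "bij_betw ?B (J' ` Y.T0) (J ` X.T0)"
      by (rule bij_betw_byWitness[where f'="?C"]) (use B C CB BC in blast)+
    fix y assume y: "y \<in> J' ` Y.T0"
    have "norm (p (proj (J' ` T') y)) \<le> K * norm y"
      by (rule order_trans[OF KL(1)[OF Y.proj_J_T_in]
          mult_left_mono[OF norm_proj_le[OF Y.csubspace_J_T Y.closed_J_T] less_imp_le[OF KL(3)]]])
    moreover have "norm (q (proj (J' ` Y.N) y)) \<le> K' * norm y"
      by (rule order_trans[OF KL'(1)[OF Y.proj_J_N_in]
          mult_left_mono[OF norm_proj_le[OF Y.csubspace_J_N Y.closed_J_N] less_imp_le[OF KL'(3)]]])
    ultimately show "norm (?B y) \<le> (K + K') * norm y"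
      by (simp add: distrib_right norm_triangle_mono)
    have "norm (proj (J' ` T') y) \<le> L * norm (p (proj (J' ` T') y))" by (rule KL(2)[OF Y.proj_J_T_in])
    also have "p (proj (J' ` T') y) = proj (J ` T) (?B y)" by (rule X.proj_J_T_eq[OF pin qin, symmetric])
    also have "L * norm (proj (J ` T) (?B y)) \<le> L * norm (?B y)"
      using KL(4) by (intro mult_left_mono norm_proj_le[OF X.csubspace_J_T X.closed_J_T]) auto
    finally have 1: "norm (proj (J' ` T') y) \<le> L * norm (?B y)" .
    have "norm (proj (J' ` Y.N) y) \<le> L' * norm (q (proj (J' ` Y.N) y))" by (rule KL'(2)[OF Y.proj_J_N_in])
    also have "q (proj (J' ` Y.N) y) = proj (J ` X.N) (?B y)" by (rule X.proj_J_N_eq[OF pin qin, symmetric])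
    also have "L' * norm (proj (J ` X.N) (?B y)) \<le> L' * norm (?B y)"
      using KL'(4) by (intro mult_left_mono norm_proj_le[OF X.csubspace_J_N X.closed_J_N]) auto
    finally have 2: "norm (proj (J' ` Y.N) y) \<le> L' * norm (?B y)" .
    have "norm y = norm (proj (J' ` T') y + proj (J' ` Y.N) y)" using Y.proj_J_T0_split[OF y] by simp
    also have "\<dots> \<le> L * norm (?B y) + L' * norm (?B y)" by (rule norm_triangle_mono[OF 1 2])
    finally show "norm y \<le> (L + L') * norm (?B y)" by (simp add: distrib_right)
  qed
qed

text \<open>Take \<open>\<Theta> = 0\<close> and \<open>B\<close> diagonal.\<close>

lemma unitary_exists:
  assumes \<tau>: "homeo_op T T' \<tau>"
  shows "\<exists>V\<in>\<V>. standard_unitary ip ip' V"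
proof -
  define p where "p s = J (adj_op T T' \<tau> (J' s))" for s
  define q where "q u = J (inv_into X.N w0 (J' u))" for u
  define B where "B y = p (proj (J' ` T') y) + q (proj (J' ` Y.N) y)" for y
  define E where "E y = E0 (proj (J' ` Y.N) y)" for y
  let ?\<Theta> = "\<lambda>y::'b. 0 :: 'b"
  have p: "homeo_op (J' ` T') (J ` T) p"
    unfolding p_def[abs_def]
    by (intro homeo_op_J_conjugate homeo_op_adj_op X.csubspace_T X.closed_T Y.csubspace_T Y.closed_T \<tau>)
  have q: "homeo_op (J' ` Y.N) (J ` X.N) q"
    unfolding q_def[abs_def]
    by (intro homeo_op_J_conjugate homeo_op_inv_into homeo_w0 X.csubspace_N Y.csubspace_N)
  have B: "homeo_op (J' ` Y.T0) (J ` X.T0) B"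
    unfolding B_def[abs_def] by (rule homeo_op_sum[OF p q])
  have \<Theta>: "bounded_selfadjoint (J' ` T') ?\<Theta>"
    unfolding bounded_selfadjoint_iff[OF Y.csubspace_J_T] bounded_op_def
    by (auto intro!: lin_op_zero Y.csubspace_J_T exI[of _ 0])
  have Bsum: "B (s + u) = p s + q u" if "s \<in> J' ` T'" "u \<in> J' ` Y.N" for s u
    by (simp only: B_def Y.proj_J_T_eq[OF that] Y.proj_J_N_eq[OF that])
  have par: "unitary_parameters B ?\<Theta> \<tau> (\<lambda>_. 0)"
    unfolding unitary_parameters_def has_matrix_graph_iff[OF Y.J_T0_iff]
    using B \<Theta> \<tau> homeo_opD(1)[OF p] homeo_opD(1)[OF q] Bsum
    by (simp add: lin_op_zero X.csubspace_J_T X.csubspace_J_N p_def[abs_def] q_def[abs_def] del: ball_simps)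
  have E: "graph_on (J' ` Y.T0) E = graph_sum (graph_on (J' ` Y.N) E0) (graph_on (J' ` T') ?\<Theta>)"
    unfolding graph_sum_iff by (intro ballI) (simp only: E_def Y.proj_J_N_eq add_0_right)
  have selfE: "bounded_selfadjoint (J' ` Y.T0) E" by (rule orthogonal_sum_selfadjoint[OF \<Theta> E])
  then have linE: "lin_op (J' ` Y.T0) (J' ` Y.T0) E" by (simp add: bounded_selfadjoint_def bounded_op_def)
  define V where "V = {(x + a, (inv_into (J' ` Y.T0) B x + 0) + (\<i> *\<^sub>C J' (E (inv_into (J' ` Y.T0) B x)) +
      J' (adj_op (J' ` Y.T0) (J ` X.T0) B (J a)))) | x a. x \<in> J ` X.T0 \<and> a \<in> X.T0}"
  have linBi: "lin_op (J ` X.T0) (J' ` Y.T0) (inv_into (J' ` Y.T0) B)"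
    by (rule homeo_opD(1)[OF homeo_op_inv_into[OF Y.csubspace_J_T0 B X.csubspace_J_T0]])
  have linBs: "lin_op (J ` X.T0) (J' ` Y.T0) (adj_op (J' ` Y.T0) (J ` X.T0) B)"
    by (rule homeo_opD(1)[OF homeo_op_adj_op[OF Y.csubspace_J_T0 Y.closed_J_T0 X.csubspace_J_T0 X.closed_J_T0 B]])
  have "lin_op (J ` X.T0) Y.T0 (\<lambda>x. \<i> *\<^sub>C J' (E (inv_into (J' ` Y.T0) B x)))"
    by (intro lin_opI clinear_on_scaleC clinear_on_compose[OF _ UNIV_I Y.clinear_on_J]
        clinear_on_compose[OF lin_opD(1)[OF linBi] lin_opD(2)[OF linBi] lin_opD(1)[OF linE]]
        complex_vector.subspace_scale[OF Y.csubspace_T0] Y.in_J_image[THEN iffD1]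
        lin_opD(2)[OF linE] lin_opD(2)[OF linBi])
  moreover have "lin_op X.T0 Y.T0 (\<lambda>a. J' (adj_op (J' ` Y.T0) (J ` X.T0) B (J a)))"
    by (intro lin_opI clinear_on_compose[OF _ UNIV_I Y.clinear_on_J]
        clinear_on_compose[OF X.clinear_on_J imageI lin_opD(1)[OF linBs]]
        Y.in_J_image[THEN iffD1] lin_opD(2)[OF linBs] imageI)
  ultimately have "unitary_matrix V B E"
    unfolding unitary_matrix_def has_matrix_2x2 V_def
    using linBi lin_op_zero[OF Y.csubspace_J_T0] by blast
  then show ?thesis using unitary_of_parameters[OF par E] by blast
qed

lemma unitary_graph:
  assumes V: "V \<in> \<V>" "standard_unitary ip ip' V"
  obtains f K where "V = graph_on UNIV f" "unitary_of_triples ip J T \<Gamma>0 \<Gamma>1 ip' J' T' \<Gamma>0' \<Gamma>1' f K"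
proof -
  have "single_valued V" "Domain V = UNIV" using V(2) by (simp_all add: standard_unitary_def)
  then obtain f where f: "clinear_on UNIV f" "V = graph_on UNIV f"
    using single_valued_csubspace_graph[OF csubspace_\<V>[OF V(1)]] by metis
  have u: "bij f" "\<exists>K. \<forall>x. norm (f x) \<le> K * norm x" "\<forall>x u. ip' (f x) (f u) = ip x u"
    using V(2) unfolding f(2) standard_unitary_graph_iff[OF f(1)] by auto
  then obtain K where K: "\<And>x. norm (f x) \<le> K * norm x" by blast
  have K': "norm (f x) \<le> (\<bar>K\<bar> + 1) * norm x" for x
    by (rule order_trans[OF K]) (intro mult_right_mono, auto)
  have "unitary_of_triples ip J T \<Gamma>0 \<Gamma>1 ip' J' T' \<Gamma>0' \<Gamma>1' f (\<bar>K\<bar> + 1)"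
    using f u K' V(1) by unfold_locales auto
  then show ?thesis using that f(2) by blast
qed

theorem unitary_iff_isomorphic:
  "(\<exists>V\<in>\<V>. standard_unitary ip ip' V) \<longleftrightarrow> isomorphic_subspaces T T'"
proof
  assume "\<exists>V\<in>\<V>. standard_unitary ip ip' V"
  then obtain V where "V \<in> \<V>" "standard_unitary ip ip' V" by blast
  then obtain f K where "unitary_of_triples ip J T \<Gamma>0 \<Gamma>1 ip' J' T' \<Gamma>0' \<Gamma>1' f K" by (rule unitary_graph)
  then show "isomorphic_subspaces T T'"
    unfolding isomorphic_subspaces_def using unitary_of_triples.homeo_T by blast
next
  assume "isomorphic_subspaces T T'"
  then show "\<exists>V\<in>\<V>. standard_unitary ip ip' V"
    unfolding isomorphic_subspaces_def using unitary_exists by blast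
qed

theorem unitary_block_form:
  assumes V: "V \<in> \<V>" "standard_unitary ip ip' V"
  shows "\<exists>B \<Theta> \<tau> b E e12 e21. unitary_parameters B \<Theta> \<tau> b \<and> bounded_selfadjoint (J' ` Y.T0) E \<and>
    has_matrix (graph_on (J' ` Y.T0) E) [J' ` T', J' ` Y.N] [J' ` T', J' ` Y.N] [[\<Theta>, e12], [e21, E0]] \<and>
    unitary_matrix V B E"
proof -
  obtain f K where fK: "V = graph_on UNIV f" "unitary_of_triples ip J T \<Gamma>0 \<Gamma>1 ip' J' T' \<Gamma>0' \<Gamma>1' f K"
    using unitary_graph[OF V] by blast
  interpret U: unitary_of_triples ip J T \<Gamma>0 \<Gamma>1 ip' J' T' \<Gamma>0' \<Gamma>1' f K by fact
  show ?thesis using U.parameters U.selfadjoint_E U.matrix_E U.matrix_V unfolding fK(1) by blast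
qed

theorem unitary_parametrization:
  "V \<in> \<V> \<and> standard_unitary ip ip' V \<and> V `` (J ` X.N) \<subseteq> orth T' \<longleftrightarrow>
    (\<exists>B \<Theta> \<tau> b E. unitary_parameters B \<Theta> \<tau> b \<and>
      graph_on (J' ` Y.T0) E = graph_sum (graph_on (J' ` Y.N) E0) (graph_on (J' ` T') \<Theta>) \<and>
      unitary_matrix V B E)"
proof
  assume "V \<in> \<V> \<and> standard_unitary ip ip' V \<and> V `` (J ` X.N) \<subseteq> orth T'"
  then have V: "V \<in> \<V>" "standard_unitary ip ip' V" "V `` (J ` X.N) \<subseteq> orth T'" by auto
  obtain f K where fK: "V = graph_on UNIV f" "unitary_of_triples ip J T \<Gamma>0 \<Gamma>1 ip' J' T' \<Gamma>0' \<Gamma>1' f K"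
    using unitary_graph[OF V(1,2)] by blast
  interpret U: unitary_of_triples ip J T \<Gamma>0 \<Gamma>1 ip' J' T' \<Gamma>0' \<Gamma>1' f K by fact
  have "f ` J ` X.N \<subseteq> orth T'" using V(3) unfolding fK(1) graph_on_def by blast
  from U.E_orthogonal_sum[OF this] U.parameters U.matrix_V
  show "\<exists>B \<Theta> \<tau> b E. unitary_parameters B \<Theta> \<tau> b \<and>
      graph_on (J' ` Y.T0) E = graph_sum (graph_on (J' ` Y.N) E0) (graph_on (J' ` T') \<Theta>) \<and>
      unitary_matrix V B E"
    unfolding fK(1) by blast
next
  assume "\<exists>B \<Theta> \<tau> b E. unitary_parameters B \<Theta> \<tau> b \<and>
      graph_on (J' ` Y.T0) E = graph_sum (graph_on (J' ` Y.N) E0) (graph_on (J' ` T') \<Theta>) \<and>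
      unitary_matrix V B E"
  then obtain B \<Theta> \<tau> b E where "unitary_parameters B \<Theta> \<tau> b"
      "graph_on (J' ` Y.T0) E = graph_sum (graph_on (J' ` Y.N) E0) (graph_on (J' ` T') \<Theta>)"
      "unitary_matrix V B E"
    by blast
  from unitary_of_parameters[OF this]
  show "V \<in> \<V> \<and> standard_unitary ip ip' V \<and> V `` (J ` X.N) \<subseteq> orth T'" by simp
qed

end

section \<open>Passage to the doubled Krein space\<close>

lemma krein_adj_eq_ip_orth: "krein_adj ip T = ip_orth (hat_ip ip) T"
proof -
  have "ip f g' = ip f' g \<longleftrightarrow> hat_ip ip (f, f') (g, g') = 0" for f f' g g'
    by (auto simp: hat_ip_def)
  then show ?thesis by (auto simp: krein_adj_def ip_orth_def)
qed

lemma boundary_triple_space_hat: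
  assumes "krein_space ip J" "csubspace T" "closed T" "krein_symmetric ip T" "boundary_triple ip T \<Gamma>0 \<Gamma>1"
  shows "boundary_triple_space (hat_ip ip) (hat_J J) T \<Gamma>0 \<Gamma>1"
proof -
  interpret krein_space "hat_ip ip" "hat_J J" by (rule krein_space_hat) fact
  have "\<i> * hat_ip ip x y = ip (fst x) (snd y) - ip (snd x) (fst y)" for x y
    by (simp add: hat_ip_def algebra_simps flip: mult.assoc)
  then show ?thesis
    using assms(2-5) unfolding krein_symmetric_def boundary_triple_def krein_adj_eq_ip_orth
    by unfold_locales auto
qed

theorem theorem5p8:
  fixes ip :: "'h::chilbert_space \<Rightarrow> 'h \<Rightarrow> complex" and J :: "'h \<Rightarrow> 'h"
    and ip' :: "'k::chilbert_space \<Rightarrow> 'k \<Rightarrow> complex" and J' :: "'k \<Rightarrow> 'k"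
    and T :: "('h \<times> 'h) set" and T' :: "('k \<times> 'k) set"
    and \<Gamma>0 \<Gamma>1 :: "'h \<times> 'h \<Rightarrow> 'l::chilbert_space"
    and \<Gamma>0' \<Gamma>1' :: "'k \<times> 'k \<Rightarrow> 'l"
    and d :: enat
    and Jh T0 N and Jh' T0' N' and G0inv G0inv' G1inv' and \<beta> \<beta>'
    and w0 w1 w01 and E0 and \<V>
  assumes "krein_space ip J" and "krein_space ip' J'"
    and "csubspace T" and "closed T" and "krein_symmetric ip T"
    and "csubspace T'" and "closed T'" and "krein_symmetric ip' T'"
    and "equal_defect ip J T d" and "equal_defect ip' J' T' d"
    and "boundary_triple ip T \<Gamma>0 \<Gamma>1" and "boundary_triple ip' T' \<Gamma>0' \<Gamma>1'"
    and "Jh = hat_J J" and "Jh' = hat_J J'"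
    and "T0 = {x \<in> krein_adj ip T. \<Gamma>0 x = 0}"
    and "T0' = {x \<in> krein_adj ip' T'. \<Gamma>0' x = 0}"
    and "N = T0 \<inter> orth T" and "N' = T0' \<inter> orth T'"
    and "G0inv = inv_into (Jh ` N) \<Gamma>0" and "G0inv' = inv_into (Jh' ` N') \<Gamma>0'"
    and "G1inv' = inv_into N' \<Gamma>1'"
    and "\<beta> = (\<lambda>l. \<Gamma>1 (G0inv l))" and "\<beta>' = (\<lambda>l. \<Gamma>1' (G0inv' l))"
    and "w0 = (\<lambda>x. Jh' (G0inv' (\<Gamma>0 (Jh x))))" and "w1 = (\<lambda>x. G1inv' (\<Gamma>1 x))"
    and "w01 = (\<lambda>x. G1inv' (\<beta> (\<Gamma>0 x) - \<beta>' (\<Gamma>0 x)))"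
    and "E0 = (\<lambda>y. (- \<i>) *\<^sub>C Jh' (G1inv' (\<beta> (\<Gamma>0' y) - \<beta>' (\<Gamma>0' y))))"
    and "\<V> = transforms (triple_graph ip T \<Gamma>0 \<Gamma>1) (triple_graph ip' T' \<Gamma>0' \<Gamma>1')"
  shows
    "((\<exists>V\<in>\<V>. single_valued V) \<longleftrightarrow> (\<exists>\<tau>. clinear_on T \<tau> \<and> \<tau> ` T = T')) \<and>
     ((\<exists>V\<in>\<V>. single_valued V \<and> single_valued (V\<inverse>) \<and> T \<subseteq> Domain V) \<longleftrightarrow>
       (\<exists>\<tau>. clinear_on T \<tau> \<and> bij_betw \<tau> T T')) \<and>
     (\<forall>V\<in>\<V>. single_valued V \<and> T \<subseteq> Domain V \<longrightarrow>
       krein_adj ip T \<subseteq> Domain V \<and>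
       (\<exists>\<tau> a12 a13 a14 a24 a34 a44.
          clinear_on T \<tau> \<and> \<tau> ` T = T' \<and> (single_valued (V\<inverse>) \<longrightarrow> bij_betw \<tau> T T') \<and>
          V \<inter> (T \<times> UNIV) = graph_on T \<tau> \<and>
          has_matrix V [T, N, Jh ` N, Jh ` T \<inter> Domain V] [T', N', Jh' ` N', Jh' ` T']
            [[\<tau>,      a12,    a13,                     a14],
             [\<lambda>_. 0, w1,     w01,                     a24],
             [\<lambda>_. 0, \<lambda>_. 0, \<lambda>x. Jh' (w0 (Jh x)),  a34],
             [\<lambda>_. 0, \<lambda>_. 0, \<lambda>_. 0,                a44]])) \<and>
     ((\<exists>V\<in>\<V>. standard_unitary (hat_ip ip) (hat_ip ip') V) \<longleftrightarrow> isomorphic_subspaces T T') \<and>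
     (\<forall>V\<in>\<V>. standard_unitary (hat_ip ip) (hat_ip ip') V \<longrightarrow>
       (\<exists>B \<Theta> \<tau> b E e12 e21.
          homeo_op (Jh' ` T0') (Jh ` T0) B \<and> bounded_selfadjoint (Jh' ` T') \<Theta> \<and>
          homeo_op T T' \<tau> \<and>
          has_matrix (graph_on (Jh' ` T0') B) [Jh' ` T', Jh' ` N'] [Jh ` T, Jh ` N]
            [[\<lambda>x. Jh (adj_op T T' \<tau> (Jh' x)), \<lambda>_. 0],
             [b,                                \<lambda>x. Jh (inv_into N w0 (Jh' x))]] \<and>
          bounded_selfadjoint (Jh' ` T0') E \<and>
          has_matrix (graph_on (Jh' ` T0') E) [Jh' ` T', Jh' ` N'] [Jh' ` T', Jh' ` N']
            [[\<Theta>,  e12],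
             [e21, E0]] \<and>
          has_matrix V [Jh ` T0, T0] [Jh' ` T0', T0']
            [[inv_into (Jh' ` T0') B, \<lambda>_. 0],
             [\<lambda>x. \<i> *\<^sub>C Jh' (E (inv_into (Jh' ` T0') B x)),
              \<lambda>x. Jh' (adj_op (Jh' ` T0') (Jh ` T0) B (Jh x))]])) \<and>
     (\<forall>V. V \<in> \<V> \<and> standard_unitary (hat_ip ip) (hat_ip ip') V \<and> V `` (Jh ` N) \<subseteq> orth T' \<longleftrightarrow>
       (\<exists>B \<Theta> \<tau> b E.
          homeo_op (Jh' ` T0') (Jh ` T0) B \<and> bounded_selfadjoint (Jh' ` T') \<Theta> \<and>
          homeo_op T T' \<tau> \<and>
          has_matrix (graph_on (Jh' ` T0') B) [Jh' ` T', Jh' ` N'] [Jh ` T, Jh ` N]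
            [[\<lambda>x. Jh (adj_op T T' \<tau> (Jh' x)), \<lambda>_. 0],
             [b,                                \<lambda>x. Jh (inv_into N w0 (Jh' x))]] \<and>
          graph_on (Jh' ` T0') E = graph_sum (graph_on (Jh' ` N') E0) (graph_on (Jh' ` T') \<Theta>) \<and>
          has_matrix V [Jh ` T0, T0] [Jh' ` T0', T0']
            [[inv_into (Jh' ` T0') B, \<lambda>_. 0],
             [\<lambda>x. \<i> *\<^sub>C Jh' (E (inv_into (Jh' ` T0') B x)),
              \<lambda>x. Jh' (adj_op (Jh' ` T0') (Jh ` T0) B (Jh x))]])) \<and>
     (closed_symmetric_op (Jh' ` T0') (Jh' ` N') E0) \<and>
     (\<forall>\<Theta> E. bounded_selfadjoint (Jh' ` T') \<Theta> \<and>
       graph_on (Jh' ` T0') E = graph_sum (graph_on (Jh' ` N') E0) (graph_on (Jh' ` T') \<Theta>) \<longrightarrow>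
       bounded_selfadjoint (Jh' ` T0') E \<and>
       graph_on (Jh' ` N') E0 \<subseteq> graph_on (Jh' ` T0') E \<and>
       graph_on (Jh' ` T0') E \<subseteq> adj_rel (Jh' ` T0') (Jh' ` T0') (graph_on (Jh' ` N') E0))"
proof -
  interpret P: two_boundary_triples "hat_ip ip" "hat_J J" T \<Gamma>0 \<Gamma>1 "hat_ip ip'" "hat_J J'" T' \<Gamma>0' \<Gamma>1'
    unfolding two_boundary_triples_def by (intro conjI boundary_triple_space_hat) fact+
  have spaces: "T0 = P.X.T0" "T0' = P.Y.T0" "N = P.X.N" "N' = P.Y.N"
    using assms(15-18) by (simp_all add: P.X.T0_def P.Y.T0_def P.X.N_def P.Y.N_def krein_adj_eq_ip_orth)
  have inverses: "G0inv = P.X.G0inv" "G0inv' = P.Y.G0inv" "G1inv' = P.Y.G1inv"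
    using assms(13,14,19-21) spaces
    by (simp_all add: P.X.G0inv_def[abs_def] P.Y.G0inv_def[abs_def] P.Y.G1inv_def[abs_def])
  have betas: "\<beta> = P.X.\<beta>" "\<beta>' = P.Y.\<beta>"
    using assms(22,23) inverses by (simp_all add: P.X.\<beta>_def[abs_def] P.Y.\<beta>_def[abs_def])
  have maps: "w0 = P.w0" "w1 = P.w1" "w01 = P.w01" "E0 = P.E0" "\<V> = P.\<V>"
    using assms(13,14,24-28) inverses betas
    by (simp_all add: P.w0_def[abs_def] P.w1_def[abs_def] P.w01_def[abs_def] P.E0_def[abs_def] P.\<V>_def
        triple_graph_def krein_adj_eq_ip_orth)
  note in_locale = assms(13,14) spaces maps krein_adj_eq_ip_orth[of ip T]
  note unfold = P.unitary_parameters_def P.unitary_matrix_def conj_assoc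
  show ?thesis
    unfolding in_locale
  proof (intro conjI)
    show "(\<exists>V\<in>P.\<V>. single_valued V) \<longleftrightarrow> (\<exists>\<tau>. clinear_on T \<tau> \<and> \<tau> ` T = T')"
      by (rule P.operator_iff_surjection)
    show "(\<exists>V\<in>P.\<V>. single_valued V \<and> single_valued (V\<inverse>) \<and> T \<subseteq> Domain V) \<longleftrightarrow>
       (\<exists>\<tau>. clinear_on T \<tau> \<and> bij_betw \<tau> T T')"
      by (rule P.injective_operator_iff_bijection)
    show "(\<exists>V\<in>P.\<V>. standard_unitary (hat_ip ip) (hat_ip ip') V) \<longleftrightarrow> isomorphic_subspaces T T'"
      by (rule P.unitary_iff_isomorphic)
    show "closed_symmetric_op (hat_J J' ` P.Y.T0) (hat_J J' ` P.Y.N) P.E0"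
      by (rule P.closed_symmetric_E0)
  qed ((intro ballI impI, elim conjE, rule P.operator_matrix, assumption+) |
       (intro ballI impI, rule P.unitary_block_form[unfolded unfold], assumption+) |
       (intro allI, rule P.unitary_parametrization[unfolded unfold]) |
       (intro allI impI conjI, (elim conjE, (rule P.orthogonal_sum_selfadjoint P.orthogonal_sum_canonical, assumption+))+))+
qed

end
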